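(* Let $\Omega$ be a connected open subset of $\mathbb{C}^n$ and let $\omega$ and $\omega'$ be two non-empty open and relatively compact subsets of $\Omega$. There is a positive constant $C$ depending only on $\Omega$, $\omega$ and $\omega'$ such that the following holds. Let $F:\Omega\to[-\infty,0)$ be a negative separately subharmonic function. Then for every real number $k>0$ there is a compact set $L\subset\omega$ such that (i) $F|_L$ is finite and $k$-Lipschitz; (ii) $|\omega\setminus L|\le \frac{C}{k^2}\,|F(\xi)|^2$ for every $\xi\in\omega'$.
   Context: A function $F:\Omega\to[-\infty,\infty)$ on an open set $\Omega\subset\mathbb{C}^n$ is separately subharmonic if for every $\xi=(\xi_1,\dots,\xi_n)\in\mathbb{C}^n$ and every $j=1,\dots,n$ the partial function $z\mapsto F(\xi_1,\dots,\xi_{j-1},z,\xi_{j+1},\dots,\xi_n)$ is subharmonic in its domain of definition $\{z\in\mathbb{C} : (\xi_1,\dots,\xi_{j-1},z,\xi_{j+1},\dots,\xi_n)\in\Omega\}$ (subharmonic functions are allowed to be identically $-\infty$ on connected components). $|E|$ denotes the Lebesgue measure of $E\subset\mathbb{C}^n\simeq\mathbb{R}^{2n}$. "$F|_L$ is $k$-Lipschitz" means $|F(x)-F(y)|\le k|x-y|$ for all $x,y\in L$. The empty set is an allowed compact set, and $|F(\xi)|^2=+\infty$ if $F(\xi)=-\infty$. *)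

theory Defs
  imports "HOL-Analysis.Analysis"
begin

definition upper_semicontinuous_on :: "'a::topological_space set \<Rightarrow> ('a \<Rightarrow> ereal) \<Rightarrow> bool" where
  "upper_semicontinuous_on U u \<longleftrightarrow> (\<forall>c. openin (top_of_set U) {z \<in> U. u z < c})"

(* The mean value (1/2pi) * (integral of u (z + r e^{it}) over 0 <= t <= 2pi), with values in
   [-oo,oo], as the integral of the positive part minus that of the negative part
   (e2ennreal sends negative numbers to 0).  If u is upper semicontinuous and < oo on the circle,
   the positive part is bounded, so oo - oo does not occur. *)
definition circle_mean :: "(complex \<Rightarrow> ereal) \<Rightarrow> complex \<Rightarrow> real \<Rightarrow> ereal" where
  "circle_mean u z r =
     (enn2ereal (\<integral>\<^sup>+t\<in>{0..2*pi}. e2ennreal (u (z + rcis r t)) \<partial>lborel)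
      - enn2ereal (\<integral>\<^sup>+t\<in>{0..2*pi}. e2ennreal (- u (z + rcis r t)) \<partial>lborel)) / ereal (2*pi)"

(* Values of u outside U are irrelevant, and u may be identically -oo on components of U. *)
definition subharmonic_on :: "complex set \<Rightarrow> (complex \<Rightarrow> ereal) \<Rightarrow> bool" where
  "subharmonic_on U u \<longleftrightarrow>
     open U \<and> (\<forall>z\<in>U. u z < \<infinity>) \<and> upper_semicontinuous_on U u \<and>
     (\<forall>z r. r > 0 \<and> cball z r \<subseteq> U \<longrightarrow> u z \<le> circle_mean u z r)"

definition replace_coord :: "complex ^ 'n \<Rightarrow> 'n \<Rightarrow> complex \<Rightarrow> complex ^ 'n" where
  "replace_coord \<xi> j z = (\<chi> i. if i = j then z else \<xi> $ i)"

definition separately_subharmonic_on ::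
    "(complex ^ 'n) set \<Rightarrow> (complex ^ 'n \<Rightarrow> ereal) \<Rightarrow> bool" where
  "separately_subharmonic_on \<Omega> F \<longleftrightarrow>
     (\<forall>\<xi> j. subharmonic_on {z. replace_coord \<xi> j z \<in> \<Omega>} (\<lambda>z. F (replace_coord \<xi> j z)))"

definition relatively_compact_in :: "'a::topological_space set \<Rightarrow> 'a set \<Rightarrow> bool" where
  "relatively_compact_in A \<Omega> \<longleftrightarrow> compact (closure A) \<and> closure A \<subseteq> \<Omega>"

end

theory Submission
  imports Defs "HOL-Complex_Analysis.Complex_Analysis"
begin

text \<open>
  Let \<open>G = - F\<close>, extended by \<open>0\<close>, a non-negative separately superharmonic function. Averaging over discs
  in one coordinate at a time and Fatou's lemma show that \<open>G\<close> is jointly lower semicontinuous.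
  Let \<open>V\<^sub>s\<close> be the mean with a radial cone kernel of radius \<open>s\<close> in \<open>\<complex>\<^sup>n\<close>. It increases to \<open>G\<close> as
  \<open>s\<close> decreases to \<open>0\<close>, and \<open>V\<^sub>s G - V\<^sub>2\<^sub>s G\<close> splits into \<open>n\<close> non-negative differences \<open>D\<^sub>j\<close>, in each
  of which only the scale of the \<open>j\<close>-th coordinate changes. Since
  \<open>V\<^sub>s V\<^sub>s - V\<^sub>2\<^sub>s V\<^sub>2\<^sub>s = (V\<^sub>s + V\<^sub>2\<^sub>s) (V\<^sub>s - V\<^sub>2\<^sub>s)\<close> and the kernel is Lipschitz, summing over dyadic \<open>s\<close> gives
  \<open>G x \<le> G y + C \<bar>x - y\<bar> T x\<close> for all \<open>y\<close> near \<open>x\<close>, where \<open>T\<close> is the sum of the means of \<open>D\<^sub>j / s\<close>.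

  The set where \<open>T\<close> exceeds \<open>k\<close> is small for two reasons. By the comparison of circle means with the
  logarithm, every \<open>D\<^sub>j\<close> is bounded by the mass \<open>N\<^sub>j\<close> of \<open>G\<close> on the slice in the \<open>j\<close>-th coordinate, which
  controls the scales \<open>s \<ge> N\<^sub>j / k\<close> pointwise. By a second order cancellation, the integral of \<open>D\<^sub>j\<close> over
  such a slice is \<open>O(s\<^sup>2 N\<^sub>j)\<close>, which controls the scales \<open>s < N\<^sub>j / k\<close> by Markov's inequality. Hence
  the measure is \<open>O(k\<^sup>-\<^sup>2)\<close> times the integral of \<open>G\<^sup>2\<close>, and the latter is at most a multiple of \<open>G(\<xi>)\<^sup>2\<close>: one
  coordinate at a time near \<open>\<xi>\<close>, and then by a chain of overlapping balls.
\<close>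

section \<open>Invariance of Lebesgue measure\<close>

text \<open>The obstacle is the weight \<open>1 / s\<close> in the Lipschitz sum: with the pointwise
  bound of \<open>D\<^sub>j\<close> by \<open>N\<^sub>j\<close> alone, the sum over dyadic
  \<open>s\<close> diverges. The two estimates meet at \<open>s = N\<^sub>j / k\<close>. Above it,
  the terms \<open>N\<^sub>j / s\<close> form a geometric sum dominated by the smallest scale, hence
  of order \<open>k\<close>. Below it, the integrals of \<open>D\<^sub>j / s\<close> are of order
  \<open>s N\<^sub>j\<close> and sum to about \<open>N\<^sub>j\<^sup>2 / k\<close>; Markov's
  inequality at height \<open>k\<close> then supplies the exponent 2. The threshold varies from
  slice to slice but not along a slice, because \<open>N\<^sub>j\<close> is taken over a disc that
  is fixed in the \<open>j\<close>-th coordinate; so the cutoff survives the shift of the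
  \<open>j\<close>-th variable on which the cancellation rests. The kernel is radial in all
  variables together, hence invariant under rotation of a single coordinate; this reduces each
  comparison of means to circle means in one variable. Since \<open>F\<close> may be minus infinity,
  means are compared by adding non-negative terms in \<open>ennreal\<close>, and finiteness is
  secured before a term is cancelled.\<close>

lemma nn_integral_lborel_shift:
  fixes f :: "'a::euclidean_space \<Rightarrow> ennreal"
  assumes [measurable]: "f \<in> borel_measurable borel"
  shows "(\<integral>\<^sup>+x. f (x + a) \<partial>lborel) = (\<integral>\<^sup>+x. f x \<partial>lborel)"
proof -
  have "(\<integral>\<^sup>+x. f x \<partial>lborel) = (\<integral>\<^sup>+x. f x \<partial>distr lborel borel ((+) a))"
    by (simp add: lborel_distr_plus)
  also have "\<dots> = (\<integral>\<^sup>+x. f (x + a) \<partial>lborel)"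
    by (subst nn_integral_distr) (simp_all add: add.commute)
  finally show ?thesis ..
qed

lemma nn_integral_lborel_uminus:
  fixes f :: "'a::euclidean_space \<Rightarrow> ennreal"
  assumes [measurable]: "f \<in> borel_measurable borel"
  shows "(\<integral>\<^sup>+x. f (- x) \<partial>lborel) = (\<integral>\<^sup>+x. f x \<partial>lborel)"
  by (subst (2) lborel_affine[of "-1" 0])
     (simp_all add: nn_integral_density nn_integral_distr)

lemma nn_integral_lborel_scaleR:
  fixes f :: "'a::euclidean_space \<Rightarrow> ennreal"
  assumes [measurable]: "f \<in> borel_measurable borel" and s: "s > 0"
  shows "(\<integral>\<^sup>+x. f x \<partial>lborel) = ennreal (s ^ DIM('a)) * (\<integral>\<^sup>+x. f (a + s *\<^sub>R x) \<partial>lborel)"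
  using s
  by (subst lborel_affine[of s a])
     (simp_all add: nn_integral_density nn_integral_distr nn_integral_cmult)

lemma lborel_tonelli:
  fixes f :: "'a::euclidean_space \<Rightarrow> 'b::euclidean_space \<Rightarrow> ennreal"
  assumes "(\<lambda>(x, y). f x y) \<in> borel_measurable (borel \<Otimes>\<^sub>M borel)"
  shows "(\<integral>\<^sup>+x. (\<integral>\<^sup>+y. f x y \<partial>lborel) \<partial>lborel) = (\<integral>\<^sup>+y. (\<integral>\<^sup>+x. f x y \<partial>lborel) \<partial>lborel)"
proof -
  have "(\<lambda>(x, y). f x y) \<in> borel_measurable (lborel \<Otimes>\<^sub>M lborel)"
    using assms by (simp cong: measurable_cong_sets)
  from lborel_pair.Fubini'[OF this] show ?thesis by simp
qed

text \<open>Only translation invariance is used, so no product decomposition of \<open>lborel\<close> is needed.\<close>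

lemma lborel_disintegration:
  fixes e :: "'b::euclidean_space \<Rightarrow> 'a::euclidean_space" and \<pi> :: "'a \<Rightarrow> 'b"
  assumes [measurable]: "f \<in> borel_measurable borel" "q \<in> borel_measurable borel"
      "e \<in> borel_measurable borel" "\<pi> \<in> borel_measurable borel"
    and \<pi>: "\<And>x v. \<pi> (x + e v) = \<pi> x + v" and e: "\<And>v. e (- v) = - e v"
  shows "(\<integral>\<^sup>+x. q (\<pi> x) * (\<integral>\<^sup>+v. f (x + e v) \<partial>lborel) \<partial>lborel) =
         (\<integral>\<^sup>+v. q v \<partial>lborel) * (\<integral>\<^sup>+x. f x \<partial>lborel)"
proof -
  have "(\<integral>\<^sup>+x. q (\<pi> x) * (\<integral>\<^sup>+v. f (x + e v) \<partial>lborel) \<partial>lborel)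
      = (\<integral>\<^sup>+x. (\<integral>\<^sup>+v. q (\<pi> x) * f (x + e v) \<partial>lborel) \<partial>lborel)"
    by (simp add: nn_integral_cmult)
  also have "\<dots> = (\<integral>\<^sup>+v. (\<integral>\<^sup>+x. q (\<pi> x) * f (x + e v) \<partial>lborel) \<partial>lborel)"
    by (rule lborel_tonelli) measurable
  also have "\<dots> = (\<integral>\<^sup>+v. (\<integral>\<^sup>+x. q (\<pi> x - v) * f x \<partial>lborel) \<partial>lborel)"
  proof (rule nn_integral_cong)
    fix v :: 'b
    have eq: "\<pi> (x + e v) - v = \<pi> x" for x using \<pi> by simp
    show "(\<integral>\<^sup>+x. q (\<pi> x) * f (x + e v) \<partial>lborel) = (\<integral>\<^sup>+x. q (\<pi> x - v) * f x \<partial>lborel)"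
      by (subst nn_integral_lborel_shift[of "\<lambda>x. q (\<pi> x - v) * f x" "e v", symmetric])
         (simp_all add: eq)
  qed
  also have "\<dots> = (\<integral>\<^sup>+x. (\<integral>\<^sup>+v. q (\<pi> x - v) * f x \<partial>lborel) \<partial>lborel)"
    by (rule lborel_tonelli) measurable
  also have "\<dots> = (\<integral>\<^sup>+x. (\<integral>\<^sup>+v. q v \<partial>lborel) * f x \<partial>lborel)"
  proof (rule nn_integral_cong)
    fix x :: 'a
    have "(\<integral>\<^sup>+v. q (\<pi> x - v) \<partial>lborel) = (\<integral>\<^sup>+v. q (v + \<pi> x) \<partial>lborel)"
      by (subst nn_integral_lborel_uminus[of "\<lambda>v. q (v + \<pi> x)", symmetric]) (simp_all)
    also have "\<dots> = (\<integral>\<^sup>+v. q v \<partial>lborel)"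
      by (rule nn_integral_lborel_shift) simp
    finally show "(\<integral>\<^sup>+v. q (\<pi> x - v) * f x \<partial>lborel) = (\<integral>\<^sup>+v. q v \<partial>lborel) * f x"
      by (simp add: nn_integral_multc)
  qed
  also have "\<dots> = (\<integral>\<^sup>+v. q v \<partial>lborel) * (\<integral>\<^sup>+x. f x \<partial>lborel)"
    by (simp add: nn_integral_cmult)
  finally show ?thesis .
qed

text \<open>Weighting by \<open>q (\<pi> x)\<close> with \<open>q\<close> of integral 1 turns the
  integral over the whole space into one over the fibres \<open>x + e v\<close>, by
  \<open>lborel_disintegration\<close>; on a fibre only the invariance of \<open>T x\<close> is left
  to use. Shears of the plane and rotations of one coordinate of a vector are both of this
  kind.\<close>

lemma lborel_fibre_invariance:
  fixes e :: "'b::euclidean_space \<Rightarrow> 'a::euclidean_space" and \<pi> :: "'a \<Rightarrow> 'b" and T :: "'a \<Rightarrow> 'b \<Rightarrow> 'b"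
  assumes [measurable]: "f \<in> borel_measurable borel"
      "e \<in> borel_measurable borel" "\<pi> \<in> borel_measurable borel"
      "(\<lambda>x. T x (\<pi> x)) \<in> borel_measurable borel"
    and [measurable]: "\<And>x. T x \<in> borel_measurable borel"
    and \<pi>: "\<And>x v. \<pi> (x + e v) = \<pi> x + v" and e: "\<And>v. e (- v) = - e v" "\<And>v w. e (v + w) = e v + e w"
    and T: "\<And>x v. T (x + e v) = T x"
    and inv: "\<And>x g. g \<in> borel_measurable borel \<Longrightarrow> (\<integral>\<^sup>+v. g (T x v) \<partial>lborel) = (\<integral>\<^sup>+v. g v \<partial>lborel)"
  shows "(\<integral>\<^sup>+x. f (x - e (\<pi> x) + e (T x (\<pi> x))) \<partial>lborel) = (\<integral>\<^sup>+x. f x \<partial>lborel)"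
proof -
  define q :: "'b \<Rightarrow> ennreal" where "q = indicator (cbox 0 One)"
  have q: "q \<in> borel_measurable borel" unfolding q_def by simp
  have q1: "(\<integral>\<^sup>+v. q v \<partial>lborel) = 1"
    by (simp add: q_def)
  let ?R = "\<lambda>x. x - e (\<pi> x) + e (T x (\<pi> x))"
  have "(\<integral>\<^sup>+x. f (?R x) \<partial>lborel) = (\<integral>\<^sup>+x. q (\<pi> x) * (\<integral>\<^sup>+v. f (?R (x + e v)) \<partial>lborel) \<partial>lborel)"
    using lborel_disintegration[where f = "\<lambda>x. f (?R x)" and q = q and e = e and \<pi> = \<pi>, OF _ q] \<pi> e q1
    by simp
  also have "\<dots> = (\<integral>\<^sup>+x. q (\<pi> x) * (\<integral>\<^sup>+v. f (x + e v) \<partial>lborel) \<partial>lborel)"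
  proof (rule nn_integral_cong, rule arg_cong2[where f = "(*)"], rule refl)
    fix x :: 'a
    have R: "?R (x + e v) = x - e (\<pi> x) + e (T x (v + \<pi> x))" for v
      unfolding \<pi> T e(2) by (simp add: add.commute)
    have "(\<integral>\<^sup>+v. f (?R (x + e v)) \<partial>lborel) = (\<integral>\<^sup>+v. f (x - e (\<pi> x) + e (T x (v + \<pi> x))) \<partial>lborel)"
      unfolding R ..
    also have "\<dots> = (\<integral>\<^sup>+v. f (x - e (\<pi> x) + e (T x v)) \<partial>lborel)"
      by (rule nn_integral_lborel_shift[where f = "\<lambda>v. f (x - e (\<pi> x) + e (T x v))"]) simp
    also have "\<dots> = (\<integral>\<^sup>+v. f (x - e (\<pi> x) + e v) \<partial>lborel)"
      by (rule inv) simp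
    also have "\<dots> = (\<integral>\<^sup>+v. f (x - e (\<pi> x) + e (v + \<pi> x)) \<partial>lborel)"
      by (rule nn_integral_lborel_shift[symmetric, where f = "\<lambda>v. f (x - e (\<pi> x) + e v)"]) simp
    also have "\<dots> = (\<integral>\<^sup>+v. f (x + e v) \<partial>lborel)"
      by (simp add: e algebra_simps)
    finally show "(\<integral>\<^sup>+v. f (?R (x + e v)) \<partial>lborel) = (\<integral>\<^sup>+v. f (x + e v) \<partial>lborel)" .
  qed
  also have "\<dots> = (\<integral>\<^sup>+x. f x \<partial>lborel)"
    using lborel_disintegration[where f = f and q = q and e = e and \<pi> = \<pi>, OF _ q] \<pi> e q1 by simp
  finally show ?thesis .
qed

section \<open>Shears and rotations of the plane\<close>

lemma nn_integral_complex_shear_Re: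
  assumes [measurable]: "f \<in> borel_measurable borel"
  shows "(\<integral>\<^sup>+z. f (z + of_real (p * Im z)) \<partial>lborel) = (\<integral>\<^sup>+z. f z \<partial>lborel)"
  using lborel_fibre_invariance[of f complex_of_real Re "\<lambda>z v. v + p * Im z"]
  by (simp add: nn_integral_lborel_shift algebra_simps flip: of_real_mult)

lemma nn_integral_complex_shear_Im:
  assumes [measurable]: "f \<in> borel_measurable borel"
  shows "(\<integral>\<^sup>+z. f (z + \<i> * of_real (p * Re z)) \<partial>lborel) = (\<integral>\<^sup>+z. f z \<partial>lborel)"
  using lborel_fibre_invariance[of f "\<lambda>v. \<i> * complex_of_real v" Im "\<lambda>z v. v + p * Re z"]
  by (simp add: nn_integral_lborel_shift algebra_simps flip: of_real_mult)

text \<open>A rotation that is not \<open>\<plusminus>1\<close> is a product of three shears.\<close>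

lemma nn_integral_complex_rotate:
  fixes u :: complex
  assumes [measurable]: "f \<in> borel_measurable borel" and u: "norm u = 1"
  shows "(\<integral>\<^sup>+z. f (u * z) \<partial>lborel) = (\<integral>\<^sup>+z. f z \<partial>lborel)"
proof (cases "Im u = 0")
  case True
  then have "u = 1 \<or> u = -1"
    using u by (auto simp: complex_eq_iff cmod_def)
  then show ?thesis
    by (auto simp: nn_integral_lborel_uminus)
next
  case False
  \<comment> \<open>For \<open>u = cis t\<close> this is \<open>- tan (t / 2)\<close>. Rotation by
    \<open>t\<close> is the real shear with factor \<open>- tan (t / 2)\<close>, then the imaginary
    shear with factor \<open>sin t\<close>, then the first shear again.\<close>
  define p where "p = (Re u - 1) / Im u"
  define A where "A z = z + complex_of_real (p * Im z)" for z
  define B where "B z = z + \<i> * complex_of_real (Im u * Re z)" for z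
  have 1: "(Re u)\<^sup>2 + (Im u)\<^sup>2 = 1"
    using u by (simp add: cmod_def)
  have eq: "u * z = A (B (A z))" for z
  proof -
    have "p * Im u = Re u - 1" using False by (simp add: p_def)
    moreover have "p * (1 + Re u) = - Im u"
      using 1 False by (simp add: p_def field_simps power2_eq_square)
    ultimately show ?thesis
      unfolding A_def B_def complex_eq_iff by simp (auto; algebra)
  qed
  have [measurable]: "A \<in> borel_measurable borel" "B \<in> borel_measurable borel"
    unfolding A_def[abs_def] B_def[abs_def] by measurable
  have "(\<integral>\<^sup>+z. f (u * z) \<partial>lborel) = (\<integral>\<^sup>+z. f (A (B (A z))) \<partial>lborel)"
    by (simp add: eq)
  also have "\<dots> = (\<integral>\<^sup>+z. f (A (B z)) \<partial>lborel)"
    using nn_integral_complex_shear_Re[of "\<lambda>z. f (A (B z))" p] by (simp add: A_def)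
  also have "\<dots> = (\<integral>\<^sup>+z. f (A z) \<partial>lborel)"
    using nn_integral_complex_shear_Im[of "\<lambda>z. f (A z)" "Im u"] by (simp add: B_def)
  also have "\<dots> = (\<integral>\<^sup>+z. f z \<partial>lborel)"
    using nn_integral_complex_shear_Re[of f p] by (simp add: A_def)
  finally show ?thesis .
qed

section \<open>Lower semicontinuity and circle means\<close>

definition lsc :: "('a::topological_space \<Rightarrow> ennreal) \<Rightarrow> bool" where
  "lsc f \<longleftrightarrow> (\<forall>c. open {x. c < f x})"

lemma lsc_borel_measurable: "lsc f \<Longrightarrow> f \<in> borel_measurable borel"
  by (rule borel_measurableI_greater) (simp add: lsc_def)

lemma lsc_liminf:
  assumes "lsc f" "(X \<longlongrightarrow> x) F"
  shows "f x \<le> Liminf F (\<lambda>n. f (X n))"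
  unfolding le_Liminf_iff
proof (intro allI impI)
  fix c assume "c < f x"
  then have "x \<in> {x. c < f x}" "open {x. c < f x}"
    using assms(1) by (simp_all add: lsc_def)
  with assms(2) have "eventually (\<lambda>n. X n \<in> {x. c < f x}) F"
    using topological_tendstoD by blast
  then show "eventually (\<lambda>n. c < f (X n)) F" by simp
qed

lemma lscI_sequentially:
  fixes f :: "'a::metric_space \<Rightarrow> ennreal"
  assumes "\<And>X x. X \<longlonglongrightarrow> x \<Longrightarrow> f x \<le> liminf (\<lambda>n. f (X n))"
  shows "lsc f"
  unfolding lsc_def
proof
  fix c
  have "closed {x. f x \<le> c}"
    unfolding closed_sequential_limits
  proof (intro allI impI, elim conjE)
    fix X x assume "\<forall>n. X n \<in> {x. f x \<le> c}" "X \<longlonglongrightarrow> x"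
    then have "f x \<le> liminf (\<lambda>n. f (X n))" "liminf (\<lambda>n. f (X n)) \<le> c"
      using assms[of X x] by (auto intro!: Liminf_le)
    then show "x \<in> {x. f x \<le> c}" by simp
  qed
  then have "open (- {x. f x \<le> c})" by (simp add: open_closed)
  also have "- {x. f x \<le> c} = {x. c < f x}" by auto
  finally show "open {x. c < f x}" .
qed

lemma lsc_compose:
  assumes "lsc f" "continuous_on UNIV k"
  shows "lsc (\<lambda>x. f (k x))"
  unfolding lsc_def
proof
  fix c
  have "open (k -` {x. c < f x})"
    using assms by (intro open_vimage) (simp_all add: lsc_def)
  then show "open {x. c < f (k x)}" by (simp add: vimage_def)
qed

text \<open>Fatou's lemma, which asks for no dominating function since the values are in
  \<open>ennreal\<close>. Circle means inherit lower semicontinuity this way.\<close>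

lemma lsc_nn_integral:
  fixes f :: "'b::metric_space \<Rightarrow> ennreal" and k :: "'a::metric_space \<Rightarrow> 'c \<Rightarrow> 'b"
  assumes "lsc f" and k: "\<And>y. continuous_on UNIV (\<lambda>x. k x y)"
    and "\<And>x. k x \<in> measurable M borel"
  shows "lsc (\<lambda>x. \<integral>\<^sup>+y. f (k x y) \<partial>M)"
proof (rule lscI_sequentially)
  fix X and x :: 'a assume X: "X \<longlonglongrightarrow> x"
  have m: "(\<lambda>y. f (k (X n) y)) \<in> borel_measurable M" for n
    by (rule measurable_compose[OF assms(3) lsc_borel_measurable[OF assms(1)]])
  have "(\<integral>\<^sup>+y. f (k x y) \<partial>M) \<le> (\<integral>\<^sup>+y. liminf (\<lambda>n. f (k (X n) y)) \<partial>M)"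
  proof (rule nn_integral_mono)
    fix y
    have "(\<lambda>n. k (X n) y) \<longlonglongrightarrow> k x y"
      by (rule continuous_on_tendsto_compose[OF k[of y] X]) simp_all
    from lsc_liminf[OF assms(1) this]
    show "f (k x y) \<le> liminf (\<lambda>n. f (k (X n) y))" .
  qed
  also have "\<dots> \<le> liminf (\<lambda>n. \<integral>\<^sup>+y. f (k (X n) y) \<partial>M)"
    using m by (intro nn_integral_liminf)
  finally show "(\<integral>\<^sup>+y. f (k x y) \<partial>M) \<le> liminf (\<lambda>n. \<integral>\<^sup>+y. f (k (X n) y) \<partial>M)" .
qed

text \<open>Without a minimum, the open sets \<open>{x. f c < f x}\<close> with \<open>c\<close> in
  \<open>K\<close> would cover \<open>K\<close>; in a finite subcover, the centre with the smallest
  value lies in none of the chosen sets.\<close>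

lemma lsc_attains_inf:
  assumes K: "compact K" "K \<noteq> {}" and f: "\<And>c. open {x. c < f x}"
  shows "\<exists>x\<in>K. \<forall>y\<in>K. (f x :: 'b::linorder) \<le> f y"
proof (rule ccontr)
  assume contra: "\<not> ?thesis"
  then have *: "K \<subseteq> \<Union>((\<lambda>c. {x. f c < f x}) ` K)"
    by (auto simp: not_le)
  obtain D where D: "D \<subseteq> K" "finite D" "K \<subseteq> \<Union>((\<lambda>c. {x. f c < f x}) ` D)"
    by (rule compactE_image[OF K(1) _ *]) (use f in auto)
  have "f ` D \<noteq> {}" using D K by auto
  then have "Min (f ` D) \<in> f ` D" using D by (intro Min_in) auto
  then obtain c where c: "c \<in> D" "f c = Min (f ` D)" by auto
  then obtain c' where "c' \<in> D" "f c' < f c" using D by auto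
  moreover have "f c \<le> f c'" using c D \<open>c' \<in> D\<close> by auto
  ultimately show False by simp
qed

section \<open>Normalised arc length on the unit circle\<close>

definition circle :: "complex measure" where
  "circle = distr (density lborel (indicator {0..1})) borel (\<lambda>x. cis (2 * pi * x))"

lemma sets_circle[simp, measurable_cong]: "sets circle = sets borel"
  by (simp add: circle_def)

lemma space_circle[simp]: "space circle = UNIV"
  by (simp add: circle_def)

lemma cis_measurable[measurable]: "cis \<in> borel_measurable borel"
  by (intro borel_measurable_continuous_onI continuous_intros)

lemma nn_integral_circle:
  assumes [measurable]: "f \<in> borel_measurable borel"
  shows "(\<integral>\<^sup>+u. f u \<partial>circle) = (\<integral>\<^sup>+x\<in>{0..1}. f (cis (2 * pi * x)) \<partial>lborel)"
  unfolding circle_def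
  by (subst nn_integral_distr) (simp_all add: nn_integral_density mult.commute)

lemma emeasure_circle[simp]: "emeasure circle UNIV = 1"
  using nn_integral_circle[of "\<lambda>_. 1"] by simp

interpretation circle: finite_measure circle
  by (rule finite_measureI) simp

lemma AE_circle: "AE u in circle. norm u = 1"
  unfolding circle_def by (subst AE_distr_iff) (auto)

lemma nn_integral_circle_cong:
  assumes "\<And>u. norm u = 1 \<Longrightarrow> f u = g u"
  shows "(\<integral>\<^sup>+u. f u \<partial>circle) = (\<integral>\<^sup>+u. g u \<partial>circle)"
  by (rule nn_integral_cong_AE) (use AE_circle in \<open>eventually_elim, simp add: assms\<close>)

lemma nn_integral_circle_mono:
  assumes "\<And>u. norm u = 1 \<Longrightarrow> f u \<le> g u"
  shows "(\<integral>\<^sup>+u. f u \<partial>circle) \<le> (\<integral>\<^sup>+u. g u \<partial>circle)"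
  by (rule nn_integral_mono_AE) (use AE_circle in \<open>eventually_elim, simp add: assms\<close>)

lemma nn_integral_circle_const[simp]: "(\<integral>\<^sup>+u. c \<partial>circle) = c"
  by simp

text \<open>In the parameter a rotation shifts \<open>{0..1}\<close> to \<open>{s..s+1}\<close>, and
  periodicity moves the piece beyond 1 back to \<open>{0<..s}\<close>. Left endpoints are discarded
  as null sets so that the pieces are disjoint.\<close>

lemma nn_integral_circle_rotate:
  assumes [measurable]: "f \<in> borel_measurable borel" and w: "norm w = 1"
  shows "(\<integral>\<^sup>+u. f (w * u) \<partial>circle) = (\<integral>\<^sup>+u. f u \<partial>circle)"
proof -
  define s where "s = Arg2pi w / (2 * pi)"
  have s: "0 \<le> s" "s < 1"
    using Arg2pi[of w] by (simp_all add: s_def)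
  have "w = cis (2 * pi * s)"
    using Arg2pi_eq[of w] w by (simp add: s_def cis_conv_exp)
  then have w: "w * cis (2 * pi * x) = cis (2 * pi * (x + s))" for x
    by (simp add: cis_mult algebra_simps)
  define g where "g x = f (cis (2 * pi * x))" for x
  have [measurable]: "g \<in> borel_measurable borel"
    unfolding g_def[abs_def] by measurable
  have per: "g (x + 1) = g x" for x
  proof -
    have "cis (2 * pi * (x + 1)) = cis (2 * pi * x)"
      by (simp add: distrib_left flip: cis_mult)
    then show ?thesis by (simp add: g_def)
  qed
  have ae: "(\<integral>\<^sup>+x. g x * indicator {a..b} x \<partial>lborel) = (\<integral>\<^sup>+x. g x * indicator {a<..b} x \<partial>lborel)" for a b
    by (rule nn_integral_cong_AE)
       (use AE_lborel_singleton[of a] in \<open>eventually_elim, auto simp: indicator_def\<close>)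
  have "(\<integral>\<^sup>+u. f (w * u) \<partial>circle) = (\<integral>\<^sup>+x. g (x + s) * indicator {0..1} x \<partial>lborel)"
    by (simp add: nn_integral_circle w g_def)
  also have "\<dots> = (\<integral>\<^sup>+x. g (x + s) * indicator {s..s+1} (x + s) \<partial>lborel)"
    by (intro nn_integral_cong arg_cong2[where f = "(*)"] refl) (auto simp: indicator_def)
  also have "\<dots> = (\<integral>\<^sup>+x. g x * indicator {s..s+1} x \<partial>lborel)"
    by (rule nn_integral_lborel_shift[where f = "\<lambda>x. g x * indicator {s..s+1} x"]) measurable
  also have "\<dots> = (\<integral>\<^sup>+x. g x * indicator {s<..s+1} x \<partial>lborel)"
    by (rule ae)
  also have "\<dots> = (\<integral>\<^sup>+x. g x * indicator {s<..1} x + g x * indicator {1<..s+1} x \<partial>lborel)"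
    by (rule nn_integral_cong) (use s in \<open>auto simp: indicator_def\<close>)
  also have "\<dots> = (\<integral>\<^sup>+x. g x * indicator {s<..1} x \<partial>lborel) + (\<integral>\<^sup>+x. g x * indicator {1<..s+1} x \<partial>lborel)"
    by (rule nn_integral_add) measurable
  also have "(\<integral>\<^sup>+x. g x * indicator {1<..s+1} x \<partial>lborel) = (\<integral>\<^sup>+x. g (x + 1) * indicator {1<..s+1} (x + 1) \<partial>lborel)"
    by (rule nn_integral_lborel_shift[symmetric, where f = "\<lambda>x. g x * indicator {1<..s+1} x"]) measurable
  also have "\<dots> = (\<integral>\<^sup>+x. g x * indicator {0<..s} x \<partial>lborel)"
    by (rule nn_integral_cong) (auto simp: indicator_def per)
  also have "(\<integral>\<^sup>+x. g x * indicator {s<..1} x \<partial>lborel) + (\<integral>\<^sup>+x. g x * indicator {0<..s} x \<partial>lborel)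
      = (\<integral>\<^sup>+x. g x * indicator {s<..1} x + g x * indicator {0<..s} x \<partial>lborel)"
    by (rule nn_integral_add[symmetric]) measurable
  also have "\<dots> = (\<integral>\<^sup>+x. g x * indicator {0<..1} x \<partial>lborel)"
    by (rule nn_integral_cong) (use s in \<open>auto simp: indicator_def\<close>)
  also have "\<dots> = (\<integral>\<^sup>+u. f u \<partial>circle)"
    unfolding ae[symmetric] by (simp add: nn_integral_circle g_def)
  finally show ?thesis .
qed

lemma integral_circle:
  fixes f :: "complex \<Rightarrow> 'a::{euclidean_space}"
  assumes f: "continuous_on (sphere 0 1) f"
  shows "f \<in> borel_measurable borel \<Longrightarrow> integrable circle f"
    "f \<in> borel_measurable borel \<Longrightarrow> (\<integral>u. f u \<partial>circle) = integral {0..1} (\<lambda>x. f (cis (2 * pi * x)))"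
proof -
  \<comment> \<open>The cutoff makes continuity on the unit circle alone yield Borel measurability,
    and \<open>g\<close> agrees with \<open>f\<close> almost everywhere for
    \<open>circle\<close>.\<close>
  define g where "g u = indicator (sphere 0 1) u *\<^sub>R f u" for u
  have [measurable]: "g \<in> borel_measurable borel"
    unfolding g_def[abs_def]
    using borel_measurable_continuous_on_indicator[OF _ f] by simp
  have gf: "g (cis x) = f (cis x)" for x by (simp add: g_def)
  have "(\<lambda>x. g (cis (2 * pi * x))) \<in> borel_measurable borel"
    by measurable
  then have [measurable]: "(\<lambda>x. f (cis (2 * pi * x))) \<in> borel_measurable borel"
    by (simp add: gf)
  have ind: "density lborel (indicator {0..1}) = density lborel (\<lambda>x. ennreal (indicator {0..1::real} x))"
    by (intro arg_cong2[where f = density] ext refl) (simp add: indicator_def)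
  have cont: "continuous_on {0..1} (\<lambda>x. f (cis (2 * pi * x)))"
    by (rule continuous_on_compose2[OF f]) (auto intro!: continuous_intros)
  then have int: "set_integrable lborel {0..1} (\<lambda>x. f (cis (2 * pi * x)))"
    by (rule borel_integrable_atLeastAtMost')
  have g: "integrable circle g" "(\<integral>u. g u \<partial>circle) = integral {0..1} (\<lambda>x. f (cis (2 * pi * x)))"
    using int set_borel_integral_eq_integral(2)[OF int]
    unfolding circle_def ind set_integrable_def set_lebesgue_integral_def
    by (simp_all add: integrable_distr_eq integral_distr integrable_density integral_density gf)
  have ae: "AE u in circle. g u = f u"
    using AE_circle by eventually_elim (simp add: g_def)
  show "integrable circle f" if "f \<in> borel_measurable borel"
    using integrable_cong_AE[OF _ _ ae] g that by simp
  show "(\<integral>u. f u \<partial>circle) = integral {0..1} (\<lambda>x. f (cis (2 * pi * x)))" if "f \<in> borel_measurable borel"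
    using integral_cong_AE[OF _ _ ae] g that by simp
qed

lemma integral_circle_ident: "(\<integral>u. u \<partial>circle) = 0"
proof -
  have [simp]: "integrable circle (\<lambda>u::complex. u)"
    by (rule integral_circle(1)) (auto intro!: continuous_intros)
  have "((\<lambda>x. sin (2 * pi * x)) has_integral (- cos (2 * pi * 1) / (2 * pi) - (- cos (2 * pi * 0) / (2 * pi)))) {0..1}"
    by (rule fundamental_theorem_of_calculus)
       (auto intro!: derivative_eq_intros simp flip: has_real_derivative_iff_has_vector_derivative)
  then have "integral {0..1} (\<lambda>x. sin (2 * pi * x)) = 0" by auto
  moreover have "((\<lambda>x. cos (2 * pi * x)) has_integral (sin (2 * pi * 1) / (2 * pi) - (sin (2 * pi * 0) / (2 * pi)))) {0..1}"
    by (rule fundamental_theorem_of_calculus)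
       (auto intro!: derivative_eq_intros simp flip: has_real_derivative_iff_has_vector_derivative)
  then have "integral {0..1} (\<lambda>x. cos (2 * pi * x)) = 0" by auto
  moreover have "(\<integral>u. Re u \<partial>circle) = integral {0..1} (\<lambda>x. Re (cis (2 * pi * x)))"
    "(\<integral>u. Im u \<partial>circle) = integral {0..1} (\<lambda>x. Im (cis (2 * pi * x)))"
    by (rule integral_circle(2); auto intro!: continuous_intros)+
  ultimately show ?thesis
    by (simp add: complex_eq_iff flip: integral_Re integral_Im)
qed

text \<open>The integrand is the real part of \<open>Ln (1 + w * u)\<close>, which is holomorphic on
  the closed unit disc because \<open>1 + w * u\<close> stays in the right half-plane. Cauchy's
  formula at the centre gives the value \<open>Ln 1 = 0\<close>.\<close>

lemma integral_circle_ln: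
  fixes w :: complex
  assumes "norm w < 1"
  shows "(\<integral>u. ln (norm (1 + w * u)) \<partial>circle) = 0"
proof -
  define f where "f u = Ln (1 + w * u)" for u
  have pos: "Re (1 + w * u) > 0" if "norm u \<le> 1" for u
  proof -
    have "norm (w * u) < 1"
      using assms that by (simp add: norm_mult) (meson le_less_trans mult_left_le norm_ge_zero)
    then show ?thesis
      using abs_Re_le_cmod[of "w * u"] by auto
  qed
  have hol: "f holomorphic_on cball 0 1"
    unfolding f_def
    by (intro holomorphic_intros) (use pos in \<open>force simp: complex_nonpos_Reals_iff\<close>)
  have "((\<lambda>u. f u / (u - 0)) has_contour_integral (2 * of_real pi * \<i> * f 0)) (circlepath 0 1)"
    by (rule Cauchy_integral_circlepath_simple[OF hol]) simp
  then have "((\<lambda>u. f u / u) has_contour_integral 0) (circlepath 0 1)"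
    by (simp add: f_def)
  then have "((\<lambda>x. 2 * pi * \<i> * f (cis (2 * pi * x))) has_integral 0) {0..1}"
    unfolding has_contour_integral circlepath_def vector_derivative_part_circlepath
    by (simp add: part_circlepath_def cis_conv_exp linepath_def mult_ac)
  from has_integral_mult_right[OF this, of "1 / (2 * pi * \<i>)"]
  have "((\<lambda>x. f (cis (2 * pi * x))) has_integral 0) {0..1}"
    by simp
  from has_integral_linear[OF this bounded_linear_Re]
  have "integral {0..1} (\<lambda>x. Re (f (cis (2 * pi * x)))) = 0"
    by (auto simp: o_def)
  moreover have "Re (f (cis (2 * pi * x))) = ln (norm (1 + w * cis (2 * pi * x)))" for x
    unfolding f_def by (rule Re_Ln) (use pos[of "cis (2 * pi * x)"] in \<open>fastforce\<close>)
  ultimately have "integral {0..1} (\<lambda>x. ln (norm (1 + w * cis (2 * pi * x)))) = 0"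
    by simp
  moreover have "continuous_on (sphere 0 1) (\<lambda>u. ln (norm (1 + w * u)))"
  proof (intro continuous_intros ballI)
    fix u :: complex assume "u \<in> sphere 0 1"
    then have "Re (1 + w * u) > 0" by (intro pos) simp
    then show "norm (1 + w * u) \<noteq> 0" by (metis less_irrefl norm_eq_zero zero_complex.simps(1))
  qed
  ultimately show ?thesis
    by (subst integral_circle(2)) auto
qed

section \<open>The minimum principle for circle means\<close>

text \<open>Fatou's lemma for the counting measure on two points.\<close>

lemma liminf_add_ennreal:
  fixes u v :: "nat \<Rightarrow> ennreal"
  shows "liminf u + liminf v \<le> liminf (\<lambda>n. u n + v n)"
  using nn_integral_liminf[of "\<lambda>n b. if b then u n else v n" "count_space UNIV"]
  by (simp add: nn_integral_count_space_finite UNIV_bool add.commute)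

lemma lsc_add:
  fixes f g :: "'a::metric_space \<Rightarrow> ennreal"
  assumes "lsc f" "lsc g"
  shows "lsc (\<lambda>x. f x + g x)"
proof (rule lscI_sequentially)
  fix X and x :: 'a assume X: "X \<longlonglongrightarrow> x"
  show "f x + g x \<le> liminf (\<lambda>n. f (X n) + g (X n))"
    using lsc_liminf[OF assms(1) X] lsc_liminf[OF assms(2) X] liminf_add_ennreal
    by (meson add_mono order_trans)
qed

lemma lsc_ennreal:
  fixes h :: "'a::topological_space \<Rightarrow> real"
  assumes h: "continuous_on UNIV h"
  shows "lsc (\<lambda>x. ennreal (h x))"
  unfolding lsc_def
proof
  fix c
  have "continuous_on UNIV (\<lambda>x. ennreal (h x))"
    using h unfolding continuous_on_def by (auto intro: tendsto_ennrealI)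
  then have "open {x. c < ennreal (h x)}"
    by (intro open_Collect_less) auto
  then show "open {x. c < ennreal (h x)}" .
qed

text \<open>Circle means may be infinite while comparison functions are real; estimates are
  therefore proved for every real \<open>l\<close> below the left-hand side.\<close>

lemma ennreal_le_if_real_le:
  fixes x y :: ennreal
  assumes "\<And>l. 0 \<le> l \<Longrightarrow> ennreal l \<le> x \<Longrightarrow> ennreal l \<le> y"
  shows "x \<le> y"
proof (cases x)
  case (real r)
  then show ?thesis using assms[of r] by simp
next
  case top
  show ?thesis
  proof (cases y)
    case (real r)
    then show ?thesis using assms[of "r + 1"] top by simp
  qed simp
qed

text \<open>If \<open>v < h\<close> somewhere, then at a minimum of \<open>v - h\<close> over
  \<open>K\<close> the supermean inequality of \<open>v\<close> and the strict submean inequality of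
  \<open>h\<close> force a smaller value on a circle. The first alternative of \<open>step\<close>
  takes the place of boundary values. As \<open>v\<close> may be infinite, the function that is
  minimised is the non-negative \<open>v + (B - h)\<close>, whose minimum exists by lower
  semicontinuity.\<close>

lemma min_principle:
  fixes v :: "complex \<Rightarrow> ennreal" and h :: "complex \<Rightarrow> real"
  assumes K: "compact K" and v: "lsc v" and h: "continuous_on UNIV h"
    and step: "\<And>z. z \<in> K \<Longrightarrow> ennreal (h z) \<le> v z \<or>
      (\<exists>r>0. cball z r \<subseteq> K \<and> (\<integral>\<^sup>+u. v (z + of_real r * u) \<partial>circle) \<le> v z \<and>
        h z < (\<integral>u. h (z + of_real r * u) \<partial>circle))"
    and z: "z \<in> K"
  shows "ennreal (h z) \<le> v z"
proof (rule ccontr)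
  assume "\<not> ennreal (h z) \<le> v z"
  then have less: "v z < ennreal (h z)" by simp
  have "bounded (h ` K)"
    using K h by (intro compact_imp_bounded compact_continuous_image) (auto intro: continuous_on_subset)
  then obtain B0 where B0: "\<And>z. z \<in> K \<Longrightarrow> \<bar>h z\<bar> \<le> B0"
    unfolding bounded_real by auto
  \<comment> \<open>The added 1 makes \<open>B - h\<close> strictly positive on \<open>K\<close>, so
    that the final strict comparison is not lost when \<open>ennreal\<close> truncates at 0.\<close>
  define B where "B = B0 + 1"
  have hB': "h z < B" if "z \<in> K" for z using B0[OF that] by (simp add: B_def)
  have hB: "h z \<le> B" if "z \<in> K" for z using hB'[OF that] by simp
  define \<phi> where "\<phi> z = v z + ennreal (B - h z)" for z
  have "lsc \<phi>"
    unfolding \<phi>_def[abs_def] by (intro lsc_add v lsc_ennreal continuous_intros h)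
  then obtain z0 where z0: "z0 \<in> K" and min: "\<And>y. y \<in> K \<Longrightarrow> \<phi> z0 \<le> \<phi> y"
    using lsc_attains_inf[OF K, of \<phi>] z by (auto simp: lsc_def)
  have "\<phi> z0 \<le> \<phi> z" by (rule min[OF z])
  also have "\<dots> < ennreal (h z) + ennreal (B - h z)"
    unfolding \<phi>_def using less
    by (simp add: ennreal_add_left_cancel_less add.commute[of _ "ennreal (B - h z)"])
  also have "\<dots> = ennreal B"
  proof -
    have "h z > 0" using less by (metis ennreal_neg linorder_not_less not_less_zero)
    then show ?thesis using hB[OF z] by (simp flip: ennreal_plus)
  qed
  finally have lessB: "\<phi> z0 < ennreal B" .
  have lt0: "v z0 < ennreal (h z0)"
  proof (rule ccontr)
    assume "\<not> v z0 < ennreal (h z0)"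
    then have "ennreal (h z0) + ennreal (B - h z0) \<le> \<phi> z0"
      unfolding \<phi>_def by (intro add_right_mono) simp
    moreover have "ennreal B \<le> ennreal (h z0) + ennreal (B - h z0)"
    proof (cases "h z0 \<ge> 0")
      case True
      then show ?thesis using hB[OF z0] ennreal_plus[of "h z0" "B - h z0"] by simp
    next
      case False
      then show ?thesis by (simp add: ennreal_neg ennreal_leI)
    qed
    ultimately show False using lessB by simp
  qed
  then obtain r where r: "r > 0" "cball z0 r \<subseteq> K" "(\<integral>\<^sup>+u. v (z0 + of_real r * u) \<partial>circle) \<le> v z0"
      "h z0 < (\<integral>u. h (z0 + of_real r * u) \<partial>circle)"
    using step[OF z0] by (auto simp: not_le)
  note [measurable] = lsc_borel_measurable[OF v] borel_measurable_continuous_onI[OF h]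
  have inK: "z0 + of_real r * u \<in> K" if "norm u = 1" for u
    using r that by (intro subsetD[OF r(2)]) (auto simp: dist_norm norm_mult)
  have conth: "continuous_on A (\<lambda>u. h (z0 + of_real r * u))" for A
    by (rule continuous_on_compose2[OF h]) (auto intro!: continuous_intros)
  have inth: "integrable circle (\<lambda>u. h (z0 + of_real r * u))"
    by (rule integral_circle(1)[OF conth]) measurable
  have "\<phi> z0 = (\<integral>\<^sup>+u. \<phi> z0 \<partial>circle)" by simp
  also have "\<dots> \<le> (\<integral>\<^sup>+u. \<phi> (z0 + of_real r * u) \<partial>circle)"
    by (rule nn_integral_circle_mono) (use inK min in blast)
  also have "\<dots> = (\<integral>\<^sup>+u. v (z0 + of_real r * u) \<partial>circle) + (\<integral>\<^sup>+u. ennreal (B - h (z0 + of_real r * u)) \<partial>circle)"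
    unfolding \<phi>_def by (rule nn_integral_add) measurable
  also have "(\<integral>\<^sup>+u. ennreal (B - h (z0 + of_real r * u)) \<partial>circle) = ennreal (\<integral>u. B - h (z0 + of_real r * u) \<partial>circle)"
  proof (rule nn_integral_eq_integral)
    show "integrable circle (\<lambda>u. B - h (z0 + of_real r * u))"
      by (intro Bochner_Integration.integrable_diff inth) simp
    show "AE u in circle. 0 \<le> B - h (z0 + of_real r * u)"
      using AE_circle by eventually_elim (use hB inK in force)
  qed
  also have "(\<integral>u. B - h (z0 + of_real r * u) \<partial>circle) = B - (\<integral>u. h (z0 + of_real r * u) \<partial>circle)"
    by (subst Bochner_Integration.integral_diff[OF _ inth]) (simp_all add: measure_def)
  also have "(\<integral>\<^sup>+u. v (z0 + of_real r * u) \<partial>circle) + ennreal (B - (\<integral>u. h (z0 + of_real r * u) \<partial>circle))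
      \<le> v z0 + ennreal (B - (\<integral>u. h (z0 + of_real r * u) \<partial>circle))"
    by (intro add_right_mono r)
  also have "\<dots> < v z0 + ennreal (B - h z0)"
  proof -
    have "ennreal (B - (\<integral>u. h (z0 + of_real r * u) \<partial>circle)) < ennreal (B - h z0)"
      using r(4) hB'[OF z0] by (cases "B - (\<integral>u. h (z0 + of_real r * u) \<partial>circle) \<ge> 0")
        (auto simp: ennreal_less_iff ennreal_neg)
    moreover have "v z0 \<noteq> top" using lt0 by auto
    ultimately show ?thesis by (simp add: ennreal_add_left_cancel_less)
  qed
  finally show False unfolding \<phi>_def by simp
qed

text \<open>\<open>cmean g v\<close> depends only on \<open>norm v\<close>; the complex radius makes it superharmonic in \<open>v\<close>.\<close>

definition cmean :: "(complex \<Rightarrow> ennreal) \<Rightarrow> complex \<Rightarrow> ennreal" where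
  "cmean g v = (\<integral>\<^sup>+u. g (v * u) \<partial>circle)"

text \<open>Lower semicontinuity is asked for on the whole plane, not only on \<open>U\<close>: it
  provides global measurability, and extending a non-negative function by 0 respects it. The value
  infinity is allowed, even identically.\<close>

definition superharmonic1 :: "complex set \<Rightarrow> (complex \<Rightarrow> ennreal) \<Rightarrow> bool" where
  "superharmonic1 U g \<longleftrightarrow> open U \<and> lsc g \<and>
     (\<forall>z r. 0 < r \<longrightarrow> cball z r \<subseteq> U \<longrightarrow> cmean (\<lambda>w. g (z + w)) (of_real r) \<le> g z)"

lemma cmean_0[simp]: "cmean g 0 = g 0"
  by (simp add: cmean_def)

lemma lsc_cmean: "lsc g \<Longrightarrow> lsc (cmean g)"
  unfolding cmean_def[abs_def] by (rule lsc_nn_integral) (auto intro!: continuous_intros)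

lemma cmean_cong_norm:
  assumes [measurable]: "g \<in> borel_measurable borel" and "norm v = norm w"
  shows "cmean g v = cmean g w"
proof (cases "v = 0")
  case True then show ?thesis using assms by simp
next
  case False
  define c where "c = w / v"
  have c: "norm c = 1" "w = v * c"
    using False assms(2) by (auto simp: c_def norm_divide)
  show ?thesis
    using nn_integral_circle_rotate[of "\<lambda>u. g (v * u)", OF _ c(1)]
    by (simp add: cmean_def c(2) mult.assoc)
qed

lemma circle_tonelli:
  fixes f :: "'a::topological_space \<Rightarrow> complex \<Rightarrow> ennreal"
  assumes "sigma_finite_measure M" "sets M = sets borel"
    and "(\<lambda>(x, y). f x y) \<in> borel_measurable (borel \<Otimes>\<^sub>M borel)"
  shows "(\<integral>\<^sup>+x. (\<integral>\<^sup>+y. f x y \<partial>circle) \<partial>M) = (\<integral>\<^sup>+y. (\<integral>\<^sup>+x. f x y \<partial>M) \<partial>circle)"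
proof -
  interpret sigma_finite_measure M by fact
  interpret pair_sigma_finite circle M ..
  have "(\<lambda>(y, x). f x y) \<in> borel_measurable (borel \<Otimes>\<^sub>M borel)"
    using measurable_compose[OF measurable_pair_swap' assms(3)] by (simp add: split_beta')
  then have "(\<lambda>(y, x). f x y) \<in> borel_measurable (circle \<Otimes>\<^sub>M M)"
    using assms(2) by (simp cong: measurable_cong_sets)
  from Fubini'[OF this] show ?thesis by simp
qed

text \<open>As a function of its complex radius, \<open>cmean g\<close> is an average over
  \<open>t\<close> of the rotated functions \<open>\<lambda>z. g (z * t)\<close>, each of which
  satisfies the same mean value inequality; Tonelli's theorem exchanges the two averages.\<close>

lemma superharmonic1_cmean:
  assumes g: "superharmonic1 U g" and R: "cball 0 R \<subseteq> U" and r: "r > 0" "norm z + r \<le> R"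
  shows "(\<integral>\<^sup>+u. cmean g (z + of_real r * u) \<partial>circle) \<le> cmean g z"
proof -
  have [measurable]: "g \<in> borel_measurable borel"
    using g by (auto simp: superharmonic1_def intro: lsc_borel_measurable)
  have "(\<integral>\<^sup>+u. cmean g (z + of_real r * u) \<partial>circle)
      = (\<integral>\<^sup>+u. (\<integral>\<^sup>+t. g ((z + of_real r * u) * t) \<partial>circle) \<partial>circle)"
    by (simp add: cmean_def)
  also have "\<dots> = (\<integral>\<^sup>+t. (\<integral>\<^sup>+u. g ((z + of_real r * u) * t) \<partial>circle) \<partial>circle)"
    by (rule circle_tonelli) (unfold_locales, simp, measurable)
  also have "\<dots> \<le> (\<integral>\<^sup>+t. g (z * t) \<partial>circle)"
  proof (rule nn_integral_circle_mono)
    fix t :: complex assume t: "norm t = 1"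
    have "(\<integral>\<^sup>+u. g ((z + of_real r * u) * t) \<partial>circle) = (\<integral>\<^sup>+u. g (z * t + of_real r * (t * u)) \<partial>circle)"
      by (simp add: algebra_simps)
    also have "\<dots> = (\<integral>\<^sup>+u. g (z * t + of_real r * u) \<partial>circle)"
      by (rule nn_integral_circle_rotate[OF _ t]) measurable
    also have "\<dots> = cmean (\<lambda>w. g (z * t + w)) (of_real r)"
      by (simp add: cmean_def)
    also have "\<dots> \<le> g (z * t)"
    proof -
      have "cball (z * t) r \<subseteq> cball 0 R"
        using r t by (auto simp: cball_subset_cball_iff dist_norm norm_mult)
      then show ?thesis using g R r(1) unfolding superharmonic1_def by blast
    qed
    finally show "(\<integral>\<^sup>+u. g ((z + of_real r * u) * t) \<partial>circle) \<le> g (z * t)" .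
  qed
  finally show ?thesis by (simp add: cmean_def)
qed

text \<open>The gain \<open>r\<^sup>2\<close> is the source of strictness: a small multiple of the
  squared norm turns harmonic comparison functions into strictly subharmonic ones, as
  \<open>min_principle\<close> demands.\<close>

lemma circle_mean_norm_square:
  "integrable circle (\<lambda>u. (norm (z + of_real r * u))\<^sup>2)" (is ?A)
  "(\<integral>u. (norm (z + of_real r * u))\<^sup>2 \<partial>circle) = (norm z)\<^sup>2 + r\<^sup>2" (is ?B)
proof -
  have c: "continuous_on (sphere 0 1) f" if "continuous_on UNIV f" for f :: "complex \<Rightarrow> real"
    using that continuous_on_subset by blast
  show A: ?A by (rule integral_circle(1)) (auto intro!: continuous_intros)
  have i: "integrable circle (\<lambda>u::complex. u)"
    by (rule integral_circle(1)) (auto intro!: continuous_intros)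
  have "(\<integral>u. (norm (z + of_real r * u))\<^sup>2 \<partial>circle) = (\<integral>u. ((norm z)\<^sup>2 + r\<^sup>2) + 2 * r * Re (cnj z * u) \<partial>circle)"
  proof (rule integral_cong_AE)
    show "AE u in circle. (norm (z + of_real r * u))\<^sup>2 = ((norm z)\<^sup>2 + r\<^sup>2) + 2 * r * Re (cnj z * u)"
      using AE_circle
    proof eventually_elim
      case (elim u)
      then have "(Re u)\<^sup>2 + (Im u)\<^sup>2 = 1" by (simp add: cmod_def)
      then have "r\<^sup>2 * ((Re u)\<^sup>2 + (Im u)\<^sup>2) = r\<^sup>2" by simp
      then show ?case
        unfolding cmod_power2 by (simp add: algebra_simps power2_eq_square)
    qed
  qed measurable
  also have "\<dots> = (norm z)\<^sup>2 + r\<^sup>2 + 2 * r * (\<integral>u. Re (cnj z * u) \<partial>circle)"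
    using i by (subst Bochner_Integration.integral_add) (auto simp: measure_def intro!: integrable_Re)
  also have "(\<integral>u. Re (cnj z * u) \<partial>circle) = Re (cnj z * (\<integral>u. u \<partial>circle))"
    using i by (subst integral_Re) auto
  finally show ?B by (simp add: integral_circle_ident)
qed

lemma ennreal_le_epsilon_mult:
  fixes y :: ennreal
  assumes "\<And>e. 0 < e \<Longrightarrow> ennreal (l - e * c) \<le> y"
  shows "ennreal l \<le> y"
proof (rule tendsto_upperbound)
  show "((\<lambda>e. ennreal (l - e * c)) \<longlongrightarrow> ennreal l) (at_right 0)"
    by (rule tendsto_eq_intros refl | simp)+
  show "\<forall>\<^sub>F e in at_right 0. ennreal (l - e * c) \<le> y"
    by (rule eventually_mono[OF eventually_at_right_less[of 0]]) (rule assms)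
qed simp

text \<open>On the circle of radius \<open>norm b\<close> the function \<open>cmean g\<close> is
  constant, so the minimum principle on the disc applies with a constant \<open>l\<close> below that
  value, perturbed by a term that vanishes on the circle and makes it strictly subharmonic.\<close>

lemma cmean_antimono:
  assumes g: "superharmonic1 U g" and R: "cball 0 R \<subseteq> U" and ab: "norm a \<le> norm b" "norm b \<le> R"
  shows "cmean g b \<le> cmean g a"
proof (rule ennreal_le_if_real_le, rule ennreal_le_epsilon_mult)
  fix l e :: real assume l: "0 \<le> l" "ennreal l \<le> cmean g b" and e: "0 < e"
  let ?h = "\<lambda>z::complex. l - e * ((norm b)\<^sup>2 - (norm z)\<^sup>2)"
  have [measurable]: "g \<in> borel_measurable borel" and g': "lsc g"
    using g by (auto simp: superharmonic1_def intro: lsc_borel_measurable)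
  show "ennreal (?h a) \<le> cmean g a"
  proof (rule min_principle[where K = "cball 0 (norm b)" and h = ?h])
    fix z :: complex assume z: "z \<in> cball 0 (norm b)"
    define r where "r = norm b - norm z"
    show "ennreal (?h z) \<le> cmean g z \<or> (\<exists>r>0. cball z r \<subseteq> cball 0 (norm b) \<and>
          (\<integral>\<^sup>+u. cmean g (z + of_real r * u) \<partial>circle) \<le> cmean g z \<and>
          ?h z < (\<integral>u. ?h (z + of_real r * u) \<partial>circle))"
    proof (cases "norm z = norm b")
      case True
      then show ?thesis using l cmean_cong_norm[of g z b] by simp
    next
      case False
      then have r: "r > 0" using z by (simp add: r_def)
      have "(\<integral>u. ?h (z + of_real r * u) \<partial>circle) = (\<integral>u. (l - e * (norm b)\<^sup>2) + e * (norm (z + of_real r * u))\<^sup>2 \<partial>circle)"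
        by (simp add: algebra_simps)
      also have "\<dots> = l - e * (norm b)\<^sup>2 + e * ((norm z)\<^sup>2 + r\<^sup>2)"
        by (subst Bochner_Integration.integral_add)
           (simp_all add: measure_def circle_mean_norm_square)
      also have "\<dots> > ?h z"
        using r e by (simp add: algebra_simps)
      finally have "?h z < (\<integral>u. ?h (z + of_real r * u) \<partial>circle)" .
      moreover have "cball z r \<subseteq> cball 0 (norm b)"
        by (auto simp: cball_subset_cball_iff dist_norm r_def)
      moreover have "(\<integral>\<^sup>+u. cmean g (z + of_real r * u) \<partial>circle) \<le> cmean g z"
        by (rule superharmonic1_cmean[OF g R r]) (use ab in \<open>simp add: r_def\<close>)
      ultimately show ?thesis using r by blast
    qed
  qed (use ab in \<open>auto intro!: lsc_cmean g' continuous_intros\<close>)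
qed

text \<open>Comparison on the annulus between \<open>norm a\<close> and \<open>R\<close> with the
  harmonic function \<open>l * ln (R / norm z) / ln (R / norm a)\<close>. It equals \<open>l\<close>
  on the inner circle and 0 on the outer one, where non-negativity of \<open>cmean g\<close> is
  enough.\<close>

lemma cmean_log:
  assumes g: "superharmonic1 U g" and R: "cball 0 R \<subseteq> U"
    and ab: "0 < norm a" "norm a \<le> norm b" "norm b < R"
    and l: "0 \<le> l" "ennreal l \<le> cmean g a"
  shows "ennreal (l * ln (R / norm b) / ln (R / norm a)) \<le> cmean g b"
proof (rule ennreal_le_epsilon_mult)
  fix e :: real assume e: "0 < e"
  define L where "L = ln (R / norm a)"
  have "norm a < R" using ab by linarith
  then have L: "L > 0" using ab(1) unfolding L_def by (intro ln_gt_zero) (simp add: less_divide_eq)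
  \<comment> \<open>The maximum with \<open>norm a\<close> changes nothing on the annulus; it
    removes the singularity at 0, since \<open>min_principle\<close> wants \<open>h\<close>
    continuous everywhere.\<close>
  define h where "h z = l * ln (R / max (norm a) (norm z)) / L - e * (R\<^sup>2 - (norm z)\<^sup>2)" for z :: complex
  have [measurable]: "g \<in> borel_measurable borel" and g': "lsc g"
    using g by (auto simp: superharmonic1_def intro: lsc_borel_measurable)
  have R0: "R > 0" using ab by linarith
  have m0: "max (norm a) x \<noteq> 0" for x using ab by (auto simp: max_def)
  have hc: "continuous_on UNIV h"
    unfolding h_def using m0 R0 L by (auto intro!: continuous_intros continuous_on_max)
  have "ennreal (h b) \<le> cmean g b"
  proof (rule min_principle[where K = "cball 0 R \<inter> {z. norm a \<le> norm z}" and h = h])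
    show "compact (cball 0 R \<inter> {z::complex. norm a \<le> norm z})"
      by (intro compact_Int_closed closed_Collect_le continuous_intros) auto
    fix z :: complex assume z: "z \<in> cball 0 R \<inter> {z. norm a \<le> norm z}"
    show "ennreal (h z) \<le> cmean g z \<or> (\<exists>r>0. cball z r \<subseteq> cball 0 R \<inter> {z. norm a \<le> norm z} \<and>
          (\<integral>\<^sup>+u. cmean g (z + of_real r * u) \<partial>circle) \<le> cmean g z \<and>
          h z < (\<integral>u. h (z + of_real r * u) \<partial>circle))"
    proof (cases "norm z = R \<or> norm z = norm a")
      case True
      then show ?thesis
      proof
        assume "norm z = R"
        then have "h z = 0" using ab R0 by (simp add: h_def max_def)
        then show ?thesis by simp
      next
        assume z': "norm z = norm a"
        have "(norm a)\<^sup>2 \<le> R\<^sup>2" using ab by (intro power_mono) auto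
        then have "0 \<le> e * (R\<^sup>2 - (norm a)\<^sup>2)" using e by (intro mult_nonneg_nonneg) auto
        moreover have "h z = l - e * (R\<^sup>2 - (norm a)\<^sup>2)" using L z' by (simp add: h_def L_def)
        ultimately have "h z \<le> l" by linarith
        then show ?thesis
          using l cmean_cong_norm[of g z a] z' by (metis dual_order.trans ennreal_leI \<open>g \<in> borel_measurable borel\<close>)
      qed
    next
      case False
      define r where "r = min (norm z - norm a) (R - norm z)"
      have r: "r > 0" using False z by (auto simp: r_def)
      have rz: "r < norm z" using ab(1) unfolding r_def by linarith
      have sub: "cball z r \<subseteq> cball 0 R \<inter> {z. norm a \<le> norm z}"
      proof
        fix y assume "y \<in> cball z r"
        then have "norm (z - y) \<le> r" by (simp add: dist_norm)
        moreover have "norm y \<le> norm z + norm (z - y)" "norm z \<le> norm y + norm (z - y)"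
          by norm+
        ultimately show "y \<in> cball 0 R \<inter> {z. norm a \<le> norm z}" by (auto simp: r_def)
      qed
      have z0: "z \<noteq> 0" using rz r by auto
      have lz: "ln (R / max (norm a) (norm z)) = ln R - ln (norm z)"
        using z z0 R0 by (simp add: ln_div max_def)
      let ?w = "of_real r / z"
      have w: "norm ?w < 1" using rz z0 r by (simp add: norm_divide)
      have ne: "1 + ?w * u \<noteq> 0" if "norm u = 1" for u
      proof
        assume "1 + ?w * u = 0"
        then have "?w * u = -1" by (simp add: add_eq_0_iff)
        then have "norm (?w * u) = 1" by simp
        moreover have "norm (?w * u) = norm ?w" using that by (simp only: norm_mult mult_1_right)
        ultimately show False using w by linarith
      qed
      have cln: "integrable circle (\<lambda>u. ln (norm (1 + ?w * u)))"
        by (rule integral_circle(1)) (use ne z0 in \<open>auto intro!: continuous_intros\<close>)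
      have "(\<integral>u. h (z + of_real r * u) \<partial>circle) = 
         (\<integral>u. ((l / L) * (ln R - ln (norm z)) - e * R\<^sup>2) + (e * (norm (z + of_real r * u))\<^sup>2 - (l / L) * ln (norm (1 + ?w * u))) \<partial>circle)"
      proof (rule integral_cong_AE)
        show "(\<lambda>u. h (z + of_real r * u)) \<in> borel_measurable circle"
          using borel_measurable_continuous_onI[OF hc] by measurable
        show "AE u in circle. h (z + of_real r * u) = ((l / L) * (ln R - ln (norm z)) - e * R\<^sup>2) + (e * (norm (z + of_real r * u))\<^sup>2 - (l / L) * ln (norm (1 + ?w * u)))"
          using AE_circle
        proof eventually_elim
          case (elim u)
          have "z + of_real r * u \<in> cball z r" using elim r by (simp add: dist_norm norm_mult)
          then have "norm a \<le> norm (z + of_real r * u)" using sub by auto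
          moreover have "z + of_real r * u = z * (1 + ?w * u)"
            using z0 by (simp add: field_simps)
          then have "norm (z + of_real r * u) = norm z * norm (1 + ?w * u)"
            by (simp only: norm_mult)
          ultimately have eq: "ln (R / max (norm a) (norm (z + of_real r * u))) = ln R - ln (norm z) - ln (norm (1 + ?w * u))"
            using ne[OF elim] z0 R0 by (simp add: max_def ln_div ln_mult)
          show ?case unfolding h_def eq by (simp add: algebra_simps diff_divide_distrib add_divide_distrib)
        qed
      qed measurable
      also have "\<dots> = ((l / L) * (ln R - ln (norm z)) - e * R\<^sup>2) + (e * ((norm z)\<^sup>2 + r\<^sup>2) - (l / L) * 0)"
        using cln integral_circle_ln[OF w] by (subst Bochner_Integration.integral_add Bochner_Integration.integral_diff;
           (simp add: measure_def circle_mean_norm_square)?)+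
      also have "\<dots> > h z"
      proof -
        have "h z = (l / L) * (ln R - ln (norm z)) - e * R\<^sup>2 + e * (norm z)\<^sup>2"
          unfolding h_def lz by (simp add: right_diff_distrib diff_divide_distrib)
        moreover have "0 < e * r\<^sup>2" using r e by simp
        ultimately show ?thesis by (simp add: distrib_left)
      qed
      finally have "h z < (\<integral>u. h (z + of_real r * u) \<partial>circle)" .
      moreover have "(\<integral>\<^sup>+u. cmean g (z + of_real r * u) \<partial>circle) \<le> cmean g z"
        by (rule superharmonic1_cmean[OF g R r]) (simp add: r_def)
      ultimately show ?thesis using r sub by blast
    qed
  qed (use ab in \<open>auto intro!: lsc_cmean g' hc\<close>)
  then show "ennreal (l * ln (R / norm b) / ln (R / norm a) - e * (R\<^sup>2 - (norm b)\<^sup>2)) \<le> cmean g b"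
    using ab by (simp add: h_def L_def max_def)
qed

text \<open>With \<open>L = ln (R / norm a)\<close> the logarithmic comparison gives the shares
  \<open>(L - ln 2) / L\<close> at \<open>2 * a\<close> and \<open>ln 2 / L\<close> at radius
  \<open>R / 2\<close>, which add up to 1. So the loss from \<open>a\<close> to \<open>2 * a\<close>
  is bounded by a mean at a fixed radius, however small \<open>a\<close> is.\<close>

lemma cmean_doubling:
  assumes g: "superharmonic1 U g" and R: "cball 0 R \<subseteq> U" and a: "2 * norm a \<le> R"
  shows "cmean g a \<le> cmean g (2 * a) + cmean g (of_real R / 2)"
proof -
  have [measurable]: "g \<in> borel_measurable borel"
    using g by (auto simp: superharmonic1_def intro: lsc_borel_measurable)
  consider "a = 0" | "a \<noteq> 0" "2 * norm a = R" | "a \<noteq> 0" "2 * norm a < R" using a by fastforce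
  then show ?thesis
  proof cases
    case 2
    then have "cmean g a = cmean g (of_real R / 2)"
      by (intro cmean_cong_norm) auto
    then show ?thesis by simp
  next
    case 3
    show ?thesis
    proof (rule ennreal_le_if_real_le)
      fix l assume l: "0 \<le> l" "ennreal l \<le> cmean g a"
      have a0: "0 < norm a" using 3 by simp
      have R0: "R > 0" using 3 a0 by linarith
      define L where "L = ln (R / norm a)"
      have "norm a < R" using 3 a0 by linarith
      then have L: "L > 0" using a0 unfolding L_def by (intro ln_gt_zero) (simp add: less_divide_eq)
      have 1: "ln (R / norm (2 * a)) = L - ln 2"
        using a0 R0 by (simp add: L_def ln_div ln_mult norm_mult)
      have 2: "ln (R / norm (of_real R / 2 :: complex)) = ln 2"
        using R0 by (simp add: norm_divide)
      have "ennreal (l * (L - ln 2) / L) \<le> cmean g (2 * a)"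
        using cmean_log[OF g R a0 _ _ l, of "2 * a"] 3 unfolding 1 L_def[symmetric] by (simp add: norm_mult)
      moreover have "ennreal (l * ln 2 / L) \<le> cmean g (of_real R / 2)"
        using cmean_log[OF g R a0 _ _ l, of "of_real R / 2"] 3 R0 unfolding 2 L_def[symmetric] by (simp add: norm_divide)
      ultimately have "ennreal (l * (L - ln 2) / L) + ennreal (l * ln 2 / L) \<le> cmean g (2 * a) + cmean g (of_real R / 2)"
        by (rule add_mono)
      moreover have "ennreal (l * (L - ln 2) / L) + ennreal (l * ln 2 / L) = ennreal l"
      proof -
        have "ln 2 < L"
          using 3 a0 R0 unfolding L_def by (subst ln_less_cancel_iff) (auto simp: field_simps)
        then have "ennreal (l * (L - ln 2) / L) + ennreal (l * ln 2 / L) = ennreal (l * (L - ln 2) / L + l * ln 2 / L)"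
          using l L by (intro ennreal_plus[symmetric]) auto
        also have "l * (L - ln 2) / L + l * ln 2 / L = l"
          using L by (simp add: field_simps)
        finally show ?thesis .
      qed
      ultimately show "ennreal l \<le> cmean g (2 * a) + cmean g (of_real R / 2)" by simp
    qed
  qed simp
qed

section \<open>Separately superharmonic functions and kernel means\<close>

lemma add_in_cball_iff: "x + q \<in> cball x r \<longleftrightarrow> norm (q :: 'a::real_normed_vector) \<le> r"
  by (simp add: dist_norm)

lemma axis_add: "axis j (v + w :: 'a::comm_monoid_add) = axis j v + axis j w"
  by (simp add: axis_def vec_eq_iff)

lemma axis_uminus: "axis j (- v :: 'a::ab_group_add) = - axis j v"
  by (simp add: axis_def vec_eq_iff)

lemma axis_zero[simp]: "axis j (0::'a::zero) = 0"
  by (simp add: axis_def vec_eq_iff)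

lemma norm_axis: "norm (axis j v :: 'a::real_normed_vector ^ 'n) = norm v"
proof -
  have "axis j v $ i = (if i = j then v else 0)" for i by (simp add: axis_def)
  then have "(\<Sum>i\<in>UNIV. (norm (axis j v $ i))\<^sup>2) = (\<Sum>i\<in>UNIV. if i = j then (norm v)\<^sup>2 else 0)"
    by (intro sum.cong) auto
  then show ?thesis by (simp add: norm_vec_def L2_set_def)
qed

lemma bounded_linear_axis: "bounded_linear (axis j :: 'a::real_normed_vector \<Rightarrow> 'a ^ 'n)"
proof
  show "\<exists>K. \<forall>x. norm (axis j x :: 'a ^ 'n) \<le> norm x * K"
    by (rule exI[of _ 1]) (simp add: norm_axis)
qed (simp_all add: axis_def vec_eq_iff)

lemmas continuous_on_axis[continuous_intros] = bounded_linear.continuous_on[OF bounded_linear_axis]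

lemma axis_measurable[measurable]: "(axis j :: complex \<Rightarrow> complex ^ 'n) \<in> borel_measurable borel"
  by (intro borel_measurable_continuous_onI continuous_intros)

lemma nth_measurable[measurable]: "(\<lambda>x :: complex ^ 'n. x $ j) \<in> borel_measurable borel"
  by (intro borel_measurable_continuous_onI continuous_intros)

lemma norm_vec_le_scale:
  fixes x :: "'a::real_normed_vector ^ 'n" and w :: "'b::real_normed_vector ^ 'n"
  assumes "\<And>i. norm (x $ i) \<le> r * norm (w $ i)" "0 \<le> r"
  shows "norm x \<le> r * norm w"
proof -
  have "norm x \<le> L2_set (\<lambda>i. r * norm (w $ i)) UNIV"
    unfolding norm_vec_def by (rule L2_set_mono) (use assms in auto)
  also have "\<dots> = r * norm w"
    using assms by (simp add: norm_vec_def L2_set_right_distrib)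
  finally show ?thesis .
qed

text \<open>Joint lower semicontinuity is part of the notion; for the function that comes from
  \<open>F\<close> it is supplied by \<open>neg_ext_le_liminf\<close>.\<close>

definition separately_superharmonic :: "(complex ^ 'n) set \<Rightarrow> (complex ^ 'n \<Rightarrow> ennreal) \<Rightarrow> bool" where
  "separately_superharmonic \<Omega> G \<longleftrightarrow> open \<Omega> \<and> lsc G \<and>
     (\<forall>x j r. 0 < r \<longrightarrow> (\<forall>v. norm v \<le> r \<longrightarrow> x + axis j v \<in> \<Omega>) \<longrightarrow>
        cmean (\<lambda>v. G (x + axis j v)) (of_real r) \<le> G x)"

lemma separately_superharmonic_measurable:
  "separately_superharmonic \<Omega> G \<Longrightarrow> G \<in> borel_measurable borel"
  by (auto simp: separately_superharmonic_def intro: lsc_borel_measurable)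

lemma separately_superharmonic_slice:
  assumes "separately_superharmonic \<Omega> G"
  shows "superharmonic1 {v. x + axis j v \<in> \<Omega>} (\<lambda>v. G (x + axis j v))"
  unfolding superharmonic1_def
proof (intro conjI allI impI)
  have "open ((\<lambda>v. x + axis j v) -` \<Omega>)"
    using assms by (intro open_vimage continuous_intros) (auto simp: separately_superharmonic_def)
  then show "open {v. x + axis j v \<in> \<Omega>}" by (simp add: vimage_def)
  show "lsc (\<lambda>v. G (x + axis j v))"
    using assms unfolding separately_superharmonic_def
    by (intro lsc_compose[where f = G and k = "\<lambda>v. x + axis j v"] continuous_intros) auto
  fix z and r :: real assume r: "0 < r" "cball z r \<subseteq> {v. x + axis j v \<in> \<Omega>}"
  have "(x + axis j z) + axis j v \<in> \<Omega>" if "norm v \<le> r" for v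
  proof -
    have "z + v \<in> cball z r" using that by (simp add: dist_norm)
    then show ?thesis using r by (auto simp: axis_add add.assoc)
  qed
  then have "cmean (\<lambda>v. G ((x + axis j z) + axis j v)) (of_real r) \<le> G (x + axis j z)"
    using assms r(1) unfolding separately_superharmonic_def by blast
  then show "cmean (\<lambda>w. G (x + axis j (z + w))) (complex_of_real r) \<le> G (x + axis j z)"
    by (simp add: axis_add add.assoc)
qed

section \<open>The cone kernel and its means\<close>

definition kmass :: "'a::euclidean_space itself \<Rightarrow> ennreal" where
  "kmass _ = (\<integral>\<^sup>+(w::'a). ennreal (max 0 (1 - norm w)) \<partial>lborel)"

text \<open>The cone is radial, hence invariant under \<open>rot j u\<close>, and Lipschitz, which
  \<open>kmean_lipschitz\<close> exploits. Dividing by its mass makes \<open>kern\<close> a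
  probability measure.\<close>

definition kfun :: "'a::euclidean_space \<Rightarrow> ennreal" where
  "kfun w = ennreal (max 0 (1 - norm w)) / kmass TYPE('a)"

definition kern :: "'a::euclidean_space measure" where
  "kern = density lborel kfun"

lemma kfun_measurable[measurable]: "kfun \<in> borel_measurable borel"
  unfolding kfun_def by measurable

lemma kmass_pos: "kmass TYPE('a::euclidean_space) \<noteq> 0"
proof
  assume "kmass TYPE('a) = 0"
  then have "AE w::'a in lborel. ennreal (max 0 (1 - norm w)) = 0"
    unfolding kmass_def by (subst (asm) nn_integral_0_iff_AE) auto
  then have "AE w::'a in lborel. w \<notin> ball 0 1"
    by eventually_elim (auto simp: ennreal_eq_0_iff max_def split: if_splits)
  then have "ball (0::'a) 1 \<in> null_sets lborel"
    by (subst (asm) AE_iff_null) (auto simp: Collect_neg_eq ball_def)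
  then show False
    using open_not_negligible[of "ball (0::'a) 1"] negligible_iff_null_sets null_sets_completionI
    by (metis ball_eq_empty centre_in_ball less_numeral_extra(1) not_one_le_zero open_ball equals0D)
qed

lemma kmass_finite: "kmass TYPE('a::euclidean_space) \<noteq> top"
proof -
  have "kmass TYPE('a) \<le> (\<integral>\<^sup>+(w::'a). indicator (cball 0 1) w \<partial>lborel)"
    unfolding kmass_def by (rule nn_integral_mono) (auto simp: indicator_def max_def ennreal_le_1)
  also have "\<dots> < top"
    using emeasure_lborel_cball_finite[of "0::'a" 1] by simp
  finally show ?thesis by simp
qed

lemma sets_kern[simp, measurable_cong]: "sets kern = sets borel"
  by (simp add: kern_def)

lemma space_kern[simp]: "space kern = UNIV"
  by (simp add: kern_def)

lemma nn_integral_kern: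
  fixes f :: "'a::euclidean_space \<Rightarrow> ennreal"
  assumes [measurable]: "f \<in> borel_measurable borel"
  shows "(\<integral>\<^sup>+w. f w \<partial>kern) = (\<integral>\<^sup>+w. kfun w * f w \<partial>lborel)"
  unfolding kern_def by (subst nn_integral_density) simp_all

lemma emeasure_kern[simp]: "emeasure kern UNIV = 1"
proof -
  have "emeasure (kern :: 'a measure) UNIV = (\<integral>\<^sup>+(w::'a). kfun w \<partial>lborel)"
    using nn_integral_kern[of "\<lambda>_. 1"] by simp
  also have "\<dots> = kmass TYPE('a) / kmass TYPE('a)"
    unfolding kfun_def by (subst nn_integral_divide) (simp_all add: kmass_def)
  finally show ?thesis
    using kmass_pos[where 'a = 'a] kmass_finite[where 'a = 'a] by (simp add: ennreal_divide_self less_top)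
qed

interpretation kern: finite_measure kern
  by (rule finite_measureI) simp

lemma nn_integral_kern_const[simp]: "(\<integral>\<^sup>+u. c \<partial>kern) = c"
  by simp

lemma AE_kern: "AE w in kern. norm w \<le> 1"
  unfolding kern_def by (subst AE_density) (auto simp: kfun_def max_def)

lemma nn_integral_kern_mono:
  assumes "\<And>u. norm u \<le> 1 \<Longrightarrow> f u \<le> g u"
  shows "(\<integral>\<^sup>+u. f u \<partial>kern) \<le> (\<integral>\<^sup>+u. g u \<partial>kern)"
  by (rule nn_integral_mono_AE) (use AE_kern in \<open>eventually_elim, simp add: assms\<close>)

lemma kern_tonelli:
  fixes f :: "'a::euclidean_space \<Rightarrow> 'b::euclidean_space \<Rightarrow> ennreal"
  assumes "sigma_finite_measure M" "sets M = sets borel"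
    and "(\<lambda>(x, y). f x y) \<in> borel_measurable (borel \<Otimes>\<^sub>M borel)"
  shows "(\<integral>\<^sup>+x. (\<integral>\<^sup>+y. f x y \<partial>kern) \<partial>M) = (\<integral>\<^sup>+y. (\<integral>\<^sup>+x. f x y \<partial>M) \<partial>kern)"
proof -
  interpret sigma_finite_measure M by fact
  interpret pair_sigma_finite "kern :: 'b measure" M ..
  have "(\<lambda>(y, x). f x y) \<in> borel_measurable (borel \<Otimes>\<^sub>M borel)"
    using measurable_compose[OF measurable_pair_swap' assms(3)] by (simp add: split_beta')
  then have "(\<lambda>(y, x). f x y) \<in> borel_measurable (kern \<Otimes>\<^sub>M M)"
    using assms(2) by (simp cong: measurable_cong_sets)
  from Fubini'[OF this] show ?thesis by simp
qed

definition rot :: "'n \<Rightarrow> complex \<Rightarrow> complex ^ 'n \<Rightarrow> complex ^ 'n" where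
  "rot j u w = w - axis j (w $ j) + axis j (u * w $ j)"

lemma rot_nth: "rot j u w $ i = (if i = j then u * w $ i else w $ i)"
  by (simp add: rot_def axis_def)

lemma norm_rot: "norm u = 1 \<Longrightarrow> norm (rot j u w) = norm w"
  unfolding norm_vec_def by (intro L2_set_cong) (auto simp: rot_nth norm_mult)

lemma rot_measurable[measurable]: "(\<lambda>(u, w). rot j u w) \<in> borel_measurable (borel \<Otimes>\<^sub>M borel)"
  unfolding rot_def by measurable

text \<open>The density depends on the norm only, and \<open>lborel\<close> is preserved since each
  fibre in direction \<open>j\<close> undergoes a rotation of the plane.\<close>

lemma nn_integral_kern_rot:
  assumes [measurable]: "f \<in> borel_measurable borel" and u: "norm u = 1"
  shows "(\<integral>\<^sup>+w. f (rot j u w) \<partial>kern) = (\<integral>\<^sup>+w. f w \<partial>kern)"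
proof -
  have [measurable]: "rot j u \<in> borel_measurable borel"
    unfolding rot_def[abs_def] by measurable
  have "(\<integral>\<^sup>+w. f (rot j u w) \<partial>kern) = (\<integral>\<^sup>+w. kfun (rot j u w) * f (rot j u w) \<partial>lborel)"
    by (simp add: nn_integral_kern kfun_def norm_rot u)
  also have "\<dots> = (\<integral>\<^sup>+w. kfun w * f w \<partial>lborel)"
    unfolding rot_def
    by (rule lborel_fibre_invariance[where f = "\<lambda>w. kfun w * f w" and T = "\<lambda>_ v. u * v"])
       (simp_all add: axis_add axis_uminus nn_integral_complex_rotate u)
  finally show ?thesis by (simp add: nn_integral_kern)
qed

definition scl :: "('n \<Rightarrow> real) \<Rightarrow> complex ^ 'n \<Rightarrow> complex ^ 'n" where
  "scl d w = (\<chi> i. of_real (d i) * w $ i)"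

lemma scl_nth[simp]: "scl d w $ i = of_real (d i) * w $ i"
  by (simp add: scl_def)

lemma continuous_on_scl[continuous_intros]:
  "continuous_on A f \<Longrightarrow> continuous_on A (\<lambda>x. scl d (f x))"
  unfolding scl_def by (intro continuous_intros)

lemma scl_measurable[measurable]: "scl d \<in> borel_measurable borel"
  by (intro borel_measurable_continuous_onI continuous_intros)

lemma scl_const: "scl (\<lambda>_. s) w = s *\<^sub>R w"
  by (simp add: vec_eq_iff scaleR_conv_of_real[symmetric])

text \<open>Every coordinate has its own scale so that a single one can be changed; scale 0 freezes
  a coordinate. The kernel itself is not a product.\<close>

definition kmean :: "('n \<Rightarrow> real) \<Rightarrow> (complex ^ 'n \<Rightarrow> ennreal) \<Rightarrow> complex ^ 'n \<Rightarrow> ennreal" where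
  "kmean d G x = (\<integral>\<^sup>+w. G (x + scl d w) \<partial>kern)"

lemma kmean_measurable[measurable]:
  assumes [measurable]: "G \<in> borel_measurable borel"
  shows "kmean d G \<in> borel_measurable borel"
proof -
  have "(\<lambda>x. \<integral>\<^sup>+w. G (x + scl d w) \<partial>kern) \<in> borel_measurable borel"
    by measurable
  then show ?thesis by (simp add: kmean_def[abs_def])
qed

lemma kmean_0: "kmean (\<lambda>_. 0) G x = G x"
proof -
  have "scl (\<lambda>_. 0) w = 0" for w :: "complex ^ 'a" by (simp add: vec_eq_iff)
  then show ?thesis by (simp add: kmean_def)
qed

text \<open>Averaging over the rotations of coordinate \<open>j\<close>, which leave the kernel
  invariant, displays the mean as an average of circle means in that coordinate. All dependence on
  \<open>d j\<close> now sits in the radius of a \<open>cmean\<close>.\<close>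

lemma kmean_polar:
  fixes G :: "complex ^ 'n \<Rightarrow> ennreal"
  assumes [measurable]: "G \<in> borel_measurable borel"
  shows "kmean d G x =
    (\<integral>\<^sup>+w. cmean (\<lambda>v. G (x + scl (d(j := 0)) w + axis j v)) (of_real (d j) * w $ j) \<partial>kern)"
proof -
  have "kmean d G x = (\<integral>\<^sup>+u. (\<integral>\<^sup>+w. G (x + scl d w) \<partial>kern) \<partial>circle)"
    by (simp add: kmean_def)
  also have "\<dots> = (\<integral>\<^sup>+u. (\<integral>\<^sup>+w. G (x + scl d (rot j u w)) \<partial>kern) \<partial>circle)"
    by (rule nn_integral_circle_cong) (simp add: nn_integral_kern_rot[where f = "\<lambda>w. G (x + scl d w)"])
  also have "\<dots> = (\<integral>\<^sup>+w. (\<integral>\<^sup>+u. G (x + scl d (rot j u w)) \<partial>circle) \<partial>kern)"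
    by (rule circle_tonelli[symmetric]) (unfold_locales, simp, measurable)
  also have "\<dots> = (\<integral>\<^sup>+w. cmean (\<lambda>v. G (x + scl (d(j := 0)) w + axis j v)) (of_real (d j) * w $ j) \<partial>kern)"
  proof -
    have "x + scl d (rot j u w) = x + scl (d(j := 0)) w + axis j (of_real (d j) * w $ j * u)" for u w
      by (simp add: vec_eq_iff rot_nth axis_def)
    then show ?thesis by (simp only: cmean_def)
  qed
  finally show ?thesis .
qed

lemma scl_axis_in_ball:
  fixes x w :: "complex ^ 'n"
  assumes d: "\<And>i. 0 \<le> d i" "\<And>i. d i \<le> \<rho>" and "cball x \<rho> \<subseteq> \<Omega>" and w: "norm w \<le> 1"
    and v: "norm v \<le> \<rho> * norm (w $ j)"
  shows "x + scl (d(j := 0)) w + axis j v \<in> \<Omega>"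
proof -
  have "0 \<le> \<rho>" using d[of undefined] by linarith
  then have "norm (scl (d(j := 0)) w + axis j v) \<le> \<rho> * norm w"
    using d v by (intro norm_vec_le_scale) (auto simp: axis_def norm_mult intro: mult_right_mono)
  also have "\<dots> \<le> \<rho>" using w \<open>0 \<le> \<rho>\<close> by (simp add: mult_left_le)
  finally have "x + (scl (d(j := 0)) w + axis j v) \<in> cball x \<rho>"
    unfolding add_in_cball_iff .
  then show ?thesis using assms(3) by (auto simp: add.assoc)
qed

lemma kmean_antimono1:
  assumes G: "separately_superharmonic \<Omega> G" and x: "cball x \<rho> \<subseteq> \<Omega>"
    and d: "\<And>i. 0 \<le> d i" "\<And>i. d i \<le> \<rho>" and c: "0 \<le> c" "c \<le> d j"
  shows "kmean d G x \<le> kmean (d(j := c)) G x"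
proof -
  note [measurable] = separately_superharmonic_measurable[OF G]
  show ?thesis
    unfolding kmean_polar[OF \<open>G \<in> _\<close>, of d x j] kmean_polar[OF \<open>G \<in> _\<close>, of "d(j := c)" x j]
  proof (rule nn_integral_kern_mono)
    fix w :: "complex ^ 'a" assume w: "norm w \<le> 1"
    let ?y = "x + scl (d(j := 0)) w"
    have sub: "cball 0 (\<rho> * norm (w $ j)) \<subseteq> {v. ?y + axis j v \<in> \<Omega>}"
      using scl_axis_in_ball[OF d x w] by auto
    have "cmean (\<lambda>v. G (?y + axis j v)) (of_real (d j) * w $ j) \<le> cmean (\<lambda>v. G (?y + axis j v)) (of_real c * w $ j)"
      by (rule cmean_antimono[OF separately_superharmonic_slice[OF G] sub])
         (use d c in \<open>auto simp: norm_mult intro!: mult_right_mono\<close>)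
    then show "cmean (\<lambda>v. G (x + scl (d(j := 0)) w + axis j v)) (complex_of_real (d j) * w $ j)
         \<le> cmean (\<lambda>v. G (x + scl ((d(j := c))(j := 0)) w + axis j v)) (complex_of_real ((d(j := c)) j) * w $ j)"
      by simp
  qed
qed

text \<open>The scales are lowered one coordinate at a time; \<open>S\<close> holds the coordinates
  already treated.\<close>

lemma kmean_antimono:
  fixes d d' :: "'n::finite \<Rightarrow> real"
  assumes G: "separately_superharmonic \<Omega> G" and x: "cball x \<rho> \<subseteq> \<Omega>"
    and d: "\<And>i. 0 \<le> d' i" "\<And>i. d' i \<le> d i" "\<And>i. d i \<le> \<rho>"
  shows "kmean d G x \<le> kmean d' G x"
proof -
  have "kmean d G x \<le> kmean (\<lambda>i. if i \<in> S then d' i else d i) G x" if "finite S" for S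
    using that
  proof (induction S)
    case (insert j S)
    let ?e = "\<lambda>i. if i \<in> S then d' i else d i"
    have "kmean ?e G x \<le> kmean (?e(j := d' j)) G x"
      using d insert.hyps order_trans[OF d(1) d(2)] order_trans[OF d(2) d(3)] by (intro kmean_antimono1[OF G x]) auto
    also have "?e(j := d' j) = (\<lambda>i. if i \<in> insert j S then d' i else d i)"
      by auto
    finally show ?case using insert by simp
  qed simp
  from this[of UNIV] show ?thesis by simp
qed

lemma kmean_le:
  fixes d :: "'n::finite \<Rightarrow> real"
  assumes G: "separately_superharmonic \<Omega> G" and x: "cball x \<rho> \<subseteq> \<Omega>"
    and d: "\<And>i. 0 \<le> d i" "\<And>i. d i \<le> \<rho>"
  shows "kmean d G x \<le> G x"
  using kmean_antimono[OF G x, of "\<lambda>_. 0" d] d by (simp add: kmean_0)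

text \<open>A substitute for polar coordinates: the disc integral is averaged over all rotations of
  the integrand.\<close>

lemma nn_integral_ball_cmean:
  assumes [measurable]: "g \<in> borel_measurable borel"
  shows "(\<integral>\<^sup>+v\<in>ball 0 R. g v \<partial>lborel) = (\<integral>\<^sup>+v\<in>ball 0 R. cmean g v \<partial>lborel)"
proof -
  have [measurable]: "ball (0::complex) R \<in> sets borel" by simp
  have "(\<integral>\<^sup>+v\<in>ball 0 R. g v \<partial>lborel) = (\<integral>\<^sup>+u. (\<integral>\<^sup>+v. g v * indicator (ball 0 R) v \<partial>lborel) \<partial>circle)"
    by simp
  also have "\<dots> = (\<integral>\<^sup>+u. (\<integral>\<^sup>+v. g (u * v) * indicator (ball 0 R) (u * v) \<partial>lborel) \<partial>circle)"
    by (intro nn_integral_circle_cong nn_integral_complex_rotate[symmetric, where f = "\<lambda>v. g v * indicator (ball 0 R) v"])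
       measurable
  also have "\<dots> = (\<integral>\<^sup>+u. (\<integral>\<^sup>+v. g (v * u) * indicator (ball 0 R) v \<partial>lborel) \<partial>circle)"
    by (rule nn_integral_circle_cong) (simp add: indicator_def norm_mult mult.commute)
  also have "\<dots> = (\<integral>\<^sup>+v. (\<integral>\<^sup>+u. g (v * u) * indicator (ball 0 R) v \<partial>circle) \<partial>lborel)"
    by (rule circle_tonelli[symmetric]) (unfold_locales, simp, measurable)
  also have "\<dots> = (\<integral>\<^sup>+v\<in>ball 0 R. cmean g v \<partial>lborel)"
    by (simp add: cmean_def nn_integral_multc)
  finally show ?thesis .
qed

lemma emeasure_disc:
  "R \<ge> 0 \<Longrightarrow> emeasure lborel (ball (c::complex) R) = ennreal (pi * R\<^sup>2)"
  by (simp add: emeasure_ball unit_ball_vol_2 flip: power2_eq_square)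

lemma cmean_le_disc:
  assumes g: "superharmonic1 U g" and R: "cball 0 R \<subseteq> U" "R > 0" and b: "norm b = R"
  shows "cmean g b \<le> ennreal (1 / (pi * R\<^sup>2)) * (\<integral>\<^sup>+v\<in>ball 0 R. g v \<partial>lborel)"
proof -
  have [measurable]: "g \<in> borel_measurable borel"
    using g by (auto simp: superharmonic1_def intro: lsc_borel_measurable)
  have "cmean g b * ennreal (pi * R\<^sup>2) = (\<integral>\<^sup>+v\<in>ball (0::complex) R. cmean g b \<partial>lborel)"
    using R by (simp add: nn_integral_cmult_indicator emeasure_disc)
  also have "\<dots> \<le> (\<integral>\<^sup>+v\<in>ball 0 R. cmean g v \<partial>lborel)"
    by (rule nn_integral_mono)
       (use b in \<open>auto simp: indicator_def intro!: cmean_antimono[OF g R(1)]\<close>)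
  also have "\<dots> = (\<integral>\<^sup>+v\<in>ball 0 R. g v \<partial>lborel)"
    by (simp add: nn_integral_ball_cmean)
  finally have "ennreal (1 / (pi * R\<^sup>2)) * (cmean g b * ennreal (pi * R\<^sup>2)) \<le>
      ennreal (1 / (pi * R\<^sup>2)) * (\<integral>\<^sup>+v\<in>ball 0 R. g v \<partial>lborel)"
    by (rule mult_left_mono) simp
  moreover have "ennreal (1 / (pi * R\<^sup>2)) * ennreal (pi * R\<^sup>2) = 1"
    using R by (simp flip: ennreal_mult)
  ultimately show ?thesis by (simp add: mult_ac)
qed

lemma disc_le_superharmonic1:
  assumes g: "superharmonic1 U g" and R: "cball 0 R \<subseteq> U" "R > 0"
  shows "(\<integral>\<^sup>+v\<in>ball 0 R. g v \<partial>lborel) \<le> ennreal (pi * R\<^sup>2) * g 0"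
proof -
  have [measurable]: "g \<in> borel_measurable borel"
    using g by (auto simp: superharmonic1_def intro: lsc_borel_measurable)
  have "(\<integral>\<^sup>+v\<in>ball 0 R. g v \<partial>lborel) = (\<integral>\<^sup>+v\<in>ball 0 R. cmean g v \<partial>lborel)"
    by (simp add: nn_integral_ball_cmean)
  also have "\<dots> \<le> (\<integral>\<^sup>+v\<in>ball (0::complex) R. g 0 \<partial>lborel)"
    by (rule nn_integral_mono)
       (auto simp: indicator_def intro!: cmean_antimono[OF g R(1), of 0, simplified])
  also have "\<dots> = ennreal (pi * R\<^sup>2) * g 0"
    using R by (simp add: nn_integral_cmult_indicator emeasure_disc mult.commute)
  finally show ?thesis .
qed

lemma cball_subset_cball_half: "cball (x::complex) (R / 2) \<subseteq> cball x R"
  by (cases "0 \<le> R") (auto simp: cball_subset_cball_iff)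

text \<open>Apply \<open>cmean_doubling\<close> under the integral of \<open>kmean_polar\<close>.
  Monotonicity in the radius bounds the error term, a circle mean at radius \<open>R / 2\<close>, by
  the average over the disc of that radius, whose area accounts for
  \<open>4 / (pi * R\<^sup>2)\<close>. The remaining means in the other coordinates are removed by
  \<open>kmean_le\<close> after exchanging the integrals.\<close>

lemma kmean_doubling:
  fixes G :: "complex ^ 'n \<Rightarrow> ennreal"
  assumes G: "separately_superharmonic \<Omega> G" and x: "cball x (\<rho> + R) \<subseteq> \<Omega>" and R: "R > 0"
    and d: "\<And>i. 0 \<le> d i" "\<And>i. d i \<le> \<rho>" and s: "2 * d j \<le> R"
  shows "kmean d G x \<le> kmean (d(j := 2 * d j)) G x +
     ennreal (4 / (pi * R\<^sup>2)) * (\<integral>\<^sup>+v\<in>ball 0 (R / 2). G (x + axis j v) \<partial>lborel)"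
proof -
  note [measurable] = separately_superharmonic_measurable[OF G]
  have Gm: "G \<in> borel_measurable borel" by measurable
  have \<rho>: "0 \<le> \<rho>" using d[of j] by linarith
  let ?y = "\<lambda>w. x + scl (d(j := 0)) w"
  have [measurable]: "?y \<in> borel_measurable borel" by measurable
  have [measurable]: "ball (0::complex) (R / 2) \<in> sets borel" by simp
  have *: "?y w + axis j v \<in> \<Omega>" if "norm w \<le> 1" "norm v \<le> R" for v w
  proof -
    have "norm (scl (d(j := 0)) w) \<le> \<rho> * norm w"
      using d \<rho> by (intro norm_vec_le_scale) (auto simp: norm_mult intro: mult_right_mono)
    also have "\<dots> \<le> \<rho>" using that \<rho> by (simp add: mult_left_le)
    finally have "norm (scl (d(j := 0)) w + axis j v) \<le> \<rho> + R"
      using that by (intro norm_triangle_le) (simp add: norm_axis)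
    then have "x + (scl (d(j := 0)) w + axis j v) \<in> cball x (\<rho> + R)"
      unfolding add_in_cball_iff .
    then show ?thesis using x by (auto simp: add.assoc)
  qed
  have "kmean d G x = (\<integral>\<^sup>+w. cmean (\<lambda>v. G (?y w + axis j v)) (of_real (d j) * w $ j) \<partial>kern)"
    by (rule kmean_polar[OF Gm])
  also have "\<dots> \<le> (\<integral>\<^sup>+w. cmean (\<lambda>v. G (?y w + axis j v)) (of_real (2 * d j) * w $ j) +
      ennreal (4 / (pi * R\<^sup>2)) * (\<integral>\<^sup>+v. G (?y w + axis j v) * indicator (ball 0 (R / 2)) v \<partial>lborel) \<partial>kern)"
  proof (rule nn_integral_kern_mono)
    fix w :: "complex ^ 'n" assume w: "norm w \<le> 1"
    have wj: "norm (w $ j) \<le> 1" by (rule order_trans[OF Finite_Cartesian_Product.norm_nth_le w])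
    have sub: "cball 0 R \<subseteq> {v. ?y w + axis j v \<in> \<Omega>}" using * w by auto
    note sh = separately_superharmonic_slice[OF G, of "?y w" j]
    have "norm (of_real (d j) * w $ j) \<le> d j" using wj d[of j] by (simp add: norm_mult mult_left_le)
    then have "2 * norm (of_real (d j) * w $ j) \<le> R" using s by linarith
    from cmean_doubling[OF sh sub this]
    have 1: "cmean (\<lambda>v. G (?y w + axis j v)) (of_real (d j) * w $ j) \<le>
       cmean (\<lambda>v. G (?y w + axis j v)) (of_real (2 * d j) * w $ j) +
       cmean (\<lambda>v. G (?y w + axis j v)) (of_real R / 2)"
      by (simp only: of_real_mult mult.assoc of_real_numeral)
    have "cmean (\<lambda>v. G (?y w + axis j v)) (of_real R / 2) \<le>
       ennreal (1 / (pi * (R / 2)\<^sup>2)) * (\<integral>\<^sup>+v\<in>ball 0 (R / 2). G (?y w + axis j v) \<partial>lborel)"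
      using order_trans[OF cball_subset_cball_half sub] R by (intro cmean_le_disc[OF sh]) (auto simp: norm_divide)
    also have "1 / (pi * (R / 2)\<^sup>2) = 4 / (pi * R\<^sup>2)" by (simp add: power_divide)
    finally show "cmean (\<lambda>v. G (?y w + axis j v)) (of_real (d j) * w $ j) \<le>
       cmean (\<lambda>v. G (?y w + axis j v)) (of_real (2 * d j) * w $ j) +
       ennreal (4 / (pi * R\<^sup>2)) * (\<integral>\<^sup>+v\<in>ball 0 (R / 2). G (?y w + axis j v) \<partial>lborel)"
      by (intro order_trans[OF 1] add_left_mono)
  qed
  also have "\<dots> = (\<integral>\<^sup>+w. cmean (\<lambda>v. G (?y w + axis j v)) (of_real (2 * d j) * w $ j) \<partial>kern) +
      (\<integral>\<^sup>+w. ennreal (4 / (pi * R\<^sup>2)) * (\<integral>\<^sup>+v. G (?y w + axis j v) * indicator (ball 0 (R / 2)) v \<partial>lborel) \<partial>kern)"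
    unfolding cmean_def by (rule nn_integral_add) measurable
  also have "(\<integral>\<^sup>+w. cmean (\<lambda>v. G (?y w + axis j v)) (of_real (2 * d j) * w $ j) \<partial>kern) = kmean (d(j := 2 * d j)) G x"
    by (simp add: kmean_polar[OF Gm, where j = j])
  also have "(\<integral>\<^sup>+w. ennreal (4 / (pi * R\<^sup>2)) * (\<integral>\<^sup>+v. G (?y w + axis j v) * indicator (ball 0 (R / 2)) v \<partial>lborel) \<partial>kern) =
      ennreal (4 / (pi * R\<^sup>2)) * (\<integral>\<^sup>+w. (\<integral>\<^sup>+v. G (?y w + axis j v) * indicator (ball 0 (R / 2)) v \<partial>lborel) \<partial>kern)"
    by (rule nn_integral_cmult) measurable
  also have "(\<integral>\<^sup>+w. (\<integral>\<^sup>+v. G (?y w + axis j v) * indicator (ball 0 (R / 2)) v \<partial>lborel) \<partial>kern) =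
      (\<integral>\<^sup>+v. (\<integral>\<^sup>+w. G (?y w + axis j v) * indicator (ball 0 (R / 2)) v \<partial>kern) \<partial>lborel)"
    by (rule kern_tonelli[symmetric]) (unfold_locales, simp, measurable)
  also have "\<dots> = (\<integral>\<^sup>+v. kmean (d(j := 0)) G (x + axis j v) * indicator (ball 0 (R / 2)) v \<partial>lborel)"
    by (simp add: kmean_def nn_integral_multc add_ac)
  finally have 1: "kmean d G x \<le> kmean (d(j := 2 * d j)) G x +
     ennreal (4 / (pi * R\<^sup>2)) * (\<integral>\<^sup>+v. kmean (d(j := 0)) G (x + axis j v) * indicator (ball 0 (R / 2)) v \<partial>lborel)" .
  have "(\<integral>\<^sup>+v. kmean (d(j := 0)) G (x + axis j v) * indicator (ball 0 (R / 2)) v \<partial>lborel) \<le>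
     (\<integral>\<^sup>+v. G (x + axis j v) * indicator (ball 0 (R / 2)) v \<partial>lborel)"
  proof (rule nn_integral_mono)
    fix v :: complex
    show "kmean (d(j := 0)) G (x + axis j v) * indicator (ball 0 (R / 2)) v \<le> G (x + axis j v) * indicator (ball 0 (R / 2)) v"
    proof (cases "v \<in> ball 0 (R / 2)")
      case True
      have "cball (x + axis j v) \<rho> \<subseteq> cball x (\<rho> + R)"
        using True R \<rho> by (auto simp: cball_subset_cball_iff dist_norm norm_axis)
      then have "kmean (d(j := 0)) G (x + axis j v) \<le> G (x + axis j v)"
        using x d \<rho> by (intro kmean_le[OF G]) auto
      then show ?thesis by (simp add: mult_right_mono)
    qed simp
  qed
  then show ?thesis by (intro order_trans[OF 1] add_left_mono mult_left_mono) simp_all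
qed

section \<open>Second order cancellation\<close>

text \<open>Continuously differentiable with Lipschitz gradient, hence with second differences of
  order \<open>(norm v / \<rho>)\<^sup>2\<close>; being the squared positive part of a quadratic
  polynomial, it permits algebraic proofs of these bounds.\<close>

definition bump :: "real \<Rightarrow> complex \<Rightarrow> real" where
  "bump \<rho> z = (max 0 (1 - (norm z / \<rho>)\<^sup>2))\<^sup>2"

lemma bump_nonneg: "0 \<le> bump \<rho> z"
  by (simp add: bump_def)

lemma bump_le_1: "bump \<rho> z \<le> 1"
  unfolding bump_def by (rule power_le_one) auto

lemma bump_eq_0:
  assumes "0 < \<rho>" "\<rho> \<le> norm z"
  shows "bump \<rho> z = 0"
proof -
  have "1 \<le> norm z / \<rho>" using assms by simp
  then have "1 \<le> (norm z / \<rho>)\<^sup>2" by (rule one_le_power)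
  then show ?thesis unfolding bump_def by simp
qed

lemma bump_ge_half:
  assumes "0 < \<rho>" "norm z \<le> \<rho> / 2"
  shows "1 / 2 \<le> bump \<rho> z"
proof -
  have "norm z / \<rho> \<le> 1 / 2" using assms by (simp add: field_simps)
  then have "(norm z / \<rho>)\<^sup>2 \<le> (1 / 2)\<^sup>2" using assms by (intro power_mono) auto
  moreover have "(1 / 2 :: real)\<^sup>2 = 1 / 4" by (simp add: power2_eq_square)
  ultimately have "3 / 4 \<le> 1 - (norm z / \<rho>)\<^sup>2" by linarith
  then have "3 / 4 \<le> max 0 (1 - (norm z / \<rho>)\<^sup>2)" by linarith
  then have "(3 / 4)\<^sup>2 \<le> bump \<rho> z" unfolding bump_def by (rule power_mono) simp
  then show ?thesis by (simp add: power2_eq_square)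
qed

lemma bump_measurable[measurable]: "bump \<rho> \<in> borel_measurable borel"
  unfolding bump_def by measurable

text \<open>The function \<open>\<lambda>a. (max 0 a)\<^sup>2\<close> is convex with derivative
  \<open>2 * max 0 a\<close>, and that derivative has Lipschitz constant 2: these are the tangent
  bound from below and the quadratic bound from above.\<close>

lemma pos_part_square_bounds:
  fixes a b :: real
  shows "(max 0 a)\<^sup>2 + 2 * max 0 a * (b - a) \<le> (max 0 b)\<^sup>2"
    and "(max 0 b)\<^sup>2 \<le> (max 0 a)\<^sup>2 + 2 * max 0 a * (b - a) + (b - a)\<^sup>2"
proof -
  have *: "A\<^sup>2 + 2 * A * (b - a) \<le> B\<^sup>2" if "0 \<le> (A - B)\<^sup>2" "A * b \<le> A * B" "A * a = A * A" for A B
  proof -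
    have "A\<^sup>2 + 2 * A * (b - a) = A * A + 2 * (A * b) - 2 * (A * a)" "(A - B)\<^sup>2 = A * A - 2 * (A * B) + B * B" "B\<^sup>2 = B * B"
      by (simp_all add: power2_eq_square algebra_simps)
    then show ?thesis using that by linarith
  qed
  have "max 0 a * b \<le> max 0 a * max 0 b" by (intro mult_left_mono) auto
  moreover have "max 0 a * a = max 0 a * max 0 a" by (simp add: max_def)
  ultimately show "(max 0 a)\<^sup>2 + 2 * max 0 a * (b - a) \<le> (max 0 b)\<^sup>2"
    by (intro *) simp_all
  consider "a \<ge> 0" "b \<ge> 0" | "a \<ge> 0" "b < 0" | "a < 0" "b \<ge> 0" | "a < 0" "b < 0" by linarith
  then show "(max 0 b)\<^sup>2 \<le> (max 0 a)\<^sup>2 + 2 * max 0 a * (b - a) + (b - a)\<^sup>2"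
  proof cases
    case 1 then show ?thesis by (simp add: max_def power2_eq_square algebra_simps)
  next
    case 2
    then have "(max 0 a)\<^sup>2 + 2 * max 0 a * (b - a) + (b - a)\<^sup>2 = b\<^sup>2"
      by (simp add: max_def power2_eq_square algebra_simps)
    then show ?thesis using 2 by simp
  next
    case 3
    then have "b\<^sup>2 \<le> (b - a)\<^sup>2" by (intro power_mono) auto
    then show ?thesis using 3 by simp
  qed simp
qed

text \<open>The arguments of the squared positive part change by \<open>w - t\<^sup>2\<close> and
  \<open>- w - t\<^sup>2\<close>, where \<open>w\<close> is linear in \<open>v\<close>. In the sum
  the linear terms cancel and only multiples of \<open>t\<^sup>2\<close> remain. Beyond
  \<open>ball 0 (2 * \<rho>)\<close> all three bumps vanish.\<close>

lemma bump_symmetrized: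
  assumes \<rho>: "0 < \<rho>" and v: "norm v \<le> \<rho>"
  shows "bump \<rho> (z - v) + bump \<rho> (z + v) \<le> 2 * bump \<rho> z + 50 * (norm v / \<rho>)\<^sup>2 * indicator (ball 0 (2 * \<rho>)) z"
    and "2 * bump \<rho> z \<le> bump \<rho> (z - v) + bump \<rho> (z + v) + 4 * (norm v / \<rho>)\<^sup>2 * indicator (ball 0 (2 * \<rho>)) z"
proof -
  define a where "a = 1 - (norm z / \<rho>)\<^sup>2"
  define b where "b = 1 - (norm (z - v) / \<rho>)\<^sup>2"
  define b' where "b' = 1 - (norm (z + v) / \<rho>)\<^sup>2"
  define m where "m = max 0 a"
  define t where "t = norm v / \<rho>"
  define w where "w = 2 * (z \<bullet> v) / \<rho>\<^sup>2"
  have m: "0 \<le> m" "m \<le> 1" by (auto simp: m_def a_def)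
  have ba: "b - a = w - t\<^sup>2" "b' - a = - w - t\<^sup>2"
    using \<rho> by (simp_all add: a_def b_def b'_def w_def t_def power_divide power2_norm_eq_inner
      inner_simps inner_commute diff_divide_distrib add_divide_distrib)
  have 1: "m\<^sup>2 + 2 * m * (w - t\<^sup>2) \<le> bump \<rho> (z - v)" "m\<^sup>2 + 2 * m * (- w - t\<^sup>2) \<le> bump \<rho> (z + v)"
    using pos_part_square_bounds(1)[of a b] pos_part_square_bounds(1)[of a b']
    unfolding bump_def b_def[symmetric] b'_def[symmetric] m_def[symmetric] ba[symmetric] by simp_all
  have 2: "bump \<rho> (z - v) \<le> m\<^sup>2 + 2 * m * (w - t\<^sup>2) + (w - t\<^sup>2)\<^sup>2"
     "bump \<rho> (z + v) \<le> m\<^sup>2 + 2 * m * (- w - t\<^sup>2) + (- w - t\<^sup>2)\<^sup>2"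
    using pos_part_square_bounds(2)[of b a] pos_part_square_bounds(2)[of b' a]
    unfolding bump_def b_def[symmetric] b'_def[symmetric] m_def[symmetric] ba[symmetric] by simp_all
  have bz: "bump \<rho> z = m\<^sup>2" by (simp add: bump_def m_def a_def)
  have t: "0 \<le> t" "t \<le> 1" using \<rho> v by (simp_all add: t_def)
  have mt: "m * t\<^sup>2 \<le> t\<^sup>2" "0 \<le> m * t\<^sup>2" using m by (simp_all add: mult_left_le_one_le)
  have far: "bump \<rho> (z - v) = 0 \<and> bump \<rho> (z + v) = 0 \<and> bump \<rho> z = 0" if "z \<notin> ball 0 (2 * \<rho>)"
  proof -
    have "2 * \<rho> \<le> norm z" using that by simp
    moreover have "norm z \<le> norm (z - v) + norm v" "norm z \<le> norm (z + v) + norm v" by norm+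
    ultimately show ?thesis using v \<rho> by (intro conjI bump_eq_0) auto
  qed
  show "2 * bump \<rho> z \<le> bump \<rho> (z - v) + bump \<rho> (z + v) + 4 * (norm v / \<rho>)\<^sup>2 * indicator (ball 0 (2 * \<rho>)) z"
  proof (cases "z \<in> ball 0 (2 * \<rho>)")
    case True
    have "2 * m\<^sup>2 \<le> bump \<rho> (z - v) + bump \<rho> (z + v) + 4 * (m * t\<^sup>2)"
      using 1 by (simp add: algebra_simps)
    then show ?thesis using True mt by (simp add: bz t_def[symmetric])
  qed (use far in simp)
  show "bump \<rho> (z - v) + bump \<rho> (z + v) \<le> 2 * bump \<rho> z + 50 * (norm v / \<rho>)\<^sup>2 * indicator (ball 0 (2 * \<rho>)) z"
  proof (cases "z \<in> ball 0 (2 * \<rho>)")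
    case True
    \<comment> \<open>Since \<open>norm z < 2 * \<rho>\<close>, \<open>w\<close> is at most
      \<open>4 * t\<close> in absolute value; with \<open>t\<^sup>2 \<le> t\<close> both increments
      are at most \<open>5 * t\<close>, and two squares of it give 50.\<close>
    have "\<bar>z \<bullet> v\<bar> \<le> norm z * norm v" by (rule Cauchy_Schwarz_ineq2)
    also have "\<dots> \<le> (2 * \<rho>) * norm v" using True by (intro mult_right_mono) auto
    finally have "\<bar>w\<bar> \<le> 4 * t"
      using \<rho> by (simp add: w_def t_def abs_mult field_simps power2_eq_square)
    moreover have "t\<^sup>2 \<le> t" using t by (simp add: power2_eq_square mult_left_le)
    ultimately have "\<bar>w - t\<^sup>2\<bar> \<le> 5 * t \<and> \<bar>- w - t\<^sup>2\<bar> \<le> 5 * t"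
      using t zero_le_power2[of t] unfolding abs_le_iff by linarith
    then have "(w - t\<^sup>2)\<^sup>2 \<le> (5 * t)\<^sup>2" "(- w - t\<^sup>2)\<^sup>2 \<le> (5 * t)\<^sup>2"
      using t by (simp_all only: abs_le_square_iff[symmetric] abs_mult) auto
    then have "bump \<rho> (z - v) + bump \<rho> (z + v) \<le> 2 * m\<^sup>2 - 4 * (m * t\<^sup>2) + 2 * (5 * t)\<^sup>2"
      using 2 by (simp add: algebra_simps)
    then show ?thesis using True mt by (simp add: bz t_def[symmetric] power2_eq_square)
  qed (use far in simp)
qed

text \<open>Through the unshifted bump: the upper bound costs 50, the lower bound 4.\<close>

lemma bump_symmetrized_compare:
  assumes \<rho>: "0 < \<rho>" and v: "norm v \<le> m" "norm v' \<le> m" and m: "m \<le> \<rho>"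
  shows "bump \<rho> (z - v) + bump \<rho> (z + v) \<le>
     bump \<rho> (z - v') + bump \<rho> (z + v') + 54 * (m / \<rho>)\<^sup>2 * indicator (ball 0 (2 * \<rho>)) z"
proof -
  have "(norm v / \<rho>)\<^sup>2 \<le> (m / \<rho>)\<^sup>2" "(norm v' / \<rho>)\<^sup>2 \<le> (m / \<rho>)\<^sup>2"
    using v \<rho> by (auto intro!: power_mono divide_right_mono)
  then have "50 * (norm v / \<rho>)\<^sup>2 * indicator (ball 0 (2 * \<rho>)) z + 4 * (norm v' / \<rho>)\<^sup>2 * indicator (ball 0 (2 * \<rho>)) z
     \<le> 54 * (m / \<rho>)\<^sup>2 * indicator (ball 0 (2 * \<rho>)) z"
    by (auto simp: indicator_def)
  then show ?thesis
    using bump_symmetrized(1)[of \<rho> v z] bump_symmetrized(2)[of \<rho> v' z] assms by linarith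
qed

lemma kmean_kmean:
  fixes G :: "complex ^ 'n \<Rightarrow> ennreal"
  shows "kmean b (kmean d G) x = (\<integral>\<^sup>+u. (\<integral>\<^sup>+w. G (x + scl b u + scl d w) \<partial>kern) \<partial>kern)"
  by (simp add: kmean_def)

text \<open>Translating \<open>x\<close> along \<open>axis j\<close> moves the \<open>j\<close>-th
  part of both displacements from \<open>G\<close> to the bump. The factor \<open>\<theta>\<close>
  is untouched because it is constant in that direction.\<close>

lemma bump_pairing_shift:
  fixes G :: "complex ^ 'n \<Rightarrow> ennreal" and c :: "complex ^ 'n"
  assumes [measurable]: "G \<in> borel_measurable borel" "\<theta> \<in> borel_measurable borel"
    and \<theta>: "\<And>x v. \<theta> (x + axis j v) = \<theta> x"
  shows "(\<integral>\<^sup>+x. \<theta> x * ennreal (bump \<rho> (x $ j - c $ j)) * kmean b (kmean d G) x \<partial>lborel) =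
    (\<integral>\<^sup>+u. (\<integral>\<^sup>+w. (\<integral>\<^sup>+x. \<theta> x * ennreal (bump \<rho> (x $ j - c $ j - (of_real (b j) * u $ j + of_real (d j) * w $ j)))
        * G (x + (scl (b(j := 0)) u + scl (d(j := 0)) w)) \<partial>lborel) \<partial>kern) \<partial>kern)"
proof -
  have "(\<integral>\<^sup>+x. \<theta> x * ennreal (bump \<rho> (x $ j - c $ j)) * kmean b (kmean d G) x \<partial>lborel) =
     (\<integral>\<^sup>+x. (\<integral>\<^sup>+u. (\<integral>\<^sup>+w. \<theta> x * ennreal (bump \<rho> (x $ j - c $ j)) * G (x + scl b u + scl d w) \<partial>kern) \<partial>kern) \<partial>lborel)"
    unfolding kmean_kmean by (simp add: nn_integral_cmult)
  also have "\<dots> = (\<integral>\<^sup>+u. (\<integral>\<^sup>+x. (\<integral>\<^sup>+w. \<theta> x * ennreal (bump \<rho> (x $ j - c $ j)) * G (x + scl b u + scl d w) \<partial>kern) \<partial>lborel) \<partial>kern)"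
    by (rule kern_tonelli) (unfold_locales, simp, measurable)
  also have "\<dots> = (\<integral>\<^sup>+u. (\<integral>\<^sup>+w. (\<integral>\<^sup>+x. \<theta> x * ennreal (bump \<rho> (x $ j - c $ j)) * G (x + scl b u + scl d w) \<partial>lborel) \<partial>kern) \<partial>kern)"
    by (rule nn_integral_cong, rule kern_tonelli) (unfold_locales, simp, measurable)
  also have "\<dots> = (\<integral>\<^sup>+u. (\<integral>\<^sup>+w. (\<integral>\<^sup>+x. \<theta> x * ennreal (bump \<rho> (x $ j - c $ j - (of_real (b j) * u $ j + of_real (d j) * w $ j)))
        * G (x + (scl (b(j := 0)) u + scl (d(j := 0)) w)) \<partial>lborel) \<partial>kern) \<partial>kern)"
  proof (rule nn_integral_cong, rule nn_integral_cong)
    fix u w :: "complex ^ 'n"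
    let ?v = "of_real (b j) * u $ j + of_real (d j) * w $ j"
    let ?q = "scl (b(j := 0)) u + scl (d(j := 0)) w"
    let ?f = "\<lambda>x. \<theta> x * ennreal (bump \<rho> (x $ j - c $ j - ?v)) * G (x + ?q)"
    have eq: "x + scl b u + scl d w = (x + axis j ?v) + ?q" for x
      by (simp add: vec_eq_iff axis_def)
    have "\<theta> x * ennreal (bump \<rho> (x $ j - c $ j)) * G (x + scl b u + scl d w) = ?f (x + axis j ?v)" for x
      unfolding eq by (simp add: \<theta>)
    then have "(\<integral>\<^sup>+x. \<theta> x * ennreal (bump \<rho> (x $ j - c $ j)) * G (x + scl b u + scl d w) \<partial>lborel) =
       (\<integral>\<^sup>+x. ?f (x + axis j ?v) \<partial>lborel)" by simp
    also have "\<dots> = (\<integral>\<^sup>+x. ?f x \<partial>lborel)"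
      by (rule nn_integral_lborel_shift) measurable
    finally show "(\<integral>\<^sup>+x. \<theta> x * ennreal (bump \<rho> (x $ j - c $ j)) * G (x + scl b u + scl d w) \<partial>lborel) = (\<integral>\<^sup>+x. ?f x \<partial>lborel)" .
  qed
  finally show ?thesis .
qed

text \<open>Two applications of the rotation invariance of \<open>kern\<close>, with the rotation by
  -1 in coordinate \<open>j\<close>.\<close>

lemma kern_reflect:
  fixes f :: "complex ^ 'n \<Rightarrow> complex ^ 'n \<Rightarrow> ennreal"
  assumes [measurable]: "(\<lambda>(u, w). f u w) \<in> borel_measurable (borel \<Otimes>\<^sub>M borel)"
  shows "(\<integral>\<^sup>+u. (\<integral>\<^sup>+w. f (rot j (-1) u) (rot j (-1) w) \<partial>kern) \<partial>kern) = (\<integral>\<^sup>+u. (\<integral>\<^sup>+w. f u w \<partial>kern) \<partial>kern)"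
proof -
  have "(\<integral>\<^sup>+u. (\<integral>\<^sup>+w. f (rot j (-1) u) (rot j (-1) w) \<partial>kern) \<partial>kern) = (\<integral>\<^sup>+u. (\<integral>\<^sup>+w. f (rot j (-1) u) w \<partial>kern) \<partial>kern)"
    by (rule nn_integral_cong, rule nn_integral_kern_rot) simp_all
  also have "\<dots> = (\<integral>\<^sup>+u. (\<integral>\<^sup>+w. f u w \<partial>kern) \<partial>kern)"
    by (rule nn_integral_kern_rot[where f = "\<lambda>u. \<integral>\<^sup>+w. f u w \<partial>kern"]) simp_all
  finally show ?thesis .
qed

text \<open>After the \<open>j\<close>-shifts have been moved onto the bump and symmetrized, the first order terms
  cancel; this is where the factor \<open>(m / \<rho>)\<^sup>2\<close> comes from.\<close>

lemma bump_pairing_compare: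
  fixes G :: "complex ^ 'n \<Rightarrow> ennreal" and c :: "complex ^ 'n"
  assumes Gm[measurable]: "G \<in> borel_measurable borel" and \<theta>m[measurable]: "\<theta> \<in> borel_measurable borel"
    and \<theta>: "\<And>x v. \<theta> (x + axis j v) = \<theta> x"
    and \<rho>: "0 < \<rho>" "m \<le> \<rho>" and bd: "0 \<le> b j" "0 \<le> d j" "0 \<le> e" "b j + d j \<le> m" "b j + e \<le> m"
  defines "P \<equiv> \<lambda>d. (\<integral>\<^sup>+x. \<theta> x * ennreal (bump \<rho> (x $ j - c $ j)) * kmean b (kmean d G) x \<partial>lborel)"
  shows "2 * P d \<le> 2 * P (d(j := e)) + ennreal (54 * (m / \<rho>)\<^sup>2) *
    (\<integral>\<^sup>+x. \<theta> x * indicator (ball 0 (2 * \<rho>)) (x $ j - c $ j) * kmean (b(j := 0)) (kmean (d(j := 0)) G) x \<partial>lborel)"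
proof -
  \<comment> \<open>\<open>V t\<close> is the total displacement in coordinate \<open>j\<close> when
    the inner scale there is \<open>t\<close>; \<open>q\<close> collects the other coordinates and
    does not involve \<open>t\<close>.\<close>
  define q where "q u w = scl (b(j := 0)) u + scl (d(j := 0)) w" for u w
  define V where "V t u w = of_real (b j) * u $ j + of_real t * w $ j" for t :: real and u w :: "complex ^ 'n"
  define \<Psi> where "\<Psi> v p = (\<integral>\<^sup>+x. \<theta> x * ennreal (bump \<rho> (x $ j - c $ j - v)) * G (x + p) \<partial>lborel)" for v p
  have [measurable]: "(\<lambda>(u, w). q u w) \<in> borel_measurable (borel \<Otimes>\<^sub>M borel)"
    unfolding q_def by measurable
  have [measurable]: "(\<lambda>(u, w). V t u w) \<in> borel_measurable (borel \<Otimes>\<^sub>M borel)" for t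
    unfolding V_def by measurable
  have [measurable]: "(\<lambda>(v, p). \<Psi> v p) \<in> borel_measurable (borel \<Otimes>\<^sub>M borel)"
    unfolding \<Psi>_def by measurable
  have [measurable]: "ball (0::complex) (2 * \<rho>) \<in> sets borel" by simp
  have P: "P (d(j := t)) = (\<integral>\<^sup>+u. (\<integral>\<^sup>+w. \<Psi> (V t u w) (q u w) \<partial>kern) \<partial>kern)" for t
    unfolding P_def bump_pairing_shift[OF Gm \<theta>m \<theta>] \<Psi>_def q_def V_def by simp
  \<comment> \<open>The reflection reverses \<open>V\<close> and fixes \<open>q\<close>. This gives
    \<open>P\<close> two expressions, whose sum contains the symmetrized bump.\<close>
  have refl: "V t (rot j (-1) u) (rot j (-1) w) = - V t u w" "q (rot j (-1) u) (rot j (-1) w) = q u w" for t u w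
    by (simp_all add: V_def q_def rot_nth vec_eq_iff)
  have P': "P (d(j := t)) = (\<integral>\<^sup>+u. (\<integral>\<^sup>+w. \<Psi> (- V t u w) (q u w) \<partial>kern) \<partial>kern)" for t
    unfolding P using kern_reflect[of "\<lambda>u w. \<Psi> (V t u w) (q u w)" j] unfolding refl by simp
  have 2: "2 * P (d(j := t)) = (\<integral>\<^sup>+u. (\<integral>\<^sup>+w. \<Psi> (V t u w) (q u w) + \<Psi> (- V t u w) (q u w) \<partial>kern) \<partial>kern)" for t
  proof -
    have "2 * P (d(j := t)) = P (d(j := t)) + P (d(j := t))" by (simp add: mult_2)
    also have "\<dots> = (\<integral>\<^sup>+u. (\<integral>\<^sup>+w. \<Psi> (V t u w) (q u w) \<partial>kern) + (\<integral>\<^sup>+w. \<Psi> (- V t u w) (q u w) \<partial>kern) \<partial>kern)"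
      by (subst (1) P, subst P', rule nn_integral_add[symmetric]) measurable
    also have "\<dots> = (\<integral>\<^sup>+u. (\<integral>\<^sup>+w. \<Psi> (V t u w) (q u w) + \<Psi> (- V t u w) (q u w) \<partial>kern) \<partial>kern)"
      by (intro nn_integral_cong nn_integral_add[symmetric]) measurable
    finally show ?thesis .
  qed
  define Q where "Q p = (\<integral>\<^sup>+x. \<theta> x * indicator (ball 0 (2 * \<rho>)) (x $ j - c $ j) * G (x + p) \<partial>lborel)" for p
  have [measurable]: "Q \<in> borel_measurable borel"
    unfolding Q_def[abs_def] by measurable
  let ?K = "ennreal (54 * (m / \<rho>)\<^sup>2)"
  have "2 * P d = 2 * P (d(j := d j))" by simp
  also have "\<dots> \<le> (\<integral>\<^sup>+u. (\<integral>\<^sup>+w. (\<Psi> (V e u w) (q u w) + \<Psi> (- V e u w) (q u w)) + ?K * Q (q u w) \<partial>kern) \<partial>kern)"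
    unfolding 2
  proof (rule nn_integral_kern_mono, rule nn_integral_kern_mono)
    fix u w :: "complex ^ 'n" assume uw: "norm u \<le> 1" "norm w \<le> 1"
    have nV: "norm (V t u w) \<le> m" if "0 \<le> t" "b j + t \<le> m" for t
    proof -
      have "norm (u $ j) \<le> 1" "norm (w $ j) \<le> 1"
        using uw by (auto intro: order_trans[OF Finite_Cartesian_Product.norm_nth_le])
      then have "b j * norm (u $ j) \<le> b j" "t * norm (w $ j) \<le> t"
        using that bd by (auto intro: mult_left_le)
      moreover have "norm (V t u w) \<le> b j * norm (u $ j) + t * norm (w $ j)"
        unfolding V_def using that bd by (intro order_trans[OF norm_triangle_ineq]) (simp add: norm_mult)
      ultimately show ?thesis using that by linarith
    qed
    have sum: "\<Psi> v p + \<Psi> (- v) p = (\<integral>\<^sup>+x. \<theta> x * ennreal (bump \<rho> (x $ j - c $ j - v) + bump \<rho> (x $ j - c $ j + v)) * G (x + p) \<partial>lborel)" for v p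
      unfolding \<Psi>_def
      by (subst nn_integral_add[symmetric]) (measurable, simp add: ennreal_plus bump_nonneg algebra_simps)
    have "\<Psi> (V (d j) u w) (q u w) + \<Psi> (- V (d j) u w) (q u w) \<le>
       (\<integral>\<^sup>+x. \<theta> x * ennreal (bump \<rho> (x $ j - c $ j - V e u w) + bump \<rho> (x $ j - c $ j + V e u w)) * G (x + q u w)
         + ?K * (\<theta> x * indicator (ball 0 (2 * \<rho>)) (x $ j - c $ j) * G (x + q u w)) \<partial>lborel)"
      unfolding sum
    proof (rule nn_integral_mono)
      fix x :: "complex ^ 'n"
      let ?z = "x $ j - c $ j"
      have "bump \<rho> (?z - V (d j) u w) + bump \<rho> (?z + V (d j) u w) \<le>
         bump \<rho> (?z - V e u w) + bump \<rho> (?z + V e u w) + 54 * (m / \<rho>)\<^sup>2 * indicator (ball 0 (2 * \<rho>)) ?z"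
        by (rule bump_symmetrized_compare[OF \<rho>(1) _ _ \<rho>(2)]) (use bd nV in auto)
      then have "ennreal (bump \<rho> (?z - V (d j) u w) + bump \<rho> (?z + V (d j) u w)) \<le>
         ennreal (bump \<rho> (?z - V e u w) + bump \<rho> (?z + V e u w)) + ennreal (54 * (m / \<rho>)\<^sup>2 * indicator (ball 0 (2 * \<rho>)) ?z)"
        by (subst ennreal_plus[symmetric]) (auto intro!: ennreal_leI add_nonneg_nonneg bump_nonneg)
      also have "ennreal (54 * (m / \<rho>)\<^sup>2 * indicator (ball 0 (2 * \<rho>)) ?z) = ?K * indicator (ball 0 (2 * \<rho>)) ?z"
        by (simp add: indicator_def)
      finally have "ennreal (bump \<rho> (?z - V (d j) u w) + bump \<rho> (?z + V (d j) u w)) * (\<theta> x * G (x + q u w)) \<le>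
        (ennreal (bump \<rho> (?z - V e u w) + bump \<rho> (?z + V e u w)) + ?K * indicator (ball 0 (2 * \<rho>)) ?z) * (\<theta> x * G (x + q u w))"
        by (rule mult_right_mono) simp
      then show "\<theta> x * ennreal (bump \<rho> (?z - V (d j) u w) + bump \<rho> (?z + V (d j) u w)) * G (x + q u w) \<le>
        \<theta> x * ennreal (bump \<rho> (?z - V e u w) + bump \<rho> (?z + V e u w)) * G (x + q u w)
         + ?K * (\<theta> x * indicator (ball 0 (2 * \<rho>)) ?z * G (x + q u w))"
        by (simp only: distrib_left distrib_right mult_ac)
    qed
    also have "\<dots> = (\<integral>\<^sup>+x. \<theta> x * ennreal (bump \<rho> (x $ j - c $ j - V e u w) + bump \<rho> (x $ j - c $ j + V e u w)) * G (x + q u w) \<partial>lborel)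
         + ?K * Q (q u w)"
      unfolding Q_def
      by (subst nn_integral_cmult[symmetric]) (measurable, rule nn_integral_add, measurable)
    finally show "\<Psi> (V (d j) u w) (q u w) + \<Psi> (- V (d j) u w) (q u w) \<le>
        (\<Psi> (V e u w) (q u w) + \<Psi> (- V e u w) (q u w)) + ?K * Q (q u w)"
      unfolding sum .
  qed
  also have "\<dots> = (\<integral>\<^sup>+u. (\<integral>\<^sup>+w. \<Psi> (V e u w) (q u w) + \<Psi> (- V e u w) (q u w) \<partial>kern) + ?K * (\<integral>\<^sup>+w. Q (q u w) \<partial>kern) \<partial>kern)"
    by (intro nn_integral_cong) (subst nn_integral_cmult[symmetric]; measurable?; rule nn_integral_add; measurable)
  also have "\<dots> = 2 * P (d(j := e)) + ?K * (\<integral>\<^sup>+u. (\<integral>\<^sup>+w. Q (q u w) \<partial>kern) \<partial>kern)"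
    unfolding 2
    by (subst nn_integral_cmult[symmetric]; measurable?; rule nn_integral_add; measurable)
  also have "(\<integral>\<^sup>+u. (\<integral>\<^sup>+w. Q (q u w) \<partial>kern) \<partial>kern) =
     (\<integral>\<^sup>+x. \<theta> x * indicator (ball 0 (2 * \<rho>)) (x $ j - c $ j) * kmean (b(j := 0)) (kmean (d(j := 0)) G) x \<partial>lborel)"
  proof -
    have "(\<integral>\<^sup>+x. \<theta> x * indicator (ball 0 (2 * \<rho>)) (x $ j - c $ j) * kmean (b(j := 0)) (kmean (d(j := 0)) G) x \<partial>lborel) =
      (\<integral>\<^sup>+x. (\<integral>\<^sup>+u. (\<integral>\<^sup>+w. \<theta> x * indicator (ball 0 (2 * \<rho>)) (x $ j - c $ j) * G (x + q u w) \<partial>kern) \<partial>kern) \<partial>lborel)"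
      unfolding kmean_kmean by (simp add: nn_integral_cmult q_def add.assoc)
    also have "\<dots> = (\<integral>\<^sup>+u. (\<integral>\<^sup>+x. (\<integral>\<^sup>+w. \<theta> x * indicator (ball 0 (2 * \<rho>)) (x $ j - c $ j) * G (x + q u w) \<partial>kern) \<partial>lborel) \<partial>kern)"
      by (rule kern_tonelli) (unfold_locales, simp, measurable)
    also have "\<dots> = (\<integral>\<^sup>+u. (\<integral>\<^sup>+w. Q (q u w) \<partial>kern) \<partial>kern)"
      unfolding Q_def by (rule nn_integral_cong, rule kern_tonelli) (unfold_locales, simp, measurable)
    finally show ?thesis ..
  qed
  finally show ?thesis .
qed

section \<open>Splitting dyadic sums at a threshold\<close>

text \<open>The selected scales form a tail of the dyadic sequence, so their sum is at most twice
  the largest of them, and that one is below \<open>a / k\<close>.\<close>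

lemma geometric_tail_below:
  fixes a :: ennreal
  assumes s: "0 < s" and k: "0 < k"
  shows "ennreal k * (\<Sum>i. ennreal (s / 2 ^ i) * indicator {i. ennreal (s / 2 ^ i * k) < a} i) \<le> 2 * a"
proof (cases "\<exists>i. ennreal (s / 2 ^ i * k) < a")
  case False
  then show ?thesis by simp
next
  case True
  define m where "m = (LEAST i. ennreal (s / 2 ^ i * k) < a)"
  have m: "ennreal (s / 2 ^ m * k) < a"
    unfolding m_def using True by (rule LeastI_ex)
  have m': "m \<le> i" if "ennreal (s / 2 ^ i * k) < a" for i
    unfolding m_def using that by (rule Least_le)
  have part: "(\<Sum>i<n. if m \<le> i then s / 2 ^ i else 0) = (if n \<le> m then 0 else 2 * s / 2 ^ m - 2 * s / 2 ^ n)" for n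
    by (induction n) (auto simp: not_le not_less_eq_eq le_Suc_eq field_simps)
  have "(\<Sum>i. ennreal (s / 2 ^ i) * indicator {i. ennreal (s / 2 ^ i * k) < a} i) \<le> ennreal (2 * s / 2 ^ m)"
  proof (rule suminf_le_const[OF summableI])
    fix n
    have "(\<Sum>i<n. ennreal (s / 2 ^ i) * indicator {i. ennreal (s / 2 ^ i * k) < a} i)
      \<le> (\<Sum>i<n. ennreal (if m \<le> i then s / 2 ^ i else 0))"
    proof (rule sum_mono)
      fix i
      show "ennreal (s / 2 ^ i) * indicator {i. ennreal (s / 2 ^ i * k) < a} i \<le> ennreal (if m \<le> i then s / 2 ^ i else 0)"
        using m'[of i] by (cases "ennreal (s / 2 ^ i * k) < a") simp_all
    qed
    also have "\<dots> = ennreal (\<Sum>i<n. if m \<le> i then s / 2 ^ i else 0)"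
      using s by (intro sum_ennreal) auto
    also have "\<dots> \<le> ennreal (2 * s / 2 ^ m)"
      unfolding part using s by (intro ennreal_leI) auto
    finally show "(\<Sum>i<n. ennreal (s / 2 ^ i) * indicator {i. ennreal (s / 2 ^ i * k) < a} i) \<le> ennreal (2 * s / 2 ^ m)" .
  qed
  then have "ennreal k * (\<Sum>i. ennreal (s / 2 ^ i) * indicator {i. ennreal (s / 2 ^ i * k) < a} i) \<le> ennreal k * ennreal (2 * s / 2 ^ m)"
    by (rule mult_left_mono) simp
  also have "\<dots> = ennreal (2 * (s / 2 ^ m * k))"
    using s k by (subst ennreal_mult[symmetric]) (simp_all add: mult_ac)
  also have "\<dots> = 2 * ennreal (s / 2 ^ m * k)"
    using s k by (subst ennreal_mult) simp_all
  also have "\<dots> \<le> 2 * a"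
    using m by (intro mult_left_mono) auto
  finally show ?thesis .
qed

lemma geometric_tail_above:
  assumes s: "0 < s" and k: "0 < k" and a: "0 \<le> a"
  shows "(\<Sum>i. ennreal (2 ^ i / s) * indicator {i. a \<le> s / 2 ^ i * k} i * ennreal a) \<le> ennreal (2 * k)"
proof (rule suminf_le_const[OF summableI])
  fix n
  have "(\<Sum>i<n. if a \<le> s / 2 ^ i * k then 2 ^ i / s * a else 0) \<le> 2 * k"
  proof (induction n)
    case (Suc n)
    show ?case
    proof (cases "a \<le> s / 2 ^ n * k")
      case True
      have "(\<Sum>i<Suc n. if a \<le> s / 2 ^ i * k then 2 ^ i / s * a else 0) \<le> (\<Sum>i<Suc n. 2 ^ i * (a / s))"
        by (rule sum_mono) (use s a in auto)
      also have "\<dots> = (2 ^ Suc n - 1) * (a / s)"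
      proof -
        have "(\<Sum>i<Suc n. 2 ^ i :: real) = 2 ^ Suc n - 1" for n
          by (induction n) auto
        then show ?thesis by (simp only: sum_distrib_right[symmetric])
      qed
      also have "\<dots> \<le> 2 ^ Suc n * (a / s)"
        using s a by (intro mult_right_mono) auto
      also have "\<dots> \<le> 2 * k"
        using True s by (simp add: field_simps)
      finally show ?thesis .
    next
      case False
      then show ?thesis using Suc by simp
    qed
  qed (use k in simp)
  then have "ennreal (\<Sum>i<n. if a \<le> s / 2 ^ i * k then 2 ^ i / s * a else 0) \<le> ennreal (2 * k)"
    by (rule ennreal_leI)
  moreover have "(\<Sum>i<n. ennreal (2 ^ i / s) * indicator {i. a \<le> s / 2 ^ i * k} i * ennreal a)
     = (\<Sum>i<n. ennreal (if a \<le> s / 2 ^ i * k then 2 ^ i / s * a else 0))"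
    using s a by (intro sum.cong) (auto simp: indicator_def ennreal_mult[symmetric])
  moreover have "\<dots> = ennreal (\<Sum>i<n. if a \<le> s / 2 ^ i * k then 2 ^ i / s * a else 0)"
    using s a by (intro sum_ennreal) auto
  ultimately show "(\<Sum>i<n. ennreal (2 ^ i / s) * indicator {i. a \<le> s / 2 ^ i * k} i * ennreal a) \<le> ennreal (2 * k)"
    by simp
qed

lemma norm_scl_le:
  assumes "\<And>i. 0 \<le> d i" "\<And>i. d i \<le> \<rho>" "norm w \<le> 1"
  shows "norm (scl d w) \<le> \<rho>"
proof -
  have "0 \<le> \<rho>" using assms(1,2)[of undefined] by linarith
  then have "norm (scl d w) \<le> \<rho> * norm w"
    using assms by (intro norm_vec_le_scale) (auto simp: norm_mult intro: mult_right_mono)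
  also have "\<dots> \<le> \<rho>" using assms \<open>0 \<le> \<rho>\<close> by (simp add: mult_left_le)
  finally show ?thesis .
qed

lemma kmean_mono:
  assumes "\<And>i. 0 \<le> d i" "\<And>i. d i \<le> \<rho>" "\<And>y. y \<in> cball x \<rho> \<Longrightarrow> f y \<le> g y"
  shows "kmean d f x \<le> kmean d g x"
  unfolding kmean_def
  by (intro nn_integral_kern_mono assms(3)) (unfold add_in_cball_iff, rule norm_scl_le[OF assms(1,2)])

lemma kmean_cong:
  assumes "\<And>i. 0 \<le> d i" "\<And>i. d i \<le> \<rho>" "\<And>y. y \<in> cball x \<rho> \<Longrightarrow> f y = g y"
  shows "kmean d f x = kmean d g x"
  using kmean_mono[OF assms(1,2), of x f g] kmean_mono[OF assms(1,2), of x g f] assms(3)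
  by (intro antisym) auto

lemma kmean_add:
  assumes [measurable]: "f \<in> borel_measurable borel" "g \<in> borel_measurable borel"
  shows "kmean d (\<lambda>y. f y + g y) x = kmean d f x + kmean d g x"
  unfolding kmean_def by (rule nn_integral_add) measurable

lemma kmean_cmult:
  assumes [measurable]: "f \<in> borel_measurable borel"
  shows "kmean d (\<lambda>y. c * f y) x = c * kmean d f x"
  unfolding kmean_def by (rule nn_integral_cmult) measurable

lemma kmean_kmean_le:
  assumes G: "separately_superharmonic \<Omega> G" and x: "cball x (\<rho> + \<rho>') \<subseteq> \<Omega>"
    and b: "\<And>i. 0 \<le> b i" "\<And>i. b i \<le> \<rho>" and d: "\<And>i. 0 \<le> d i" "\<And>i. d i \<le> \<rho>'"
  shows "kmean b (kmean d G) x \<le> G x"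
proof -
  have nn: "0 \<le> \<rho>" "0 \<le> \<rho>'" using b[of undefined] d[of undefined] by linarith+
  have "kmean b (kmean d G) x \<le> kmean b G x"
  proof (rule kmean_mono[OF b])
    fix y assume "y \<in> cball x \<rho>"
    then have "cball y \<rho>' \<subseteq> cball x (\<rho> + \<rho>')"
      using nn by (auto simp: cball_subset_cball_iff dist_commute)
    then show "kmean d G y \<le> G y" using x by (intro kmean_le[OF G _ d]) blast
  qed
  also have "\<dots> \<le> G x"
    using x nn by (intro kmean_le[OF G _ b]) (auto simp: subset_iff)
  finally show ?thesis .
qed

lemma kmean_le_cball:
  fixes G :: "complex ^ 'n \<Rightarrow> ennreal"
  assumes [measurable]: "G \<in> borel_measurable borel" and s: "0 < s"
  shows "ennreal (s ^ DIM(complex ^ 'n)) * kmass TYPE(complex ^ 'n) * kmean (\<lambda>_. s) G x \<le> (\<integral>\<^sup>+z\<in>cball x s. G z \<partial>lborel)"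
proof -
  let ?M = "kmass TYPE(complex ^ 'n)"
  have [measurable]: "cball (0::complex ^ 'n) 1 \<in> sets borel" "cball x s \<in> sets borel" by simp_all
  have "?M * kmean (\<lambda>_. s) G x = ?M * (\<integral>\<^sup>+w. kfun w * G (x + s *\<^sub>R w) \<partial>lborel)"
    unfolding kmean_def scl_const by (subst nn_integral_kern) simp_all
  also have "\<dots> = (\<integral>\<^sup>+w. ?M * (kfun w * G (x + s *\<^sub>R w)) \<partial>lborel)"
    by (rule nn_integral_cmult[symmetric]) measurable
  also have "\<dots> \<le> (\<integral>\<^sup>+w. G (x + s *\<^sub>R w) * indicator (cball x s) (x + s *\<^sub>R w) \<partial>lborel)"
  proof (rule nn_integral_mono)
    fix w :: "complex ^ 'n"
    have "?M * kfun w = ennreal (max 0 (1 - norm w))"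
      using kmass_pos[where 'a = "complex ^ 'n"] kmass_finite[where 'a = "complex ^ 'n"]
      unfolding kfun_def by (subst mult.commute) (simp add: ennreal_divide_times ennreal_divide_self less_top)
    also have "\<dots> \<le> indicator (cball x s) (x + s *\<^sub>R w)"
      using s by (auto simp: indicator_def add_in_cball_iff max_def mult_le_cancel_left1 ennreal_le_1 simp del: mem_cball)
    finally have "?M * kfun w \<le> indicator (cball x s) (x + s *\<^sub>R w)" .
    then show "?M * (kfun w * G (x + s *\<^sub>R w)) \<le> G (x + s *\<^sub>R w) * indicator (cball x s) (x + s *\<^sub>R w)"
      unfolding mult.assoc[symmetric] by (subst mult.commute) (rule mult_left_mono, simp_all)
  qed
  finally have "ennreal (s ^ DIM(complex ^ 'n)) * (?M * kmean (\<lambda>_. s) G x) \<le>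
     ennreal (s ^ DIM(complex ^ 'n)) * (\<integral>\<^sup>+w. G (x + s *\<^sub>R w) * indicator (cball x s) (x + s *\<^sub>R w) \<partial>lborel)"
    by (rule mult_left_mono) simp
  also have "\<dots> = (\<integral>\<^sup>+z\<in>cball x s. G z \<partial>lborel)"
    by (rule nn_integral_lborel_scaleR[symmetric, OF _ s, where f = "\<lambda>z. G z * indicator (cball x s) z"]) measurable
  finally show ?thesis by (simp add: mult.assoc)
qed

lemma kmean_finite:
  fixes G :: "complex ^ 'n \<Rightarrow> ennreal"
  assumes "G \<in> borel_measurable borel" "0 < s" "(\<integral>\<^sup>+z\<in>cball x s. G z \<partial>lborel) < \<infinity>"
  shows "kmean (\<lambda>_. s) G x < \<infinity>"
proof (rule ccontr)
  assume "\<not> kmean (\<lambda>_. s) G x < \<infinity>"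
  then have "kmean (\<lambda>_. s) G x = top" by (simp add: not_less top_unique)
  then have "ennreal (s ^ DIM(complex ^ 'n)) * kmass TYPE(complex ^ 'n) * kmean (\<lambda>_. s) G x = top"
    using assms(2) kmass_pos[where 'a = "complex ^ 'n"] by (simp add: ennreal_mult_eq_top_iff)
  then show False using kmean_le_cball[OF assms(1,2), of x] assms(3) by simp
qed

section \<open>Masses on slices in one coordinate\<close>

text \<open>The disc is centred at \<open>c $ j\<close> and not at \<open>x $ j\<close>, which makes
  the mass constant in direction \<open>j\<close>. A cutoff expressed through it is therefore
  admissible as \<open>\<theta>\<close> in \<open>bump_pairing_compare\<close>.\<close>

definition slice_mass :: "complex ^ 'n \<Rightarrow> real \<Rightarrow> 'n \<Rightarrow> (complex ^ 'n \<Rightarrow> ennreal) \<Rightarrow> complex ^ 'n \<Rightarrow> ennreal" where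
  "slice_mass c r j G x = (\<integral>\<^sup>+z\<in>ball (c $ j) r. G (x + axis j (z - x $ j)) \<partial>lborel)"

lemma slice_mass_measurable[measurable]:
  assumes [measurable]: "G \<in> borel_measurable borel"
  shows "slice_mass c r j G \<in> borel_measurable borel"
proof -
  have [measurable]: "ball (c $ j) r \<in> sets borel" by simp
  have "(\<lambda>x. \<integral>\<^sup>+z. G (x + axis j (z - x $ j)) * indicator (ball (c $ j) r) z \<partial>lborel) \<in> borel_measurable borel"
    by measurable
  then show ?thesis by (simp add: slice_mass_def[abs_def])
qed

lemma slice_mass_axis: "slice_mass c r j G (x + axis j v) = slice_mass c r j G x"
proof -
  have "x + axis j v + axis j (z - (x + axis j v) $ j) = x + axis j (z - x $ j)" for z
    by (simp add: vec_eq_iff axis_def)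
  then show ?thesis by (simp only: slice_mass_def)
qed

lemma norm_replace_le:
  fixes x c :: "complex ^ 'n"
  shows "norm (x + axis j (c $ j - x $ j) - c) \<le> norm (x - c)"
  using norm_vec_le_scale[of "x + axis j (c $ j - x $ j) - c" 1 "x - c"] by (simp add: axis_def)

lemma dist_replace_le:
  fixes x c :: "complex ^ 'n"
  shows "dist c (x + axis j (z - x $ j)) \<le> norm (x + axis j (c $ j - x $ j) - c) + dist (c $ j) z"
proof -
  have "x + axis j (z - x $ j) - c = (x + axis j (c $ j - x $ j) - c) + axis j (z - c $ j)"
    by (simp add: vec_eq_iff axis_def)
  then have "norm (x + axis j (z - x $ j) - c) \<le> norm (x + axis j (c $ j - x $ j) - c) + norm (z - c $ j)"
    using norm_triangle_ineq[of "x + axis j (c $ j - x $ j) - c" "axis j (z - c $ j)"] by (simp only: norm_axis)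
  then show ?thesis by (simp add: dist_norm norm_minus_commute)
qed

text \<open>Displacements in coordinate \<open>j\<close> do not change the slice, so after
  exchanging integrals only means of \<open>G\<close> in the other coordinates are left, and these
  lie below \<open>G\<close>.\<close>

lemma kmean_slice_mass_le:
  fixes G :: "complex ^ 'n \<Rightarrow> ennreal"
  assumes G: "separately_superharmonic \<Omega> G" and b: "\<And>i. 0 \<le> b i" "\<And>i. b i \<le> \<rho>"
    and x: "cball c (norm (x - c) + r + \<rho>) \<subseteq> \<Omega>"
  shows "kmean b (slice_mass c r j G) x \<le> slice_mass c r j G x"
proof -
  note [measurable] = separately_superharmonic_measurable[OF G]
  have [measurable]: "ball (c $ j) r \<in> sets borel" by simp
  have eq: "x + scl b w + axis j (z - (x + scl b w) $ j) = x + axis j (z - x $ j) + scl (b(j := 0)) w" for w z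
    by (simp add: vec_eq_iff axis_def)
  have "kmean b (slice_mass c r j G) x =
     (\<integral>\<^sup>+w. (\<integral>\<^sup>+z. G (x + axis j (z - x $ j) + scl (b(j := 0)) w) * indicator (ball (c $ j) r) z \<partial>lborel) \<partial>kern)"
    unfolding kmean_def slice_mass_def eq ..
  also have "\<dots> = (\<integral>\<^sup>+z. (\<integral>\<^sup>+w. G (x + axis j (z - x $ j) + scl (b(j := 0)) w) * indicator (ball (c $ j) r) z \<partial>kern) \<partial>lborel)"
    by (rule kern_tonelli[symmetric]) (unfold_locales, simp, measurable)
  also have "\<dots> = (\<integral>\<^sup>+z. kmean (b(j := 0)) G (x + axis j (z - x $ j)) * indicator (ball (c $ j) r) z \<partial>lborel)"
    by (simp add: kmean_def nn_integral_multc)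
  also have "\<dots> \<le> (\<integral>\<^sup>+z. G (x + axis j (z - x $ j)) * indicator (ball (c $ j) r) z \<partial>lborel)"
  proof (rule nn_integral_mono)
    fix z :: complex
    show "kmean (b(j := 0)) G (x + axis j (z - x $ j)) * indicator (ball (c $ j) r) z \<le> G (x + axis j (z - x $ j)) * indicator (ball (c $ j) r) z"
    proof (cases "z \<in> ball (c $ j) r")
      case True
      have "dist c (x + axis j (z - x $ j)) \<le> norm (x - c) + r"
        using dist_replace_le[of c x j z] norm_replace_le[of x j c] True by simp
      moreover have "0 \<le> \<rho>" using b[of undefined] by linarith
      ultimately have "cball (x + axis j (z - x $ j)) \<rho> \<subseteq> cball c (norm (x - c) + r + \<rho>)"
        by (auto simp: cball_subset_cball_iff dist_commute)
      then have "kmean (b(j := 0)) G (x + axis j (z - x $ j)) \<le> G (x + axis j (z - x $ j))"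
        using x b \<open>0 \<le> \<rho>\<close> by (intro kmean_le[OF G, of _ \<rho>]) auto
      then show ?thesis by (simp add: mult_right_mono)
    qed simp
  qed
  finally show ?thesis by (simp add: slice_mass_def)
qed

lemma ennreal_mult_le_squares: "(a::ennreal) * b \<le> a\<^sup>2 + b\<^sup>2"
proof (cases "a \<le> b")
  case True
  then have "a * b \<le> b * b" by (rule mult_right_mono) simp
  then show ?thesis by (simp add: power2_eq_square add_increasing)
next
  case False
  then have "a * b \<le> a * a" by (intro mult_left_mono) auto
  then show ?thesis by (simp add: power2_eq_square add_increasing2)
qed

text \<open>The left side is a double integral of \<open>G x * G x'\<close> over pairs on a common
  slice; the product is at most the sum of the squares. Membership in \<open>W\<close> splits into a
  condition on the slice and one on \<open>x $ j\<close>, so \<open>lborel_disintegration\<close>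
  interchanges the two points. Each square contributes the area of a disc of radius
  \<open>2 * r\<close>, in total \<open>8 * pi * r\<^sup>2\<close>.\<close>

lemma slice_mass_pairing:
  fixes G :: "complex ^ 'n \<Rightarrow> ennreal" and c :: "complex ^ 'n" and j :: 'n
  assumes [measurable]: "G \<in> borel_measurable borel" and r: "0 < r"
  defines "W \<equiv> {x :: complex ^ 'n. norm (x + axis j (c $ j - x $ j) - c) < r \<and> x $ j \<in> ball (c $ j) (2 * r)}"
  shows "(\<integral>\<^sup>+x\<in>W. G x * slice_mass c (2 * r) j G x \<partial>lborel) \<le> ennreal (8 * pi * r\<^sup>2) * (\<integral>\<^sup>+x\<in>W. (G x)\<^sup>2 \<partial>lborel)"
proof -
  let ?D = "ball (c $ j) (2 * r)"
  let ?P = "{x :: complex ^ 'n. norm (x + axis j (c $ j - x $ j) - c) < r}"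
  have D[measurable]: "?D \<in> sets borel" by simp
  have P[measurable]: "?P \<in> sets borel" by measurable
  have W[measurable]: "W \<in> sets borel" unfolding W_def by measurable
  have aD: "emeasure lborel ?D = ennreal (4 * pi * r\<^sup>2)"
    using r by (subst emeasure_disc) (simp_all add: power_mult_distrib mult_ac)
  have "(\<integral>\<^sup>+x\<in>W. G x * slice_mass c (2 * r) j G x \<partial>lborel) =
    (\<integral>\<^sup>+x. (\<integral>\<^sup>+z. G x * G (x + axis j (z - x $ j)) * indicator ?D z * indicator W x \<partial>lborel) \<partial>lborel)"
    unfolding slice_mass_def
    by (intro nn_integral_cong) (simp add: nn_integral_cmult[symmetric] nn_integral_multc[symmetric] mult.assoc)
  also have "\<dots> \<le> (\<integral>\<^sup>+x. (\<integral>\<^sup>+z. (G x)\<^sup>2 * indicator W x * indicator ?D z + (G (x + axis j (z - x $ j)))\<^sup>2 * indicator ?D z * indicator W x \<partial>lborel) \<partial>lborel)"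
    using ennreal_mult_le_squares by (intro nn_integral_mono) (auto simp: indicator_def)
  also have "\<dots> = (\<integral>\<^sup>+x. (\<integral>\<^sup>+z. (G x)\<^sup>2 * indicator W x * indicator ?D z \<partial>lborel) + (\<integral>\<^sup>+z. (G (x + axis j (z - x $ j)))\<^sup>2 * indicator ?D z * indicator W x \<partial>lborel) \<partial>lborel)"
    by (intro nn_integral_cong nn_integral_add) measurable
  also have "\<dots> = (\<integral>\<^sup>+x. (\<integral>\<^sup>+z. (G x)\<^sup>2 * indicator W x * indicator ?D z \<partial>lborel) \<partial>lborel) + (\<integral>\<^sup>+x. (\<integral>\<^sup>+z. (G (x + axis j (z - x $ j)))\<^sup>2 * indicator ?D z * indicator W x \<partial>lborel) \<partial>lborel)"
    by (intro nn_integral_add) measurable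
  also have "(\<integral>\<^sup>+x. (\<integral>\<^sup>+z. (G x)\<^sup>2 * indicator W x * indicator ?D z \<partial>lborel) \<partial>lborel) = ennreal (4 * pi * r\<^sup>2) * (\<integral>\<^sup>+x\<in>W. (G x)\<^sup>2 \<partial>lborel)"
    by (simp add: nn_integral_cmult_indicator nn_integral_multc aD) (simp add: mult.commute)
  also have "(\<integral>\<^sup>+x. (\<integral>\<^sup>+z. (G (x + axis j (z - x $ j)))\<^sup>2 * indicator ?D z * indicator W x \<partial>lborel) \<partial>lborel) =
     (\<integral>\<^sup>+x. indicator ?D (x $ j) * (\<integral>\<^sup>+v. (G (x + axis j v))\<^sup>2 * indicator W (x + axis j v) \<partial>lborel) \<partial>lborel)"
  proof (rule nn_integral_cong)
    fix x :: "complex ^ 'n"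
    have P: "x + axis j v + axis j (c $ j - (x + axis j v) $ j) = x + axis j (c $ j - x $ j)" for v
      by (simp add: vec_eq_iff axis_def)
    have ind: "indicator W x = (indicator ?D (x $ j) * indicator ?P x :: ennreal)"
       "indicator W (x + axis j v) = (indicator ?D (x $ j + v) * indicator ?P x :: ennreal)" for v
      unfolding W_def indicator_def mem_Collect_eq P by auto
    have "(\<integral>\<^sup>+z. (G (x + axis j (z - x $ j)))\<^sup>2 * indicator ?D z * indicator W x \<partial>lborel) =
       (\<integral>\<^sup>+v. (G (x + axis j (v + x $ j - x $ j)))\<^sup>2 * indicator ?D (v + x $ j) * indicator W x \<partial>lborel)"
      by (rule nn_integral_lborel_shift[symmetric, where f = "\<lambda>z. (G (x + axis j (z - x $ j)))\<^sup>2 * indicator ?D z * indicator W x"]) measurable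
    also have "\<dots> = (\<integral>\<^sup>+v. indicator ?D (x $ j) * ((G (x + axis j v))\<^sup>2 * indicator W (x + axis j v)) \<partial>lborel)"
      unfolding ind by (simp add: mult_ac add.commute)
    also have "\<dots> = indicator ?D (x $ j) * (\<integral>\<^sup>+v. (G (x + axis j v))\<^sup>2 * indicator W (x + axis j v) \<partial>lborel)"
      by (rule nn_integral_cmult) measurable
    finally show "(\<integral>\<^sup>+z. (G (x + axis j (z - x $ j)))\<^sup>2 * indicator ?D z * indicator W x \<partial>lborel) =
       indicator ?D (x $ j) * (\<integral>\<^sup>+v. (G (x + axis j v))\<^sup>2 * indicator W (x + axis j v) \<partial>lborel)" .
  qed
  also have "\<dots> = (\<integral>\<^sup>+z. indicator ?D z \<partial>lborel) * (\<integral>\<^sup>+x. (G x)\<^sup>2 * indicator W x \<partial>lborel)"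
    by (rule lborel_disintegration[where f = "\<lambda>x. (G x)\<^sup>2 * indicator W x" and q = "indicator ?D"])
       (simp_all add: axis_uminus)
  also have "(\<integral>\<^sup>+z. indicator ?D z \<partial>lborel) = ennreal (4 * pi * r\<^sup>2)"
    by (simp add: aD)
  also have "ennreal (4 * pi * r\<^sup>2) * (\<integral>\<^sup>+x\<in>W. (G x)\<^sup>2 \<partial>lborel) + ennreal (4 * pi * r\<^sup>2) * (\<integral>\<^sup>+x\<in>W. (G x)\<^sup>2 \<partial>lborel)
     = ennreal (8 * pi * r\<^sup>2) * (\<integral>\<^sup>+x\<in>W. (G x)\<^sup>2 \<partial>lborel)"
    by (simp flip: distrib_right ennreal_plus)
  finally show ?thesis .
qed

section \<open>Dyadic oscillation in one coordinate\<close>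

text \<open>As \<open>top - top = top\<close> in \<open>ennreal\<close>, the decomposition
  \<open>kdiff_add\<close> holds even where the means are infinite; upper bounds such as
  \<open>kdiff_le\<close> ask for a finite subtrahend.\<close>

definition kdiff :: "('n \<Rightarrow> real) \<Rightarrow> 'n \<Rightarrow> (complex ^ 'n \<Rightarrow> ennreal) \<Rightarrow> complex ^ 'n \<Rightarrow> ennreal" where
  "kdiff d j G x = kmean d G x - kmean (d(j := 2 * d j)) G x"

lemma kdiff_measurable[measurable]:
  assumes [measurable]: "G \<in> borel_measurable borel"
  shows "kdiff d j G \<in> borel_measurable borel"
  unfolding kdiff_def[abs_def] by measurable

lemma kdiff_add:
  assumes "separately_superharmonic \<Omega> G" "cball x \<rho> \<subseteq> \<Omega>"
    "\<And>i. 0 \<le> d i" "\<And>i. d i \<le> \<rho>" "2 * d j \<le> \<rho>"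
  shows "kmean d G x = kmean (d(j := 2 * d j)) G x + kdiff d j G x"
proof -
  have "kmean (d(j := 2 * d j)) G x \<le> kmean d G x"
    using assms by (intro kmean_antimono) auto
  then show ?thesis unfolding kdiff_def by (metis add.commute diff_add_cancel_ennreal)
qed

lemma kdiff_le:
  assumes G: "separately_superharmonic \<Omega> G" and x: "cball x (\<rho> + R) \<subseteq> \<Omega>" and R: "R > 0"
    and d: "\<And>i. 0 \<le> d i" "\<And>i. d i \<le> \<rho>" and s: "2 * d j \<le> R"
    and fin: "kmean (d(j := 2 * d j)) G x < \<infinity>"
  shows "kdiff d j G x \<le> ennreal (4 / (pi * R\<^sup>2)) * (\<integral>\<^sup>+v\<in>ball 0 (R / 2). G (x + axis j v) \<partial>lborel)"
  unfolding kdiff_def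
  using kmean_doubling[where d = d and j = j, OF G x R d s] fin
  by (intro ennreal_minus_le_iff[THEN iffD2]) (auto simp: add.commute)

text \<open>\<open>kdiff_sum\<close> measures the oscillation of \<open>G\<close> in the \<open>j\<close>-th coordinate over all dyadic scales below \<open>\<rho> / 8\<close>.\<close>

definition kdiff_sum :: "real \<Rightarrow> (real \<Rightarrow> 'n \<Rightarrow> real) \<Rightarrow> 'n \<Rightarrow> (complex ^ 'n \<Rightarrow> ennreal) \<Rightarrow> complex ^ 'n \<Rightarrow> ennreal" where
  "kdiff_sum \<rho> dd j G x = (\<Sum>i. ennreal (2 ^ i / (\<rho> / 8)) * kmean (\<lambda>_. 4 * (\<rho> / 8 / 2 ^ i)) (kdiff (dd (\<rho> / 8 / 2 ^ i)) j G) x)"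

lemma kdiff_sum_measurable[measurable]:
  assumes [measurable]: "G \<in> borel_measurable borel"
  shows "kdiff_sum \<rho> dd j G \<in> borel_measurable borel"
  unfolding kdiff_sum_def[abs_def] by measurable

text \<open>The weak type estimate behind the exponent 2. Scales with \<open>s i * k\<close> at
  least \<open>A x\<close> contribute at most \<open>k / 2\<close>, so a bad point has
  \<open>S x\<close> at least \<open>k / 2\<close>, where \<open>S\<close> collects the finer
  scales. In the integral of \<open>S\<close> each scale gains \<open>(s i)\<^sup>2\<close> from the
  cancellation; after the weight \<open>1 / s i\<close>, a geometric sum of size
  \<open>A x / k\<close> remains, to be paired with \<open>G\<close>. The profile \<open>dd\<close>
  allows scales up to \<open>2 * s\<close> in the other coordinates, as the coordinatewise
  telescoping requires.\<close>

lemma kdiff_sum_weak_bound: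
  fixes G :: "complex ^ 'n \<Rightarrow> ennreal" and c :: "complex ^ 'n" and j :: 'n
  assumes G: "separately_superharmonic \<Omega> G" and \<rho>: "0 < \<rho>" and c: "cball c (10 * \<rho>) \<subseteq> \<Omega>"
    and dd: "\<And>s i. 0 < s \<Longrightarrow> s \<le> dd s i" "\<And>s i. 0 < s \<Longrightarrow> dd s i \<le> 2 * s" "\<And>s. dd s j = s"
    and k: "0 < k"
  shows "emeasure lborel {x \<in> ball c (\<rho> / 2). ennreal k < kdiff_sum \<rho> dd j G x} * ennreal (k\<^sup>2) \<le>
    ennreal (995328 / \<rho>\<^sup>2) * (\<integral>\<^sup>+x\<in>cball c (5 * \<rho>). (G x)\<^sup>2 \<partial>lborel)"
proof (cases "(\<integral>\<^sup>+x\<in>cball c (5 * \<rho>). (G x)\<^sup>2 \<partial>lborel) < \<infinity>")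
  case False
  then show ?thesis using \<rho> by (simp add: not_less top_unique ennreal_mult_eq_top_iff)
next
  case L2: True
  note Gm[measurable] = separately_superharmonic_measurable[OF G]
  have [measurable]: "cball c (5 * \<rho>) \<in> sets borel" "ball c (\<rho> / 2) \<in> sets borel" by simp_all
  define s where "s i = \<rho> / 8 / 2 ^ i" for i :: nat
  have s0: "0 < s i" for i using \<rho> by (simp add: s_def)
  have s1: "s i \<le> \<rho> / 8" for i using \<rho> by (simp add: s_def field_simps)
  define D where "D i = kdiff (dd (s i)) j G" for i
  define N where "N = slice_mass c (2 * \<rho>) j G"
  have [measurable]: "D i \<in> borel_measurable borel" "N \<in> borel_measurable borel" for i
    unfolding D_def N_def by measurable
  \<comment> \<open>\<open>P\<close> is a cylinder in direction \<open>j\<close>, and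
    \<open>W\<close> a bounded piece of it that still contains, inside \<open>P\<close>, the support
    of the bump and of the second order error.\<close>
  define P where "P = {x :: complex ^ 'n. norm (x + axis j (c $ j - x $ j) - c) < \<rho>}"
  define W where "W = {x :: complex ^ 'n. norm (x + axis j (c $ j - x $ j) - c) < \<rho> \<and> x $ j \<in> ball (c $ j) (2 * \<rho>)}"
  have [measurable]: "ball (c $ j) (2 * \<rho>) \<in> sets borel" "ball (0::complex) (2 * \<rho>) \<in> sets borel" "ball (0::complex) (\<rho> / 2) \<in> sets borel" by simp_all
  have [measurable]: "P \<in> sets borel" "W \<in> sets borel" unfolding P_def W_def by measurable
  have W5: "W \<subseteq> cball c (3 * \<rho>)"
  proof
    fix x assume "x \<in> W"
    then show "x \<in> cball c (3 * \<rho>)"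
      using dist_replace_le[of c x j "x $ j"] by (simp add: W_def)
  qed
  have L1: "(\<integral>\<^sup>+x\<in>cball c (5 * \<rho>). G x \<partial>lborel) < \<infinity>"
  proof -
    have "(\<integral>\<^sup>+x\<in>cball c (5 * \<rho>). G x \<partial>lborel) \<le> (\<integral>\<^sup>+x. indicator (cball c (5 * \<rho>)) x + (G x)\<^sup>2 * indicator (cball c (5 * \<rho>)) x \<partial>lborel)"
    proof (rule nn_integral_mono)
      fix x
      show "G x * indicator (cball c (5 * \<rho>)) x \<le> indicator (cball c (5 * \<rho>)) x + (G x)\<^sup>2 * indicator (cball c (5 * \<rho>)) x"
        using ennreal_mult_le_squares[of 1 "G x"] by (auto simp: indicator_def)
    qed
    also have "\<dots> = emeasure lborel (cball c (5 * \<rho>)) + (\<integral>\<^sup>+x\<in>cball c (5 * \<rho>). (G x)\<^sup>2 \<partial>lborel)"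
      by (subst nn_integral_add) simp_all
    also have "\<dots> < \<infinity>"
      using L2 emeasure_lborel_cball_finite[of c "5 * \<rho>"] by simp
    finally show ?thesis .
  qed
  have sub: "cball y r \<subseteq> \<Omega>" if "dist c y + r \<le> 10 * \<rho>" for y r
  proof -
    have "cball y r \<subseteq> cball c (10 * \<rho>)" using that by (auto simp: cball_subset_cball_iff dist_commute)
    then show ?thesis using c by blast
  qed
  have L1': "(\<integral>\<^sup>+x\<in>A. G x \<partial>lborel) < \<infinity>" if "A \<subseteq> cball c (5 * \<rho>)" for A
  proof -
    have "(\<integral>\<^sup>+x\<in>A. G x \<partial>lborel) \<le> (\<integral>\<^sup>+x\<in>cball c (5 * \<rho>). G x \<partial>lborel)"
      using that by (intro nn_integral_mono) (auto simp: indicator_def)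
    then show ?thesis using L1 by (rule le_less_trans)
  qed
  have dd0: "0 \<le> dd (s i) l" "dd (s i) l \<le> 2 * s i" "((dd (s i))(j := e)) l \<le> max e (2 * s i)" for i l e
    using dd(1)[OF s0, of i l] dd(2)[OF s0, of i l] s0[of i] by (auto simp: max_def)
  have dd\<rho>: "dd (s i) l \<le> \<rho>" for i l
    using dd0(2)[of i l] s1[of i] \<rho> by linarith
  \<comment> \<open>All scales are at least \<open>s i\<close>, so this mean is dominated by the
    uniform one at scale \<open>s i\<close>, which a ball integral controls. Finiteness is what
    \<open>kdiff_le\<close> asks for.\<close>
  have fin: "kmean ((dd (s i))(j := 2 * s i)) G y < \<infinity>" if "y \<in> cball c (2 * \<rho>)" for i y
  proof -
    have "kmean ((dd (s i))(j := 2 * s i)) G y \<le> kmean (\<lambda>_. s i) G y"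
    proof (rule kmean_antimono[OF G, of _ \<rho>])
      show "cball y \<rho> \<subseteq> \<Omega>" using that \<rho> by (intro sub) simp
    qed (use s0[of i] s1[of i] \<rho> dd(1)[OF s0, of i] dd\<rho>[of i] in auto)
    also have "\<dots> < \<infinity>"
    proof (rule kmean_finite[OF Gm s0 L1'])
      show "cball y (s i) \<subseteq> cball c (5 * \<rho>)"
        using that \<rho> s1[of i] by (auto simp: cball_subset_cball_iff dist_commute)
    qed
    finally show ?thesis .
  qed
  let ?Ca = "4 / (pi * \<rho>\<^sup>2)"
  have Ca: "0 < ?Ca" using \<rho> by simp
  \<comment> \<open>The doubling estimate with \<open>R = \<rho>\<close>: its disc of radius
    \<open>\<rho> / 2\<close> about \<open>y $ j\<close> lies in the fixed disc of radius
    \<open>2 * \<rho>\<close> about \<open>c $ j\<close>.\<close>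
  have DN: "D i y \<le> ennreal ?Ca * N y" if y: "y \<in> cball c \<rho>" for i y
  proof -
    have "D i y \<le> ennreal ?Ca * (\<integral>\<^sup>+v\<in>ball 0 (\<rho> / 2). G (y + axis j v) \<partial>lborel)"
      unfolding D_def
    proof (rule kdiff_le[OF G, of _ "2 * s i"])
      show "cball y (2 * s i + \<rho>) \<subseteq> \<Omega>" using y s1[of i] \<rho> by (intro sub) simp
      show "kmean ((dd (s i))(j := 2 * dd (s i) j)) G y < \<infinity>"
        using y \<rho> fin[of y i] by (simp add: dd(3))
    qed (use \<rho> dd0 s1[of i] s0[of i] in \<open>auto simp: dd(3)\<close>)
    also have "(\<integral>\<^sup>+v\<in>ball 0 (\<rho> / 2). G (y + axis j v) \<partial>lborel) =
        (\<integral>\<^sup>+z. G (y + axis j (z + (- y $ j))) * indicator (ball 0 (\<rho> / 2)) (z + (- y $ j)) \<partial>lborel)"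
      by (rule nn_integral_lborel_shift[symmetric, where f = "\<lambda>v. G (y + axis j v) * indicator (ball 0 (\<rho> / 2)) v"]) measurable
    also have "\<dots> \<le> N y"
      unfolding N_def slice_mass_def
    proof (rule nn_integral_mono)
      fix z
      have "dist (c $ j) (y $ j) \<le> \<rho>"
        using y dist_vec_nth_le[of c j y] by simp
      then have "z \<in> ball (c $ j) (2 * \<rho>)" if "dist 0 (z - y $ j) < \<rho> / 2"
        using that \<rho> dist_triangle[of "c $ j" z "y $ j"] by (simp add: dist_norm norm_minus_commute)
      then show "G (y + axis j (z + (- y $ j))) * indicator (ball 0 (\<rho> / 2)) (z + (- y $ j))
          \<le> G (y + axis j (z - y $ j)) * indicator (ball (c $ j) (2 * \<rho>)) z"
        by (auto simp: indicator_def)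
    qed
    finally show ?thesis using Ca by (simp add: mult_left_mono)
  qed
  define KD where "KD i x = kmean (\<lambda>_. 4 * s i) (D i) x" for i x
  have [measurable]: "KD i \<in> borel_measurable borel" for i unfolding KD_def[abs_def] by measurable
  \<comment> \<open>The outer scale \<open>4 * s i\<close> is at most \<open>\<rho> / 2\<close>, so
    the outer mean only sees points where \<open>DN\<close> holds.\<close>
  have KD_N: "KD i x \<le> ennreal ?Ca * N x" if x: "x \<in> ball c (\<rho> / 2)" for i x
  proof -
    have "KD i x \<le> kmean (\<lambda>_. 4 * s i) (\<lambda>y. ennreal ?Ca * N y) x"
      unfolding KD_def
    proof (rule kmean_mono)
      fix y assume "y \<in> cball x (\<rho> / 2)"
      then have "y \<in> cball c \<rho>" using x dist_triangle[of c y x] by (simp add: dist_commute)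
      then show "D i y \<le> ennreal ?Ca * N y" by (rule DN)
    qed (use s0[of i] s1[of i] in auto)
    also have "\<dots> = ennreal ?Ca * kmean (\<lambda>_. 4 * s i) N x"
      by (rule kmean_cmult) measurable
    also have "kmean (\<lambda>_. 4 * s i) N x \<le> N x"
      unfolding N_def
    proof (rule kmean_slice_mass_le[OF G, of _ \<rho>])
      show "cball c (norm (x - c) + 2 * \<rho> + \<rho>) \<subseteq> \<Omega>"
        using x \<rho> by (intro sub) (simp add: dist_norm norm_minus_commute)
    qed (use s0[of i] s1[of i] \<rho> in auto)
    finally show ?thesis by (simp add: mult_left_mono)
  qed
  \<comment> \<open>Four times the pointwise bound: \<open>geometric_tail_above\<close> allows
    \<open>2 * k\<close> for terms built from \<open>A\<close>, hence \<open>k / 2\<close> for the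
    actual ones.\<close>
  define A where "A x = 4 * (ennreal ?Ca * N x)" for x
  have [measurable]: "A \<in> borel_measurable borel" unfolding A_def[abs_def] by measurable
  \<comment> \<open>Keeps scale \<open>i\<close> only on slices where it lies below the threshold
    \<open>A x / k\<close>. Both factors are constant in direction \<open>j\<close>, so the cutoff
    does not spoil the cancellation.\<close>
  define \<theta> where "\<theta> i x = (indicator P x * indicator {x. ennreal (s i * k) < A x} x :: ennreal)" for i and x :: "complex ^ 'n"
  have [measurable]: "\<theta> i \<in> borel_measurable borel" for i unfolding \<theta>_def[abs_def] by measurable
  have \<theta>j: "\<theta> i (x + axis j v) = \<theta> i x" for i x v
  proof -
    have "x + axis j v + axis j (c $ j - (x + axis j v) $ j) = x + axis j (c $ j - x $ j)"
      by (simp add: vec_eq_iff axis_def)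
    then have "x + axis j v \<in> P \<longleftrightarrow> x \<in> P" unfolding P_def mem_Collect_eq by (simp only:)
    moreover have "A (x + axis j v) = A x" by (simp add: A_def N_def slice_mass_axis)
    ultimately show ?thesis by (simp add: \<theta>_def indicator_def)
  qed
  let ?X = "\<lambda>x. ennreal (bump \<rho> (x $ j - c $ j))"
  \<comment> \<open>\<open>bump_pairing_compare\<close> with \<open>m = 6 * s i\<close>, the outer
    scale \<open>4 * s i\<close> plus the larger inner scale \<open>2 * s i\<close>; 1944 is
    \<open>54 * 6\<^sup>2\<close>.\<close>
  have key: "2 * (\<integral>\<^sup>+x. \<theta> i x * ?X x * KD i x \<partial>lborel) \<le> ennreal (1944 * (s i / \<rho>)\<^sup>2) * (\<integral>\<^sup>+x. \<theta> i x * indicator W x * G x \<partial>lborel)" for i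
  proof -
    let ?b = "\<lambda>_::'n. 4 * s i" and ?d = "dd (s i)" and ?d' = "(dd (s i))(j := 2 * s i)"
    define PP where "PP d = (\<integral>\<^sup>+x. \<theta> i x * ?X x * kmean ?b (kmean d G) x \<partial>lborel)" for d
    have in3: "x \<in> cball c (3 * \<rho>) \<and> x \<in> W" if "\<theta> i x * indicator (ball 0 (2 * \<rho>)) (x $ j - c $ j) \<noteq> (0::ennreal)" for x
    proof -
      have "x \<in> P" using that by (auto simp: \<theta>_def indicator_def split: if_splits)
      moreover have "x $ j - c $ j \<in> ball 0 (2 * \<rho>)" using that by (auto simp: indicator_def split: if_splits)
      ultimately have "x \<in> W" by (simp add: W_def P_def dist_norm norm_minus_commute)
      then show ?thesis using W5 by auto
    qed
    have Xind: "?X x \<le> indicator (ball 0 (2 * \<rho>)) (x $ j - c $ j)" for x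
    proof (cases "x $ j - c $ j \<in> ball 0 (2 * \<rho>)")
      case True
      then show ?thesis by (simp add: bump_le_1 ennreal_le_1)
    next
      case False
      then show ?thesis using \<rho> by (simp add: bump_eq_0)
    qed
    have indW: "\<theta> i x * indicator (ball 0 (2 * \<rho>)) (x $ j - c $ j) \<le> \<theta> i x * indicator W x" for x
      using in3[of x] by (cases "\<theta> i x * indicator (ball 0 (2 * \<rho>)) (x $ j - c $ j) = (0::ennreal)") (auto simp: indicator_def split: if_splits)
    have PPle: "\<theta> i x * indicator (ball 0 (2 * \<rho>)) (x $ j - c $ j) * kmean b (kmean d G) x \<le> \<theta> i x * indicator W x * G x"
      if "\<And>l. 0 \<le> b l" "\<And>l. b l \<le> 4 * s i" "\<And>l. 0 \<le> d l" "\<And>l. d l \<le> 2 * s i" for b d x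
    proof (cases "\<theta> i x * indicator (ball 0 (2 * \<rho>)) (x $ j - c $ j) = (0::ennreal)")
      case True
      then show ?thesis by auto
    next
      case False
      then have "dist c x \<le> 3 * \<rho>" using in3[of x] by auto
      then have "kmean b (kmean d G) x \<le> G x"
        using s1[of i] \<rho> by (intro kmean_kmean_le[OF G _ that] sub) simp
      then show ?thesis by (intro mult_mono indW) auto
    qed
    \<comment> \<open>The pairing at the doubled scale must be finite, because it occurs on both
      sides of the comparison and is cancelled.\<close>
    have "PP ?d' \<le> (\<integral>\<^sup>+x. \<theta> i x * indicator W x * G x \<partial>lborel)"
      unfolding PP_def
    proof (rule nn_integral_mono)
      fix x
      have "\<theta> i x * ?X x * kmean ?b (kmean ?d' G) x \<le> \<theta> i x * indicator (ball 0 (2 * \<rho>)) (x $ j - c $ j) * kmean ?b (kmean ?d' G) x"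
        by (intro mult_mono Xind) auto
      also have "\<dots> \<le> \<theta> i x * indicator W x * G x"
        by (rule PPle) (use s0[of i] dd0[of i] in auto)
      finally show "\<theta> i x * ?X x * kmean ?b (kmean ?d' G) x \<le> \<theta> i x * indicator W x * G x" .
    qed
    also have "\<dots> \<le> (\<integral>\<^sup>+x\<in>W. G x \<partial>lborel)"
      by (rule nn_integral_mono) (auto simp: \<theta>_def indicator_def)
    also have "\<dots> < \<infinity>" using W5 \<rho> by (intro L1') (auto simp: subset_iff)
    finally have PPfin: "PP ?d' < \<infinity>" .
    have "2 * PP ?d \<le> 2 * PP ?d' + ennreal (54 * ((6 * s i) / \<rho>)\<^sup>2) *
       (\<integral>\<^sup>+x. \<theta> i x * indicator (ball 0 (2 * \<rho>)) (x $ j - c $ j) * kmean (?b(j := 0)) (kmean (?d(j := 0)) G) x \<partial>lborel)"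
      unfolding PP_def
      by (rule bump_pairing_compare[OF Gm _ \<theta>j \<rho>]) (use s0[of i] s1[of i] dd(3) in auto)
    also have "\<dots> \<le> 2 * PP ?d' + ennreal (54 * ((6 * s i) / \<rho>)\<^sup>2) * (\<integral>\<^sup>+x. \<theta> i x * indicator W x * G x \<partial>lborel)"
      by (intro add_left_mono mult_left_mono nn_integral_mono PPle) (use s0[of i] dd0[of i] in auto)
    finally have 1: "2 * PP ?d \<le> 2 * PP ?d' + ennreal (54 * ((6 * s i) / \<rho>)\<^sup>2) * (\<integral>\<^sup>+x. \<theta> i x * indicator W x * G x \<partial>lborel)" .
    have "PP ?d = (\<integral>\<^sup>+x. \<theta> i x * ?X x * kmean ?b (kmean ?d' G) x + \<theta> i x * ?X x * KD i x \<partial>lborel)"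
      unfolding PP_def
    proof (rule nn_integral_cong)
      fix x
      show "\<theta> i x * ?X x * kmean ?b (kmean ?d G) x = \<theta> i x * ?X x * kmean ?b (kmean ?d' G) x + \<theta> i x * ?X x * KD i x"
      proof (cases "\<theta> i x * ?X x = 0")
        case True
        then show ?thesis by auto
      next
        case False
        have "indicator (ball 0 (2 * \<rho>)) (x $ j - c $ j) \<noteq> (0::ennreal)"
        proof
          assume "indicator (ball 0 (2 * \<rho>)) (x $ j - c $ j) = (0::ennreal)"
          then have "?X x \<le> 0" using Xind[of x] by (simp only:)
          then show False using False by simp
        qed
        then have "\<theta> i x * indicator (ball 0 (2 * \<rho>)) (x $ j - c $ j) \<noteq> (0::ennreal)"
          using False by simp
        then have x: "dist c x \<le> 3 * \<rho>" using in3[of x] by auto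
        have "kmean ?b (kmean ?d G) x = kmean ?b (\<lambda>y. kmean ?d' G y + D i y) x"
        proof (rule kmean_cong[of _ "4 * s i"])
          fix y assume "y \<in> cball x (4 * s i)"
          then have "dist c y \<le> 4 * \<rho>" using x s1[of i] dist_triangle[of c y x] \<rho> by simp
          then have "cball y (2 * s i) \<subseteq> \<Omega>" using s1[of i] \<rho> by (intro sub) simp
          from kdiff_add[where d = ?d and j = j, OF G this dd0(1,2)]
          show "kmean ?d G y = kmean ?d' G y + D i y" by (simp add: D_def dd(3))
        qed (use s0[of i] in auto)
        also have "\<dots> = kmean ?b (kmean ?d' G) x + KD i x"
          unfolding KD_def by (rule kmean_add) measurable
        finally show ?thesis by (simp add: distrib_left)
      qed
    qed
    also have "\<dots> = PP ?d' + (\<integral>\<^sup>+x. \<theta> i x * ?X x * KD i x \<partial>lborel)"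
      unfolding PP_def by (rule nn_integral_add) measurable
    finally have "2 * PP ?d' + 2 * (\<integral>\<^sup>+x. \<theta> i x * ?X x * KD i x \<partial>lborel) \<le>
        2 * PP ?d' + ennreal (54 * ((6 * s i) / \<rho>)\<^sup>2) * (\<integral>\<^sup>+x. \<theta> i x * indicator W x * G x \<partial>lborel)"
      using 1 by (simp add: distrib_left)
    moreover have "2 * PP ?d' \<noteq> top" using PPfin by (simp add: ennreal_mult_eq_top_iff)
    ultimately have "2 * (\<integral>\<^sup>+x. \<theta> i x * ?X x * KD i x \<partial>lborel) \<le>
         ennreal (54 * ((6 * s i) / \<rho>)\<^sup>2) * (\<integral>\<^sup>+x. \<theta> i x * indicator W x * G x \<partial>lborel)"
      by (simp add: ennreal_add_left_cancel_le)
    also have "54 * ((6 * s i) / \<rho>)\<^sup>2 = 1944 * (s i / \<rho>)\<^sup>2" by (simp add: power_mult_distrib power_divide)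
    finally show ?thesis .
  qed
  define S where "S x = (\<Sum>i. ennreal (1 / s i) * (\<theta> i x * KD i x))" for x
  have [measurable]: "S \<in> borel_measurable borel" unfolding S_def[abs_def] by measurable
  \<comment> \<open>Weight \<open>1 / s i\<close> times gain \<open>(s i)\<^sup>2\<close> leaves
    \<open>s i\<close>; by \<open>geometric_tail_below\<close>, \<open>k\<close> times the sum of
    \<open>s i * \<theta> i x\<close> is at most \<open>2 * A x\<close>, which is
    \<open>8 * ?Ca * N x\<close>.\<close>
  have S_int: "2 * (\<integral>\<^sup>+x. ?X x * S x \<partial>lborel) * ennreal k \<le> ennreal (1944 * 8 * ?Ca / \<rho>\<^sup>2) * (\<integral>\<^sup>+x\<in>W. G x * N x \<partial>lborel)"
  proof -
    have "2 * (\<integral>\<^sup>+x. ?X x * S x \<partial>lborel) = (\<integral>\<^sup>+x. (\<Sum>i. ennreal (1 / s i) * (2 * (\<theta> i x * ?X x * KD i x))) \<partial>lborel)"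
    proof -
      have "2 * (?X x * S x) = (\<Sum>i. ennreal (1 / s i) * (2 * (\<theta> i x * ?X x * KD i x)))" for x
        unfolding S_def mult.assoc[symmetric, of 2 "?X x"]
        by (subst ennreal_suminf_cmult[symmetric], intro suminf_cong) (simp add: mult_ac)
      then show ?thesis by (subst nn_integral_cmult[symmetric]) simp_all
    qed
    also have "\<dots> = (\<Sum>i. \<integral>\<^sup>+x. ennreal (1 / s i) * (2 * (\<theta> i x * ?X x * KD i x)) \<partial>lborel)"
      by (rule nn_integral_suminf) measurable
    also have "\<dots> = (\<Sum>i. ennreal (1 / s i) * (2 * (\<integral>\<^sup>+x. \<theta> i x * ?X x * KD i x \<partial>lborel)))"
      by (simp add: nn_integral_cmult)
    also have "\<dots> \<le> (\<Sum>i. ennreal (1944 / \<rho>\<^sup>2) * (ennreal (s i) * (\<integral>\<^sup>+x. \<theta> i x * indicator W x * G x \<partial>lborel)))"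
    proof (rule suminf_le)
      fix i
      have "ennreal (1 / s i) * (2 * (\<integral>\<^sup>+x. \<theta> i x * ?X x * KD i x \<partial>lborel)) \<le>
         ennreal (1 / s i) * (ennreal (1944 * (s i / \<rho>)\<^sup>2) * (\<integral>\<^sup>+x. \<theta> i x * indicator W x * G x \<partial>lborel))"
        by (intro mult_left_mono key) simp
      also have "\<dots> = ennreal (1944 / \<rho>\<^sup>2 * s i) * (\<integral>\<^sup>+x. \<theta> i x * indicator W x * G x \<partial>lborel)"
        using s0[of i] unfolding mult.assoc[symmetric]
        by (subst ennreal_mult[symmetric]) (simp_all add: power_divide power2_eq_square)
      also have "\<dots> = ennreal (1944 / \<rho>\<^sup>2) * (ennreal (s i) * (\<integral>\<^sup>+x. \<theta> i x * indicator W x * G x \<partial>lborel))"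
        using s0[of i] by (subst ennreal_mult) (simp_all add: mult.assoc)
      finally show "ennreal (1 / s i) * (2 * (\<integral>\<^sup>+x. \<theta> i x * ?X x * KD i x \<partial>lborel)) \<le>
        ennreal (1944 / \<rho>\<^sup>2) * (ennreal (s i) * (\<integral>\<^sup>+x. \<theta> i x * indicator W x * G x \<partial>lborel))" .
    qed simp_all
    also have "\<dots> = ennreal (1944 / \<rho>\<^sup>2) * (\<integral>\<^sup>+x. G x * indicator W x * (\<Sum>i. ennreal (s i) * \<theta> i x) \<partial>lborel)"
    proof -
      have "(\<integral>\<^sup>+x. G x * indicator W x * (\<Sum>i. ennreal (s i) * \<theta> i x) \<partial>lborel) =
        (\<integral>\<^sup>+x. (\<Sum>i. ennreal (s i) * (\<theta> i x * indicator W x * G x)) \<partial>lborel)"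
        by (intro nn_integral_cong) (subst ennreal_suminf_cmult[symmetric], intro suminf_cong, simp add: mult_ac)
      also have "\<dots> = (\<Sum>i. \<integral>\<^sup>+x. ennreal (s i) * (\<theta> i x * indicator W x * G x) \<partial>lborel)"
        by (rule nn_integral_suminf) measurable
      finally show ?thesis by (simp add: nn_integral_cmult ennreal_suminf_cmult)
    qed
    finally have "2 * (\<integral>\<^sup>+x. ?X x * S x \<partial>lborel) * ennreal k \<le>
      ennreal (1944 / \<rho>\<^sup>2) * (\<integral>\<^sup>+x. G x * indicator W x * (\<Sum>i. ennreal (s i) * \<theta> i x) \<partial>lborel) * ennreal k"
      by (rule mult_right_mono) simp
    also have "\<dots> = ennreal (1944 / \<rho>\<^sup>2) * (\<integral>\<^sup>+x. G x * indicator W x * (ennreal k * (\<Sum>i. ennreal (s i) * \<theta> i x)) \<partial>lborel)"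
      unfolding mult.assoc by (subst nn_integral_multc[symmetric]) (measurable, simp add: mult_ac)
    also have "\<dots> \<le> ennreal (1944 / \<rho>\<^sup>2) * (\<integral>\<^sup>+x. G x * indicator W x * (ennreal (8 * ?Ca) * N x) \<partial>lborel)"
    proof (intro mult_left_mono nn_integral_mono)
      fix x
      have "ennreal k * (\<Sum>i. ennreal (s i) * \<theta> i x) \<le> ennreal k * (\<Sum>i. ennreal (\<rho> / 8 / 2 ^ i) * indicator {i. ennreal (\<rho> / 8 / 2 ^ i * k) < A x} i)"
        by (intro mult_left_mono suminf_le) (auto simp: \<theta>_def s_def indicator_def)
      also have "\<dots> \<le> 2 * A x" by (rule geometric_tail_below) (use \<rho> k in auto)
      also have "\<dots> = ennreal (8 * ?Ca) * N x"
        using Ca by (subst ennreal_mult) (simp_all add: A_def mult.assoc[symmetric])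
      finally show "ennreal k * (\<Sum>i. ennreal (s i) * \<theta> i x) \<le> ennreal (8 * ?Ca) * N x" .
    qed simp_all
    also have "\<dots> = ennreal (1944 / \<rho>\<^sup>2) * (ennreal (8 * ?Ca) * (\<integral>\<^sup>+x\<in>W. G x * N x \<partial>lborel))"
      by (subst nn_integral_cmult[symmetric]) (measurable, simp add: mult_ac)
    also have "\<dots> = ennreal (1944 * 8 * ?Ca / \<rho>\<^sup>2) * (\<integral>\<^sup>+x\<in>W. G x * N x \<partial>lborel)"
      using Ca unfolding mult.assoc[symmetric] by (subst ennreal_mult[symmetric]) (simp_all add: mult_ac)
    finally show ?thesis .
  qed
  let ?Bad = "{x \<in> ball c (\<rho> / 2). ennreal k < kdiff_sum \<rho> dd j G x}"
  have Bad[measurable]: "?Bad \<in> sets borel" by measurable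
  \<comment> \<open>The coarse scales use the pointwise bound \<open>KD_N\<close> and stay within
    \<open>k / 2\<close>; the remainder of the sum, beyond \<open>k / 2\<close>, must come from
    \<open>S\<close>.\<close>
  have bad: "ennreal (k / 2) \<le> S x" if x: "x \<in> ?Bad" for x
  proof -
    have xb: "x \<in> ball c (\<rho> / 2)" using x by simp
    have xP: "x \<in> P"
      using xb norm_replace_le[of x j c] \<rho> by (simp add: P_def dist_norm norm_minus_commute)
    have inv: "ennreal (2 ^ i / (\<rho> / 8)) = ennreal (1 / s i)" for i by (simp add: s_def mult.commute)
    have "kdiff_sum \<rho> dd j G x = (\<Sum>i. ennreal (1 / s i) * KD i x)"
      unfolding kdiff_sum_def inv KD_def D_def s_def ..
    also have "\<dots> \<le> (\<Sum>i. ennreal (1 / s i) * (\<theta> i x * KD i x) + ennreal (1 / s i) * indicator {i. A x \<le> ennreal (s i * k)} i * (ennreal ?Ca * N x))"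
    proof (rule suminf_le)
      fix i
      show "ennreal (1 / s i) * KD i x \<le> ennreal (1 / s i) * (\<theta> i x * KD i x) + ennreal (1 / s i) * indicator {i. A x \<le> ennreal (s i * k)} i * (ennreal ?Ca * N x)"
      proof (cases "A x \<le> ennreal (s i * k)")
        case True
        then show ?thesis using KD_N[OF xb, of i] by (simp add: mult_left_mono add_increasing)
      next
        case False
        then show ?thesis using xP by (simp add: \<theta>_def)
      qed
    qed simp_all
    also have "\<dots> = S x + (\<Sum>i. ennreal (1 / s i) * indicator {i. A x \<le> ennreal (s i * k)} i * (ennreal ?Ca * N x))"
      unfolding S_def by (rule suminf_add[symmetric]) simp_all
    also have "(\<Sum>i. ennreal (1 / s i) * indicator {i. A x \<le> ennreal (s i * k)} i * (ennreal ?Ca * N x)) \<le> ennreal (k / 2)"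
    proof (cases "A x")
      case (real a)
      have "ennreal ?Ca * N x = ennreal (a / 4)"
      proof -
        have "4 * (ennreal ?Ca * N x) = 4 * ennreal (a / 4)"
          using real by (simp add: A_def ennreal_mult[symmetric, of 4, simplified])
        then show ?thesis by (simp add: ennreal_mult_cancel_left)
      qed
      then have "(\<Sum>i. ennreal (1 / s i) * indicator {i. A x \<le> ennreal (s i * k)} i * (ennreal ?Ca * N x)) =
         (\<Sum>i. ennreal (1 / 4) * (ennreal (2 ^ i / (\<rho> / 8)) * indicator {i. a \<le> \<rho> / 8 / 2 ^ i * k} i * ennreal a))"
        using real \<rho> k
        by (intro suminf_cong) (auto simp: indicator_def s_def ennreal_mult[symmetric] mult_ac)
      also have "\<dots> = ennreal (1 / 4) * (\<Sum>i. ennreal (2 ^ i / (\<rho> / 8)) * indicator {i. a \<le> \<rho> / 8 / 2 ^ i * k} i * ennreal a)"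
        by (rule ennreal_suminf_cmult)
      also have "\<dots> \<le> ennreal (1 / 4) * ennreal (2 * k)"
        using real \<rho> k by (intro mult_left_mono geometric_tail_above) auto
      also have "\<dots> = ennreal (k / 2)"
        using k by (simp add: ennreal_mult[symmetric])
      finally show ?thesis .
    qed (simp add: top_unique)
    finally have "ennreal k < S x + ennreal (k / 2)"
      using x by (auto intro: less_le_trans add_left_mono)
    then have "ennreal (k / 2) + ennreal (k / 2) < S x + ennreal (k / 2)"
      using k by (simp flip: ennreal_plus)
    then show ?thesis
      by (meson add_right_mono leD nle_le)
  qed
  \<comment> \<open>Markov's inequality for \<open>S\<close> weighted with the bump, which is at
    least 1/2 on \<open>ball c (\<rho> / 2)\<close>.\<close>
  have "emeasure lborel ?Bad * ennreal (k\<^sup>2) = 2 * ennreal k * ((\<integral>\<^sup>+x. indicator ?Bad x \<partial>lborel) * ennreal (k / 2))"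
  proof -
    have "ennreal (k\<^sup>2) = ennreal (2 * k) * ennreal (k / 2)"
      using k by (subst ennreal_mult[symmetric]) (simp_all add: power2_eq_square)
    also have "ennreal (2 * k) = 2 * ennreal k"
      using k by (subst ennreal_mult) simp_all
    finally show ?thesis by (simp only: nn_integral_indicator[OF Bad[folded sets_lborel]] mult_ac)
  qed
  also have "\<dots> = 2 * ennreal k * (\<integral>\<^sup>+x. indicator ?Bad x * ennreal (k / 2) \<partial>lborel)"
    by (subst nn_integral_multc) simp_all
  also have "\<dots> \<le> 2 * ennreal k * (\<integral>\<^sup>+x. 2 * (?X x * S x) \<partial>lborel)"
  proof (intro mult_left_mono nn_integral_mono)
    fix x
    show "indicator ?Bad x * ennreal (k / 2) \<le> 2 * (?X x * S x)"
    proof (cases "x \<in> ?Bad")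
      case True
      then have "dist (c $ j) (x $ j) \<le> \<rho> / 2"
        using dist_vec_nth_le[of c j x] by simp
      then have "1 / 2 \<le> bump \<rho> (x $ j - c $ j)"
        using \<rho> by (intro bump_ge_half) (simp_all add: dist_norm norm_minus_commute)
      then have "1 \<le> 2 * bump \<rho> (x $ j - c $ j)" by simp
      then have "1 \<le> ennreal (2 * bump \<rho> (x $ j - c $ j))" by (simp add: ennreal_ge_1)
      also have "\<dots> = 2 * ?X x" by (subst ennreal_mult) (simp_all add: bump_nonneg)
      finally have "1 * ennreal (k / 2) \<le> (2 * ?X x) * S x"
        using bad[OF True] by (intro mult_mono) auto
      then show ?thesis using True by (simp add: mult.assoc)
    qed simp
  qed simp
  also have "\<dots> = 2 * (2 * (\<integral>\<^sup>+x. ?X x * S x \<partial>lborel) * ennreal k)"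
    by (subst nn_integral_cmult) (simp_all add: mult_ac)
  also have "\<dots> \<le> 2 * (ennreal (1944 * 8 * ?Ca / \<rho>\<^sup>2) * (\<integral>\<^sup>+x\<in>W. G x * N x \<partial>lborel))"
    by (intro mult_left_mono S_int) simp
  also have "\<dots> \<le> 2 * (ennreal (1944 * 8 * ?Ca / \<rho>\<^sup>2) * (ennreal (8 * pi * \<rho>\<^sup>2) * (\<integral>\<^sup>+x\<in>W. (G x)\<^sup>2 \<partial>lborel)))"
    unfolding N_def W_def by (intro mult_left_mono slice_mass_pairing[OF Gm \<rho>]) simp_all
  also have "\<dots> = ennreal (995328 / \<rho>\<^sup>2) * (\<integral>\<^sup>+x\<in>W. (G x)\<^sup>2 \<partial>lborel)"
  proof -
    \<comment> \<open>The outer 2 comes from \<open>k\<^sup>2 = 2 * k * (k / 2)\<close>, the last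
      factor from \<open>slice_mass_pairing\<close>; the factor \<open>pi\<close> cancels against
      the one in \<open>?Ca\<close>, leaving \<open>2 * 1944 * 8 * 4 * 8\<close>.\<close>
    have "2 * (ennreal (1944 * 8 * ?Ca / \<rho>\<^sup>2) * ennreal (8 * pi * \<rho>\<^sup>2)) = ennreal (2 * (1944 * 8 * ?Ca / \<rho>\<^sup>2 * (8 * pi * \<rho>\<^sup>2)))"
    proof -
      have "2 * (ennreal a * ennreal b) = ennreal (2 * (a * b))" if "0 \<le> a" "0 \<le> b" for a b
        using that by (simp add: ennreal_mult)
      then show ?thesis using \<rho> by simp
    qed
    also have "2 * (1944 * 8 * ?Ca / \<rho>\<^sup>2 * (8 * pi * \<rho>\<^sup>2)) = 995328 / \<rho>\<^sup>2"
      using \<rho> by (simp add: field_simps)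
    finally show ?thesis by (simp add: mult.assoc[symmetric])
  qed
  also have "\<dots> \<le> ennreal (995328 / \<rho>\<^sup>2) * (\<integral>\<^sup>+x\<in>cball c (5 * \<rho>). (G x)\<^sup>2 \<partial>lborel)"
    using W5 \<rho> by (intro mult_left_mono nn_integral_mono) (auto simp: indicator_def subset_iff)
  finally show ?thesis .
qed

section \<open>Lipschitz estimates from dyadic oscillations\<close>

text \<open>Moves the dependence on \<open>x\<close> from \<open>f\<close> to the cone, whose
  Lipschitz constant then passes to the mean.\<close>

lemma kmean_uniform:
  fixes f :: "complex ^ 'n \<Rightarrow> ennreal"
  assumes [measurable]: "f \<in> borel_measurable borel" and s: "0 < s"
  shows "ennreal (s ^ DIM(complex ^ 'n)) * kmass TYPE(complex ^ 'n) * kmean (\<lambda>_. s) f x =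
    (\<integral>\<^sup>+z. ennreal (max 0 (1 - norm (z - x) / s)) * f z \<partial>lborel)"
proof -
  let ?M = "kmass TYPE(complex ^ 'n)"
  have "?M * kmean (\<lambda>_. s) f x = ?M * (\<integral>\<^sup>+w. kfun w * f (x + s *\<^sub>R w) \<partial>lborel)"
    unfolding kmean_def scl_const by (subst nn_integral_kern) simp_all
  also have "\<dots> = (\<integral>\<^sup>+w. ?M * (kfun w * f (x + s *\<^sub>R w)) \<partial>lborel)"
    by (rule nn_integral_cmult[symmetric]) measurable
  also have "\<dots> = (\<integral>\<^sup>+w. ennreal (max 0 (1 - norm (x + s *\<^sub>R w - x) / s)) * f (x + s *\<^sub>R w) \<partial>lborel)"
  proof (rule nn_integral_cong)
    fix w :: "complex ^ 'n"
    have "?M * kfun w = ennreal (max 0 (1 - norm w))"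
      using kmass_pos[where 'a = "complex ^ 'n"] kmass_finite[where 'a = "complex ^ 'n"]
      unfolding kfun_def by (subst mult.commute) (simp add: ennreal_divide_times ennreal_divide_self less_top)
    then show "?M * (kfun w * f (x + s *\<^sub>R w)) = ennreal (max 0 (1 - norm (x + s *\<^sub>R w - x) / s)) * f (x + s *\<^sub>R w)"
      using s by (simp add: mult.assoc[symmetric])
  qed
  finally have "ennreal (s ^ DIM(complex ^ 'n)) * (?M * kmean (\<lambda>_. s) f x) = ennreal (s ^ DIM(complex ^ 'n)) *
    (\<integral>\<^sup>+w. ennreal (max 0 (1 - norm (x + s *\<^sub>R w - x) / s)) * f (x + s *\<^sub>R w) \<partial>lborel)"
    by (rule arg_cong)
  also have "\<dots> = (\<integral>\<^sup>+z. ennreal (max 0 (1 - norm (z - x) / s)) * f z \<partial>lborel)"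
    by (rule nn_integral_lborel_scaleR[symmetric, OF _ s, where f = "\<lambda>z. ennreal (max 0 (1 - norm (z - x) / s)) * f z"]) measurable
  finally show ?thesis by (simp add: mult.assoc)
qed

text \<open>Where the cone of radius \<open>s\<close> about \<open>x\<close> is positive, it exceeds
  the one about \<open>y\<close> by at most \<open>dist x y / s\<close>, and there the wider cone of
  radius \<open>t\<close> is at least 1/2; this explains the factor 2. The power of
  \<open>t / s\<close> compares the normalisations. The error is expressed at \<open>x\<close>
  alone, so the estimate is one-sided and holds for infinite means as well.\<close>

lemma kmean_lipschitz:
  fixes f :: "complex ^ 'n \<Rightarrow> ennreal"
  assumes f[measurable]: "f \<in> borel_measurable borel" and s: "0 < s" "2 * s \<le> t"
  shows "kmean (\<lambda>_. s) f x \<le> kmean (\<lambda>_. s) f y +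
    ennreal (2 * dist x y / s * (t / s) ^ DIM(complex ^ 'n)) * kmean (\<lambda>_. t) f x"
proof -
  let ?d = "DIM(complex ^ 'n)" and ?M = "kmass TYPE(complex ^ 'n)"
  let ?c = "ennreal (s ^ ?d) * ?M"
  let ?I = "\<lambda>s x. \<integral>\<^sup>+z. ennreal (max 0 (1 - norm (z - x) / s)) * f z \<partial>lborel"
  have t: "0 < t" using s by linarith
  have "?I s x \<le> (\<integral>\<^sup>+z. ennreal (max 0 (1 - norm (z - y) / s)) * f z +
      ennreal (2 * dist x y / s) * (ennreal (max 0 (1 - norm (z - x) / t)) * f z) \<partial>lborel)"
  proof (rule nn_integral_mono)
    fix z
    have "max 0 (1 - norm (z - x) / s) \<le> max 0 (1 - norm (z - y) / s) + 2 * dist x y / s * max 0 (1 - norm (z - x) / t)"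
    proof (cases "norm (z - x) \<le> s")
      case True
      then have "norm (z - x) / t \<le> 1 / 2" using s t by (simp add: field_simps)
      then have "1 / 2 \<le> 1 - norm (z - x) / t" by simp
      then have "1 / 2 \<le> max 0 (1 - norm (z - x) / t)" by (rule order_trans) (rule max.cobounded2)
      moreover have "1 \<le> 2 * u" if "1 / 2 \<le> u" for u :: real using that by simp
      ultimately have "1 \<le> 2 * max 0 (1 - norm (z - x) / t)" by blast
      then have "dist x y / s * 1 \<le> dist x y / s * (2 * max 0 (1 - norm (z - x) / t))"
        using s by (intro mult_left_mono) auto
      moreover have "norm (z - y) \<le> norm (z - x) + dist x y"
        using dist_triangle[of z y x] by (simp add: dist_norm)
      then have "norm (z - y) / s \<le> norm (z - x) / s + dist x y / s"
        using s by (simp add: add_divide_distrib[symmetric] divide_right_mono)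
      moreover have "norm (z - x) / s \<le> 1" using True s by simp
      moreover have "max 0 (1 - a) \<le> max 0 (1 - b) + c" if "e * 1 \<le> c" "b \<le> a + e" "a \<le> 1" for a b c e :: real
        using that by (simp add: max_def)
      moreover have "2 * dist x y / s * max 0 (1 - norm (z - x) / t) = dist x y / s * (2 * max 0 (1 - norm (z - x) / t))"
        by simp
      ultimately show ?thesis by (simp only:)
    next
      case False
      then have "1 - norm (z - x) / s \<le> 0" using s by (simp add: field_simps)
      then have "max 0 (1 - norm (z - x) / s) = 0" by simp
      moreover have "0 \<le> 2 * dist x y / s * max 0 (1 - norm (z - x) / t)" using s by simp
      ultimately show ?thesis by linarith
    qed
    then have "ennreal (max 0 (1 - norm (z - x) / s)) \<le>
        ennreal (max 0 (1 - norm (z - y) / s) + 2 * dist x y / s * max 0 (1 - norm (z - x) / t))"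
      by (rule ennreal_leI)
    also have "\<dots> = ennreal (max 0 (1 - norm (z - y) / s)) + ennreal (2 * dist x y / s) * ennreal (max 0 (1 - norm (z - x) / t))"
      using s by (subst ennreal_mult[symmetric], simp, simp, subst ennreal_plus[symmetric]) simp_all
    finally have "ennreal (max 0 (1 - norm (z - x) / s)) * f z \<le> (ennreal (max 0 (1 - norm (z - y) / s)) + ennreal (2 * dist x y / s) * ennreal (max 0 (1 - norm (z - x) / t))) * f z"
      by (rule mult_right_mono) simp
    then show "ennreal (max 0 (1 - norm (z - x) / s)) * f z \<le> ennreal (max 0 (1 - norm (z - y) / s)) * f z +
      ennreal (2 * dist x y / s) * (ennreal (max 0 (1 - norm (z - x) / t)) * f z)"
      by (simp only: distrib_right mult.assoc)
  qed
  also have "\<dots> = ?I s y + ennreal (2 * dist x y / s) * ?I t x"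
    by (subst nn_integral_cmult[symmetric]) (measurable, rule nn_integral_add, measurable)
  finally have "?c * kmean (\<lambda>_. s) f x \<le> ?c * kmean (\<lambda>_. s) f y +
     ennreal (2 * dist x y / s) * (ennreal (t ^ ?d) * ?M * kmean (\<lambda>_. t) f x)"
    unfolding kmean_uniform[OF f s(1)] kmean_uniform[OF f t] .
  also have "ennreal (2 * dist x y / s) * (ennreal (t ^ ?d) * ?M * kmean (\<lambda>_. t) f x) =
     ?c * (ennreal (2 * dist x y / s * (t / s) ^ ?d) * kmean (\<lambda>_. t) f x)"
  proof -
    have "ennreal (2 * dist x y / s) * ennreal (t ^ ?d) = ennreal (s ^ ?d) * ennreal (2 * dist x y / s * (t / s) ^ ?d)"
      using s t by (simp add: ennreal_mult[symmetric] power_divide)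
    then show ?thesis by (simp only: mult.assoc[symmetric]) (simp only: mult_ac)
  qed
  finally have "?c * kmean (\<lambda>_. s) f x \<le> ?c * (kmean (\<lambda>_. s) f y + ennreal (2 * dist x y / s * (t / s) ^ ?d) * kmean (\<lambda>_. t) f x)"
    by (simp only: distrib_left)
  moreover have "?c \<noteq> 0" "?c \<noteq> top"
    using s kmass_pos[where 'a = "complex ^ 'n"] kmass_finite[where 'a = "complex ^ 'n"]
    by (simp_all add: ennreal_mult_eq_top_iff)
  ultimately show ?thesis
    by (simp add: ennreal_mult_le_mult_iff)
qed

lemma kmean_commute:
  fixes G :: "complex ^ 'n \<Rightarrow> ennreal"
  assumes [measurable]: "G \<in> borel_measurable borel"
  shows "kmean b (kmean d G) x = kmean d (kmean b G) x"
proof -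
  have "kmean b (kmean d G) x = (\<integral>\<^sup>+w. (\<integral>\<^sup>+u. G (x + scl b u + scl d w) \<partial>kern) \<partial>kern)"
    unfolding kmean_kmean by (rule kern_tonelli) (unfold_locales, simp, measurable)
  then show ?thesis unfolding kmean_kmean by (simp add: add_ac)
qed

lemma kmean_sum:
  assumes "finite A" "\<And>a. a \<in> A \<Longrightarrow> f a \<in> borel_measurable borel"
  shows "kmean d (\<lambda>y. \<Sum>a\<in>A. f a y) x = (\<Sum>a\<in>A. kmean d (f a) x)"
  unfolding kmean_def by (rule nn_integral_sum) (use assms in measurable)

text \<open>The scales on the way from \<open>s\<close> to \<open>2 * s\<close> just before
  coordinate \<open>j\<close> is doubled, the coordinates being processed in the order
  \<open>idx\<close>.\<close>

definition stage :: "('n \<Rightarrow> nat) \<Rightarrow> 'n \<Rightarrow> real \<Rightarrow> 'n \<Rightarrow> real" where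
  "stage idx j s l = (if idx l < idx j then 2 * s else s)"

lemma kmean_telescope:
  fixes G :: "complex ^ 'n \<Rightarrow> ennreal" and idx :: "'n \<Rightarrow> nat"
  assumes G: "separately_superharmonic \<Omega> G" and s: "0 < s" and x: "cball x (2 * s) \<subseteq> \<Omega>"
    and idx: "bij_betw idx UNIV {..<n}"
  shows "kmean (\<lambda>_. s) G x = kmean (\<lambda>_. 2 * s) G x + (\<Sum>j\<in>UNIV. kdiff (stage idx j s) j G x)"
proof -
  have "kmean (\<lambda>_. s) G x = kmean (\<lambda>l. if idx l < m then 2 * s else s) G x + (\<Sum>j | idx j < m. kdiff (stage idx j s) j G x)"
    if "m \<le> n" for m
    using that
  proof (induction m)
    case (Suc m)
    then obtain j where j: "idx j = m"
      using idx by (metis Suc_le_lessD bij_betw_iff_bijections lessThan_iff)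
    let ?h = "\<lambda>m l. if idx l < m then 2 * s else s"
    have inj: "idx l = m \<longleftrightarrow> l = j" for l
      using idx j by (metis UNIV_I bij_betw_def inj_onD)
    have st: "stage idx j s = ?h m" by (auto simp: stage_def j)
    have "kmean (?h m) G x = kmean ((?h m)(j := 2 * ?h m j)) G x + kdiff (?h m) j G x"
      using s by (intro kdiff_add[OF G x]) (auto simp: j)
    also have "(?h m)(j := 2 * ?h m j) = ?h (Suc m)"
      using inj by (auto simp: fun_eq_iff less_Suc_eq j)
    finally have 1: "kmean (?h m) G x = kmean (?h (Suc m)) G x + kdiff (stage idx j s) j G x" unfolding st .
    have "{j. idx j < Suc m} = insert j {j. idx j < m}"
      using inj by (auto simp: less_Suc_eq)
    then have "(\<Sum>j | idx j < Suc m. kdiff (stage idx j s) j G x) = kdiff (stage idx j s) j G x + (\<Sum>j | idx j < m. kdiff (stage idx j s) j G x)"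
      by (simp add: j)
    then show ?case using Suc 1 by (simp add: add.assoc)
  qed simp
  from this[of n] have "kmean (\<lambda>_. s) G x = kmean (\<lambda>l. if idx l < n then 2 * s else s) G x + (\<Sum>j | idx j < n. kdiff (stage idx j s) j G x)"
    by simp
  moreover have "idx l < n" for l using idx by (auto simp: bij_betw_def)
  ultimately show ?thesis by simp
qed

text \<open>Every \<open>l < G x\<close> is a lower bound for \<open>G\<close> near
  \<open>x\<close>, hence for the iterated means at small scales.\<close>

lemma le_if_means_le:
  fixes G :: "complex ^ 'n \<Rightarrow> ennreal"
  assumes G: "lsc G" and s: "s \<longlonglongrightarrow> 0" "\<And>i. 0 < s i"
    and B: "\<And>i::nat. kmean (\<lambda>_. s i) (kmean (\<lambda>_. s i) G) x \<le> B"
  shows "G x \<le> B"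
proof (rule ccontr)
  assume "\<not> G x \<le> B"
  then have "B < G x" by simp
  from dense[OF this] obtain l where l: "B < l" "l < G x" by blast
  have "open {y. l < G y}" using G by (simp add: lsc_def)
  then obtain e where e: "e > 0" "ball x e \<subseteq> {y. l < G y}"
    using open_contains_ball l by (metis mem_Collect_eq)
  have "\<forall>\<^sub>F i in sequentially. s i < e / 2"
    using order_tendstoD(2)[OF s(1), of "e / 2"] e by simp
  then obtain i where i: "s i < e / 2" by (auto simp: eventually_sequentially)
  have "l = kmean (\<lambda>_. s i) (kmean (\<lambda>_. s i) (\<lambda>_. l)) x" by (simp add: kmean_def)
  also have "\<dots> \<le> kmean (\<lambda>_. s i) (kmean (\<lambda>_. s i) G) x"
  proof (intro kmean_mono[of _ "s i"])
    fix y z assume "y \<in> cball x (s i)" "z \<in> cball y (s i)"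
    then have "z \<in> ball x e" using i dist_triangle[of x z y] by simp
    then show "l \<le> G z" using e by auto
  qed (use s(2)[of i] in auto)
  also have "\<dots> \<le> B" by (rule B)
  finally show False using l by simp
qed

text \<open>The twice averaged function \<open>E i\<close> increases with \<open>i\<close>, and its
  increments are means of \<open>D (Suc i)\<close> over Lipschitz kernels. Summing their
  oscillations between \<open>x\<close> and \<open>y\<close> and letting the scale tend to 0 gives
  the estimate for \<open>G\<close>, with a constant uniform in \<open>\<Omega>\<close>,
  \<open>G\<close> and both points.\<close>

lemma lipschitz_by_kdiff_sum:
  fixes G :: "complex ^ 'n \<Rightarrow> ennreal" and idx :: "'n \<Rightarrow> nat"
  assumes \<rho>: "0 < \<rho>" and idx: "bij_betw idx UNIV {..<n}"
  shows "\<exists>K\<ge>0. \<forall>\<Omega> (G :: complex ^ 'n \<Rightarrow> ennreal) x y. separately_superharmonic \<Omega> G \<longrightarrow> cball x (3 * \<rho>) \<subseteq> \<Omega> \<longrightarrow> dist x y \<le> \<rho> \<longrightarrow>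
    G x \<le> G y + ennreal (K * dist x y) *
      ((\<Sum>j\<in>UNIV. kdiff_sum \<rho> (stage idx j) j G x) + (\<integral>\<^sup>+z\<in>cball x \<rho>. G z \<partial>lborel))"
proof -
  let ?d = "DIM(complex ^ 'n)" and ?M = "kmass TYPE(complex ^ 'n)"
  define s where "s i = \<rho> / 8 / 2 ^ i" for i :: nat
  have s0: "0 < s i" for i using \<rho> by (simp add: s_def)
  have s1: "s i \<le> \<rho> / 8" for i using \<rho> by (simp add: s_def field_simps)
  have sS: "s i = 2 * s (Suc i)" for i by (simp add: s_def)
  have slim: "s \<longlonglongrightarrow> 0"
    unfolding s_def[abs_def] using \<rho> by real_asymp
  obtain m where m: "?M = ennreal m" "0 < m"
    using kmass_pos[where 'a = "complex ^ 'n"] kmass_finite[where 'a = "complex ^ 'n"]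
    by (metis ennreal_cases ennreal_eq_0_iff not_le)
  \<comment> \<open>The two outer kernels of a dyadic step have ratios 4 and 2 to the comparison
    scale and weights \<open>1 / s\<close> and \<open>1 / (2 * s)\<close>, hence the constant
    \<open>2 * 4 ^ d + 2 ^ d \<le> 3 * 4 ^ d\<close> in real dimension \<open>d\<close>.
    \<open>K2\<close> belongs to the coarsest scale.\<close>
  define K1 where "K1 = 3 * (4::real) ^ ?d"
  define K2 where "K2 = 2 / s 0 * 4 ^ ?d / ((4 * s 0) ^ ?d * m)"
  define K where "K = max K1 K2"
  have K: "0 \<le> K" by (simp add: K_def K1_def le_max_iff_disj)
  have "G x \<le> G y + ennreal (K * dist x y) *
      ((\<Sum>j\<in>UNIV. kdiff_sum \<rho> (stage idx j) j G x) + (\<integral>\<^sup>+z\<in>cball x \<rho>. G z \<partial>lborel))"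
    if G: "separately_superharmonic \<Omega> G" and x: "cball x (3 * \<rho>) \<subseteq> \<Omega>" and xy: "dist x y \<le> \<rho>" for \<Omega> G x y
  proof -
    note Gm[measurable] = separately_superharmonic_measurable[OF G]
    let ?V = "\<lambda>s. kmean (\<lambda>_::'n. s)"
    define D where "D i p = (\<Sum>j\<in>UNIV. kdiff (stage idx j (s i)) j G p)" for i p
    have [measurable]: "D i \<in> borel_measurable borel" for i unfolding D_def[abs_def] by measurable
    have sub: "cball p r \<subseteq> \<Omega>" if "dist x p + r \<le> 3 * \<rho>" for p r
    proof -
      have "cball p r \<subseteq> cball x (3 * \<rho>)" using that by (auto simp: cball_subset_cball_iff dist_commute)
      then show ?thesis using x by blast
    qed
    have tel: "?V (s (Suc i)) G p = ?V (s i) G p + D (Suc i) p" if "dist x p \<le> 2 * \<rho>" for i p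
      using kmean_telescope[OF G s0[of "Suc i"] _ idx, of p] that s1[of i] \<rho>
      unfolding D_def sS[of i, symmetric] by (simp add: sub)
    define E where "E i p = ?V (s i) (?V (s i) G) p" for i p
    \<comment> \<open>The increment is added first inside and then, after commuting the means,
      outside; this is the factorised difference of squares without any subtraction.\<close>
    have ES: "E (Suc i) p = E i p + (?V (s (Suc i)) (D (Suc i)) p + ?V (s i) (D (Suc i)) p)" if p: "dist x p \<le> \<rho>" for i p
    proof -
      have near: "dist x q \<le> 2 * \<rho>" if "q \<in> cball p (s l)" for q l
        using that p s1[of l] \<rho> dist_triangle[of x q p] by simp
      have "E (Suc i) p = ?V (s (Suc i)) (\<lambda>q. ?V (s i) G q + D (Suc i) q) p"
        unfolding E_def by (rule kmean_cong[of _ "s (Suc i)"]) (use s0[of "Suc i"] near tel in auto)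
      also have "\<dots> = ?V (s (Suc i)) (?V (s i) G) p + ?V (s (Suc i)) (D (Suc i)) p"
        by (rule kmean_add) measurable
      also have "?V (s (Suc i)) (?V (s i) G) p = ?V (s i) (?V (s (Suc i)) G) p"
        by (rule kmean_commute) measurable
      also have "\<dots> = ?V (s i) (\<lambda>q. ?V (s i) G q + D (Suc i) q) p"
        by (rule kmean_cong[of _ "s i"]) (use s0[of i] near tel in auto)
      also have "\<dots> = E i p + ?V (s i) (D (Suc i)) p"
        unfolding E_def by (rule kmean_add) measurable
      finally show ?thesis by (simp add: add_ac)
    qed
    define T where "T i = ennreal (1 / s i) * ?V (4 * s i) (D i) x" for i
    define B where "B = (\<integral>\<^sup>+z\<in>cball x \<rho>. G z \<partial>lborel)"
    \<comment> \<open>At the coarsest scale the Lipschitz error is a mean of \<open>G\<close>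
      itself, bounded by the ball integral that appears as the last summand of the
      conclusion.\<close>
    have base: "E 0 x \<le> E 0 y + ennreal (K * dist x y) * B"
    proof -
      have V4: "?V (4 * s 0) G q \<le> ennreal (1 / ((4 * s 0) ^ ?d * m)) * B" if q: "q \<in> cball x (s 0)" for q
      proof -
        have c: "ennreal ((4 * s 0) ^ ?d) * ?M = ennreal ((4 * s 0) ^ ?d * m)"
          using s0[of 0] m by (simp add: ennreal_mult)
        have "ennreal ((4 * s 0) ^ ?d * m) * ?V (4 * s 0) G q \<le> (\<integral>\<^sup>+z\<in>cball q (4 * s 0). G z \<partial>lborel)"
          using kmean_le_cball[OF Gm, of "4 * s 0" q] s0[of 0] unfolding c by simp
        also have "\<dots> \<le> B"
          unfolding B_def
        proof (rule nn_integral_mono)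
          fix z
          have "z \<in> cball x \<rho>" if "z \<in> cball q (4 * s 0)"
            using that q s1[of 0] \<rho> dist_triangle[of x z q] by simp
          then show "G z * indicator (cball q (4 * s 0)) z \<le> G z * indicator (cball x \<rho>) z"
            by (auto simp: indicator_def)
        qed
        finally have "ennreal (1 / ((4 * s 0) ^ ?d * m)) * (ennreal ((4 * s 0) ^ ?d * m) * ?V (4 * s 0) G q) \<le> ennreal (1 / ((4 * s 0) ^ ?d * m)) * B"
          by (rule mult_left_mono) simp
        moreover have "ennreal (1 / ((4 * s 0) ^ ?d * m)) * ennreal ((4 * s 0) ^ ?d * m) = 1"
          using s0[of 0] m by (subst ennreal_mult[symmetric]) simp_all
        ultimately show ?thesis by (simp add: mult.assoc[symmetric])
      qed
      have "E 0 x \<le> E 0 y + ennreal (2 * dist x y / s 0 * (4 * s 0 / s 0) ^ ?d) * ?V (4 * s 0) (?V (s 0) G) x"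
        unfolding E_def by (rule kmean_lipschitz) (use s0[of 0] in \<open>simp_all\<close>)
      also have "?V (4 * s 0) (?V (s 0) G) x = ?V (s 0) (?V (4 * s 0) G) x"
        by (rule kmean_commute) measurable
      also have "\<dots> \<le> ?V (s 0) (\<lambda>_. ennreal (1 / ((4 * s 0) ^ ?d * m)) * B) x"
        by (rule kmean_mono[of _ "s 0"]) (use s0[of 0] V4 in auto)
      also have "\<dots> = ennreal (1 / ((4 * s 0) ^ ?d * m)) * B" by (simp add: kmean_def)
      finally have "E 0 x \<le> E 0 y + ennreal (2 * dist x y / s 0 * (4 * s 0 / s 0) ^ ?d) * (ennreal (1 / ((4 * s 0) ^ ?d * m)) * B)"
        by (simp add: mult_left_mono add_left_mono)
      also have "ennreal (2 * dist x y / s 0 * (4 * s 0 / s 0) ^ ?d) * (ennreal (1 / ((4 * s 0) ^ ?d * m)) * B) = ennreal (K2 * dist x y) * B"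
      proof -
        have "ennreal (2 * dist x y / s 0 * (4 * s 0 / s 0) ^ ?d) * ennreal (1 / ((4 * s 0) ^ ?d * m)) = ennreal (K2 * dist x y)"
          using s0[of 0] m by (subst ennreal_mult[symmetric]) (simp_all add: K2_def mult_ac)
        then show ?thesis by (simp only: mult.assoc[symmetric])
      qed
      also have "E 0 y + ennreal (K2 * dist x y) * B \<le> E 0 y + ennreal (K * dist x y) * B"
        by (intro add_left_mono mult_right_mono ennreal_leI) (auto simp: K_def)
      finally show ?thesis .
    qed
    \<comment> \<open>Both outer kernels, of scales \<open>s (Suc i)\<close> and \<open>s i\<close>,
      are compared with the same scale \<open>4 * s (Suc i)\<close>; for the second one the
      condition \<open>2 * s \<le> t\<close> holds with equality.\<close>
    have Ei: "E i x \<le> E i y + ennreal (K * dist x y) * ((\<Sum>l\<le>i. T l) + B)" for i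
    proof (induction i)
      case 0
      have "E 0 y + ennreal (K * dist x y) * B \<le> E 0 y + ennreal (K * dist x y) * ((\<Sum>l\<le>0. T l) + B)"
        by (intro add_left_mono mult_left_mono) (auto intro: add_increasing)
      with base show ?case by (rule order_trans)
    next
      case (Suc i)
      let ?s = "s (Suc i)"
      have 1: "?V ?s (D (Suc i)) x \<le> ?V ?s (D (Suc i)) y + ennreal (2 * dist x y / ?s * (4 * ?s / ?s) ^ ?d) * ?V (4 * ?s) (D (Suc i)) x"
        by (rule kmean_lipschitz) (use s0[of "Suc i"] in simp_all)
      have 2: "?V (s i) (D (Suc i)) x \<le> ?V (s i) (D (Suc i)) y + ennreal (2 * dist x y / s i * (4 * ?s / s i) ^ ?d) * ?V (4 * ?s) (D (Suc i)) x"
        by (rule kmean_lipschitz) (use s0[of "Suc i"] s0[of i] sS[of i] in simp_all)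
      have c: "ennreal (2 * dist x y / ?s * (4 * ?s / ?s) ^ ?d) + ennreal (2 * dist x y / s i * (4 * ?s / s i) ^ ?d) \<le> ennreal (K * dist x y) * ennreal (1 / ?s)"
      proof -
        have "2 * dist x y / ?s * (4 * ?s / ?s) ^ ?d + 2 * dist x y / s i * (4 * ?s / s i) ^ ?d = (2 * 4 ^ ?d + 2 ^ ?d) * dist x y / ?s"
          using s0[of "Suc i"] unfolding sS[of i] by (simp add: field_simps)
        also have "\<dots> \<le> (K * dist x y) * (1 / ?s)"
        proof -
          have "(2::real) ^ ?d \<le> 4 ^ ?d" by (rule power_mono) auto
          then have "2 * 4 ^ ?d + 2 ^ ?d \<le> K1" unfolding K1_def by linarith
          also have "K1 \<le> K" by (simp add: K_def)
          finally have "2 * 4 ^ ?d + 2 ^ ?d \<le> K" .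
          then have "(2 * 4 ^ ?d + 2 ^ ?d) * (dist x y / ?s) \<le> K * (dist x y / ?s)"
            using s0[of "Suc i"] by (intro mult_right_mono) auto
          then show ?thesis by simp
        qed
        finally have "ennreal (2 * dist x y / ?s * (4 * ?s / ?s) ^ ?d + 2 * dist x y / s i * (4 * ?s / s i) ^ ?d) \<le> ennreal ((K * dist x y) * (1 / ?s))"
          by (rule ennreal_leI)
        then show ?thesis
          using s0[of "Suc i"] s0[of i] K by (simp add: ennreal_plus[symmetric] ennreal_mult[symmetric] del: ennreal_plus)
      qed
      have "E (Suc i) x = E i x + (?V ?s (D (Suc i)) x + ?V (s i) (D (Suc i)) x)"
        using \<rho> by (intro ES) simp
      also have "\<dots> \<le> (E i y + ennreal (K * dist x y) * ((\<Sum>l\<le>i. T l) + B)) +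
        ((?V ?s (D (Suc i)) y + ennreal (2 * dist x y / ?s * (4 * ?s / ?s) ^ ?d) * ?V (4 * ?s) (D (Suc i)) x) +
         (?V (s i) (D (Suc i)) y + ennreal (2 * dist x y / s i * (4 * ?s / s i) ^ ?d) * ?V (4 * ?s) (D (Suc i)) x))"
        by (intro add_mono Suc 1 2)
      also have "\<dots> = (E i y + (?V ?s (D (Suc i)) y + ?V (s i) (D (Suc i)) y)) + (ennreal (K * dist x y) * ((\<Sum>l\<le>i. T l) + B) +
         (ennreal (2 * dist x y / ?s * (4 * ?s / ?s) ^ ?d) + ennreal (2 * dist x y / s i * (4 * ?s / s i) ^ ?d)) * ?V (4 * ?s) (D (Suc i)) x)"
        by (simp only: distrib_right add_ac)
      also have "\<dots> \<le> (E i y + (?V ?s (D (Suc i)) y + ?V (s i) (D (Suc i)) y)) + (ennreal (K * dist x y) * ((\<Sum>l\<le>i. T l) + B) +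
         (ennreal (K * dist x y) * ennreal (1 / ?s)) * ?V (4 * ?s) (D (Suc i)) x)"
        by (intro add_left_mono mult_right_mono c) simp
      also have "\<dots> = E (Suc i) y + ennreal (K * dist x y) * ((\<Sum>l\<le>Suc i. T l) + B)"
        using ES[OF xy, of i] by (simp add: T_def distrib_left mult.assoc add_ac)
      finally show ?case .
    qed
    have Tsum: "(\<Sum>l\<le>i. T l) \<le> (\<Sum>j\<in>UNIV. kdiff_sum \<rho> (stage idx j) j G x)" for i
    proof -
      have T: "T l = (\<Sum>j\<in>UNIV. ennreal (2 ^ l / (\<rho> / 8)) * kmean (\<lambda>_. 4 * (\<rho> / 8 / 2 ^ l)) (kdiff (stage idx j (\<rho> / 8 / 2 ^ l)) j G) x)" for l
      proof -
        have "1 / s l = 2 ^ l / (\<rho> / 8)" by (simp add: s_def mult.commute)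
        then show ?thesis
          unfolding T_def D_def by (subst kmean_sum) (simp_all add: sum_distrib_left s_def mult.commute[of 8])
      qed
      have "(\<Sum>l\<le>i. T l) = (\<Sum>j\<in>UNIV. \<Sum>l\<le>i. ennreal (2 ^ l / (\<rho> / 8)) * kmean (\<lambda>_. 4 * (\<rho> / 8 / 2 ^ l)) (kdiff (stage idx j (\<rho> / 8 / 2 ^ l)) j G) x)"
        unfolding T by (rule sum.swap)
      also have "\<dots> \<le> (\<Sum>j\<in>UNIV. kdiff_sum \<rho> (stage idx j) j G x)"
        unfolding kdiff_sum_def by (intro sum_mono sum_le_suminf) simp_all
      finally show ?thesis .
    qed
    show ?thesis
    proof (rule le_if_means_le[OF _ slim s0])
      show "lsc G" using G by (simp add: separately_superharmonic_def)
      fix i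
      have "E i x \<le> E i y + ennreal (K * dist x y) * ((\<Sum>l\<le>i. T l) + B)" by (rule Ei)
      also have "\<dots> \<le> G y + ennreal (K * dist x y) * ((\<Sum>j\<in>UNIV. kdiff_sum \<rho> (stage idx j) j G x) + B)"
      proof (intro add_mono mult_left_mono Tsum order_refl)
        show "E i y \<le> G y"
          unfolding E_def using xy s1[of i] s0[of i] \<rho>
          by (intro kmean_kmean_le[OF G, of _ "s i" "s i"] sub) auto
      qed simp
      finally show "kmean (\<lambda>_. s i) (kmean (\<lambda>_. s i) G) x \<le> G y + ennreal (K * dist x y) *
        ((\<Sum>j\<in>UNIV. kdiff_sum \<rho> (stage idx j) j G x) + (\<integral>\<^sup>+z\<in>cball x \<rho>. G z \<partial>lborel))"
        by (simp add: E_def B_def)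
    qed
  qed
  then show ?thesis using K by blast
qed

section \<open>Square integrability\<close>

lemma superharmonic1_translate:
  assumes "superharmonic1 U g"
  shows "superharmonic1 {w. z + w \<in> U} (\<lambda>w. g (z + w))"
  unfolding superharmonic1_def
proof (intro conjI allI impI)
  have "open ((\<lambda>w. z + w) -` U)"
    using assms by (intro open_vimage continuous_intros) (auto simp: superharmonic1_def)
  then show "open {w. z + w \<in> U}" by (simp add: vimage_def)
  show "lsc (\<lambda>w. g (z + w))"
    using assms unfolding superharmonic1_def
    by (intro lsc_compose[where f = g and k = "\<lambda>w. z + w"] continuous_intros) auto
  fix y and r :: real assume r: "0 < r" "cball y r \<subseteq> {w. z + w \<in> U}"
  have "cball (z + y) r \<subseteq> U"
  proof
    fix w assume "w \<in> cball (z + y) r"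
    then have "w - z \<in> cball y r" by (simp add: dist_norm algebra_simps)
    then have "w - z \<in> {w. z + w \<in> U}" using r(2) by blast
    then show "w \<in> U" by simp
  qed
  then have "cmean (\<lambda>w. g ((z + y) + w)) (of_real r) \<le> g (z + y)"
    using assms r(1) unfolding superharmonic1_def by blast
  then show "cmean (\<lambda>w. g (z + (y + w))) (complex_of_real r) \<le> g (z + y)"
    by (simp add: add.assoc)
qed

text \<open>The same cancellation in one variable: the circle is invariant under
  \<open>u \<mapsto> - u\<close>, so the shifts moved onto the bump can be symmetrized, with an
  error of order \<open>(t / r)\<^sup>2\<close>.\<close>

lemma bump_pairing_cmean:
  assumes [measurable]: "g \<in> borel_measurable borel" and r: "0 < r" and t: "0 \<le> t" "t \<le> r"
  shows "2 * (\<integral>\<^sup>+z. ennreal (bump r z) * g z \<partial>lborel) \<le>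
    2 * (\<integral>\<^sup>+z. ennreal (bump r z) * cmean (\<lambda>w. g (z + w)) (of_real t) \<partial>lborel) +
    ennreal (4 * (t / r)\<^sup>2) * (\<integral>\<^sup>+z\<in>ball 0 (2 * r). g z \<partial>lborel)"
proof -
  have [measurable]: "ball (0::complex) (2 * r) \<in> sets borel" by simp
  define P where "P = (\<integral>\<^sup>+z. ennreal (bump r z) * cmean (\<lambda>w. g (z + w)) (of_real t) \<partial>lborel)"
  define \<Psi> where "\<Psi> v = (\<integral>\<^sup>+z. ennreal (bump r (z - v)) * g z \<partial>lborel)" for v
  have [measurable]: "\<Psi> \<in> borel_measurable borel" unfolding \<Psi>_def[abs_def] by measurable
  have "P = (\<integral>\<^sup>+z. (\<integral>\<^sup>+u. ennreal (bump r z) * g (z + of_real t * u) \<partial>circle) \<partial>lborel)"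
    unfolding P_def cmean_def by (simp add: nn_integral_cmult)
  also have "\<dots> = (\<integral>\<^sup>+u. (\<integral>\<^sup>+z. ennreal (bump r z) * g (z + of_real t * u) \<partial>lborel) \<partial>circle)"
    by (rule circle_tonelli) (unfold_locales, simp, measurable)
  also have "\<dots> = (\<integral>\<^sup>+u. \<Psi> (of_real t * u) \<partial>circle)"
  proof (rule nn_integral_cong)
    fix u
    show "(\<integral>\<^sup>+z. ennreal (bump r z) * g (z + of_real t * u) \<partial>lborel) = \<Psi> (of_real t * u)"
      unfolding \<Psi>_def
      using nn_integral_lborel_shift[where f = "\<lambda>z. ennreal (bump r (z - of_real t * u)) * g z" and a = "of_real t * u"]
      by simp
  qed
  finally have P1: "P = (\<integral>\<^sup>+u. \<Psi> (of_real t * u) \<partial>circle)" .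
  then have P2: "P = (\<integral>\<^sup>+u. \<Psi> (- (of_real t * u)) \<partial>circle)"
    using nn_integral_circle_rotate[of "\<lambda>u. \<Psi> (of_real t * u)" "-1"] by simp
  have "2 * (\<integral>\<^sup>+z. ennreal (bump r z) * g z \<partial>lborel) = (\<integral>\<^sup>+u. 2 * (\<integral>\<^sup>+z. ennreal (bump r z) * g z \<partial>lborel) \<partial>circle)"
    by simp
  also have "\<dots> \<le> (\<integral>\<^sup>+u. (\<Psi> (of_real t * u) + \<Psi> (- (of_real t * u))) + ennreal (4 * (t / r)\<^sup>2) * (\<integral>\<^sup>+z\<in>ball 0 (2 * r). g z \<partial>lborel) \<partial>circle)"
  proof (rule nn_integral_circle_mono)
    fix u :: complex assume u: "norm u = 1"
    let ?v = "of_real t * u"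
    have nv: "norm ?v = t" using u t by (simp add: norm_mult)
    have "2 * (\<integral>\<^sup>+z. ennreal (bump r z) * g z \<partial>lborel) = (\<integral>\<^sup>+z. 2 * (ennreal (bump r z) * g z) \<partial>lborel)"
      by (rule nn_integral_cmult[symmetric]) measurable
    also have "\<dots> \<le> (\<integral>\<^sup>+z. (ennreal (bump r (z - ?v)) * g z + ennreal (bump r (z - (- ?v))) * g z) + ennreal (4 * (t / r)\<^sup>2) * (g z * indicator (ball 0 (2 * r)) z) \<partial>lborel)"
    proof (rule nn_integral_mono)
      fix z
      have "2 * bump r z \<le> bump r (z - ?v) + bump r (z - (- ?v)) + 4 * (t / r)\<^sup>2 * indicator (ball 0 (2 * r)) z"
        using bump_symmetrized(2)[OF r, of ?v z] t unfolding nv by simp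
      then have "ennreal (2 * bump r z) \<le> ennreal (bump r (z - ?v) + bump r (z - (- ?v)) + 4 * (t / r)\<^sup>2 * indicator (ball 0 (2 * r)) z)"
        by (rule ennreal_leI)
      also have "\<dots> = (ennreal (bump r (z - ?v)) + ennreal (bump r (z - (- ?v)))) + ennreal (4 * (t / r)\<^sup>2 * indicator (ball 0 (2 * r)) z)"
        by (simp add: bump_nonneg)
      also have "ennreal (4 * (t / r)\<^sup>2 * indicator (ball 0 (2 * r)) z) = ennreal (4 * (t / r)\<^sup>2) * indicator (ball 0 (2 * r)) z"
        by (simp add: indicator_def)
      finally have "ennreal (2 * bump r z) * g z \<le> ((ennreal (bump r (z - ?v)) + ennreal (bump r (z - (- ?v)))) + ennreal (4 * (t / r)\<^sup>2) * indicator (ball 0 (2 * r)) z) * g z"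
        by (rule mult_right_mono) simp
      moreover have "ennreal (2 * bump r z) = 2 * ennreal (bump r z)"
        by (subst ennreal_mult) (simp_all add: bump_nonneg)
      ultimately show "2 * (ennreal (bump r z) * g z) \<le> (ennreal (bump r (z - ?v)) * g z + ennreal (bump r (z - (- ?v))) * g z) + ennreal (4 * (t / r)\<^sup>2) * (g z * indicator (ball 0 (2 * r)) z)"
        by (simp only: distrib_left distrib_right mult_ac)
    qed
    also have "\<dots> = (\<Psi> ?v + \<Psi> (- ?v)) + ennreal (4 * (t / r)\<^sup>2) * (\<integral>\<^sup>+z\<in>ball 0 (2 * r). g z \<partial>lborel)"
      unfolding \<Psi>_def
      by (subst nn_integral_add; measurable?) (subst nn_integral_add; measurable?; subst nn_integral_cmult; measurable?; simp)
    finally show "2 * (\<integral>\<^sup>+z. ennreal (bump r z) * g z \<partial>lborel) \<le> (\<Psi> ?v + \<Psi> (- ?v)) + ennreal (4 * (t / r)\<^sup>2) * (\<integral>\<^sup>+z\<in>ball 0 (2 * r). g z \<partial>lborel)" .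
  qed
  also have "\<dots> = 2 * P + ennreal (4 * (t / r)\<^sup>2) * (\<integral>\<^sup>+z\<in>ball 0 (2 * r). g z \<partial>lborel)"
  proof -
    have "2 * P = P + P" by (simp add: mult_2)
    also have "\<dots> = (\<integral>\<^sup>+u. \<Psi> (of_real t * u) + \<Psi> (- (of_real t * u)) \<partial>circle)"
      by (subst (1) P1, subst P2, rule nn_integral_add[symmetric]) measurable
    finally show ?thesis by (subst nn_integral_add) simp_all
  qed
  finally show ?thesis unfolding P_def .
qed

text \<open>\<open>cmean_log\<close> bounds the growth for small \<open>t\<close> by
  \<open>ln (R / t)\<close>. The inequalities \<open>ln x \<le> 2 * sqrt x\<close> and
  \<open>1 / 2 \<le> ln 2\<close> trade the logarithm for a power that is easily solved for
  \<open>t\<close>.\<close>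

lemma cmean_sqrt_bound:
  assumes g: "superharmonic1 U g" and R: "cball 0 R \<subseteq> U" and m: "0 \<le> m" "cmean g (of_real (R / 2)) \<le> ennreal m"
    and t: "0 < t" "2 * t \<le> R"
  shows "cmean g (of_real t) \<le> ennreal (4 * m * sqrt (R / t))"
proof (rule ennreal_le_if_real_le)
  fix l assume l: "0 \<le> l" "ennreal l \<le> cmean g (of_real t)"
  have R0: "0 < R" using t by linarith
  have "ennreal (l * ln (R / norm (of_real (R / 2) :: complex)) / ln (R / norm (of_real t :: complex))) \<le> cmean g (of_real (R / 2))"
    by (rule cmean_log[OF g R _ _ _ l]) (use t R0 in auto)
  also note m(2)
  finally have "l * ln 2 / ln (R / t) \<le> m"
    using t R0 m by (simp add: ennreal_le_iff)
  moreover have L: "0 < ln (R / t)" using t by (intro ln_gt_zero) simp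
  ultimately have 1: "l * ln 2 \<le> m * ln (R / t)" by (simp add: field_simps)
  have "ln (R / t) = 2 * ln (sqrt (R / t))" using t R0 by (simp add: ln_sqrt)
  also have "ln (sqrt (R / t)) \<le> sqrt (R / t)"
    using ln_le_minus_one[of "sqrt (R / t)"] t R0 by simp
  finally have 2: "ln (R / t) \<le> 2 * sqrt (R / t)" by simp
  have "(1 / 2 :: real) \<le> ln 2"
    using ln_le_minus_one[of "1 / 2"] by (simp add: ln_div)
  then have "l * (1 / 2) \<le> l * ln 2" using l by (intro mult_left_mono) auto
  also note 1
  also have "m * ln (R / t) \<le> m * (2 * sqrt (R / t))" using 2 m by (intro mult_left_mono) auto
  finally have "l \<le> 4 * m * sqrt (R / t)" by simp
  then show "ennreal l \<le> ennreal (4 * m * sqrt (R / t))" by (rule ennreal_leI)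
qed

text \<open>For a suitable radius \<open>t\<close> all circle means about points of
  \<open>ball 0 r\<close> are at most \<open>\<mu> / 2\<close>, so on the superlevel set
  \<open>g\<close> exceeds its mean by at least \<open>\<mu> / 2\<close>. The integral of the excess
  against the bump is of order \<open>(t / r)\<^sup>2 * m\<close>, and \<open>t\<close> is of order
  \<open>(m / \<mu>)\<^sup>2\<close>. The resulting fifth power of \<open>m / \<mu>\<close> is more
  than square integrability demands.\<close>

lemma superharmonic1_superlevel:
  assumes g: "superharmonic1 U g" and R: "0 < R" "cball 0 R \<subseteq> U" and m: "0 < m" "g 0 \<le> ennreal m"
    and \<mu>: "256 * m \<le> \<mu>"
  shows "emeasure lborel {z \<in> ball 0 (R / 8). ennreal \<mu> < g z} \<le> ennreal (32 * pi * R\<^sup>2 * (m / \<mu>) * (128 * m / \<mu>) ^ 4)"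
proof -
  have [measurable]: "g \<in> borel_measurable borel"
    using g by (auto simp: superharmonic1_def intro: lsc_borel_measurable)
  have [measurable]: "ball (0::complex) (R / 8) \<in> sets borel" "ball (0::complex) R \<in> sets borel" "ball (0::complex) (R / 2) \<in> sets borel" by simp_all
  define r where "r = R / 4"
  have r: "0 < r" using R by (simp add: r_def)
  have \<mu>0: "0 < \<mu>" using m \<mu> by linarith
  \<comment> \<open>Makes \<open>sqrt (R / 2 / t)\<close> equal to \<open>\<mu> / (128 * m)\<close>.
    The mean at radius \<open>R / 4\<close> is at most \<open>16 * m\<close>, from the ratio of the
    areas of discs of radius \<open>R\<close> and \<open>R / 4\<close>, so
    \<open>cmean_sqrt_bound\<close> yields exactly \<open>\<mu> / 2\<close>. The hypothesis on
    \<open>\<mu>\<close> keeps \<open>t\<close> at most \<open>R / 8\<close>.\<close>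
  define t where "t = R / 2 * (128 * m / \<mu>)\<^sup>2"
  have q: "0 < 128 * m / \<mu>" "128 * m / \<mu> \<le> 1 / 2" using m \<mu> \<mu>0 by (simp_all add: field_simps)
  have t: "0 < t" "2 * t \<le> R / 2" "t \<le> r"
  proof -
    have "(128 * m / \<mu>)\<^sup>2 \<le> (1 / 2)\<^sup>2" using q by (intro power_mono) auto
    then have "R * (128 * m / \<mu>)\<^sup>2 \<le> R * (1 / 2)\<^sup>2" using R by (intro mult_left_mono) auto
    then show "2 * t \<le> R / 2" "t \<le> r" using R by (simp_all add: t_def r_def power2_eq_square)
    show "0 < t" unfolding t_def using zero_less_power[OF q(1), of 2] R by (intro mult_pos_pos) simp_all
  qed
  define I where "I = (\<integral>\<^sup>+z\<in>ball 0 R. g z \<partial>lborel)"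
  have I: "I \<le> ennreal (pi * R\<^sup>2 * m)"
  proof -
    have "I \<le> ennreal (pi * R\<^sup>2) * g 0"
      unfolding I_def by (rule disc_le_superharmonic1[OF g R(2,1)])
    also have "\<dots> \<le> ennreal (pi * R\<^sup>2) * ennreal m" by (intro mult_left_mono m) simp
    finally show ?thesis using m by (simp add: ennreal_mult)
  qed
  have mean: "cmean (\<lambda>w. g (z + w)) (of_real t) \<le> ennreal (\<mu> / 2)" "cmean (\<lambda>w. g (z + w)) (of_real t) \<le> g z" if z: "z \<in> ball 0 r" for z
  proof -
    note sh = superharmonic1_translate[OF g, of z]
    have sub: "cball 0 (R / 2) \<subseteq> {w. z + w \<in> U}"
    proof
      fix w :: complex assume "w \<in> cball 0 (R / 2)"
      then have "z + w \<in> cball 0 R" using z norm_triangle_ineq[of z w] R by (simp add: r_def)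
      then show "w \<in> {w. z + w \<in> U}" using R(2) by auto
    qed
    have sub4: "cball 0 (R / 4) \<subseteq> {w. z + w \<in> U}" using sub R by (auto simp: subset_iff)
    have "cmean (\<lambda>w. g (z + w)) (of_real (R / 4)) \<le> ennreal (1 / (pi * (R / 4)\<^sup>2)) * (\<integral>\<^sup>+v\<in>ball 0 (R / 4). g (z + v) \<partial>lborel)"
      by (rule cmean_le_disc[OF sh sub4]) (use R in auto)
    also have "(\<integral>\<^sup>+v\<in>ball 0 (R / 4). g (z + v) \<partial>lborel) \<le> (\<integral>\<^sup>+v. g (v + z) * indicator (ball 0 R) (v + z) \<partial>lborel)"
    proof (rule nn_integral_mono)
      fix v :: complex
      have "v + z \<in> ball 0 R" if "v \<in> ball 0 (R / 4)"
        using that z norm_triangle_ineq[of v z] R by (simp add: r_def)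
      then show "g (z + v) * indicator (ball 0 (R / 4)) v \<le> g (v + z) * indicator (ball 0 R) (v + z)"
        by (auto simp: indicator_def add.commute)
    qed
    also have "\<dots> = I"
      unfolding I_def by (rule nn_integral_lborel_shift[where f = "\<lambda>v. g v * indicator (ball 0 R) v"]) measurable
    also note I
    finally have "cmean (\<lambda>w. g (z + w)) (of_real (R / 4)) \<le> ennreal (1 / (pi * (R / 4)\<^sup>2)) * ennreal (pi * R\<^sup>2 * m)"
      by (simp add: mult_left_mono)
    also have "\<dots> = ennreal (16 * m)"
      using R m by (subst ennreal_mult[symmetric]) (simp_all add: power_divide)
    finally have "cmean (\<lambda>w. g (z + w)) (of_real ((R / 2) / 2)) \<le> ennreal (16 * m)" by simp
    from cmean_sqrt_bound[OF sh sub _ this t(1,2)]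
    have "cmean (\<lambda>w. g (z + w)) (of_real t) \<le> ennreal (4 * (16 * m) * sqrt (R / 2 / t))"
      using m by simp
    also have "sqrt (R / 2 / t) = \<mu> / (128 * m)"
    proof -
      have "R / 2 / t = (\<mu> / (128 * m))\<^sup>2" using R m \<mu>0 by (simp add: t_def power_divide)
      then show ?thesis using m \<mu>0 by (simp add: real_sqrt_abs)
    qed
    also have "4 * (16 * m) * (\<mu> / (128 * m)) = \<mu> / 2" using m by simp
    finally show "cmean (\<lambda>w. g (z + w)) (of_real t) \<le> ennreal (\<mu> / 2)" .
    show "cmean (\<lambda>w. g (z + w)) (of_real t) \<le> g z"
      using cmean_antimono[OF sh sub, of 0 "of_real t"] t by simp
  qed
  let ?S = "{z \<in> ball 0 (R / 8). ennreal \<mu> < g z}"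
  have [measurable]: "?S \<in> sets borel" by measurable
  let ?C = "\<lambda>z. cmean (\<lambda>w. g (z + w)) (of_real t)"
  have [measurable]: "?C \<in> borel_measurable borel" unfolding cmean_def by measurable
  let ?X = "\<lambda>z. ennreal (bump r z)"
  define P where "P = (\<integral>\<^sup>+z. ?X z * ?C z \<partial>lborel)"
  have "2 * P + ennreal (\<mu> / 2) * emeasure lborel ?S = (\<integral>\<^sup>+z. 2 * (?X z * ?C z) + ennreal (\<mu> / 2) * indicator ?S z \<partial>lborel)"
    unfolding P_def
    by (subst nn_integral_add; measurable?) (subst nn_integral_cmult; measurable?; subst nn_integral_cmult_indicator; simp)
  also have "\<dots> \<le> (\<integral>\<^sup>+z. 2 * (?X z * g z) \<partial>lborel)"
  proof (rule nn_integral_mono)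
    fix z
    show "2 * (?X z * ?C z) + ennreal (\<mu> / 2) * indicator ?S z \<le> 2 * (?X z * g z)"
    proof (cases "z \<in> ?S")
      case True
      then have z: "z \<in> ball 0 r" using R by (simp add: r_def)
      have "1 / 2 \<le> bump r z" using True r by (intro bump_ge_half) (auto simp: r_def)
      then have "1 \<le> ennreal (2 * bump r z)" by (simp add: ennreal_ge_1)
      also have "\<dots> = 2 * ?X z" by (subst ennreal_mult) (simp_all add: bump_nonneg)
      finally have X1: "1 \<le> 2 * ?X z" .
      have "2 * (?X z * ?C z) + ennreal (\<mu> / 2) * indicator ?S z = (2 * ?X z) * ?C z + 1 * ennreal (\<mu> / 2)"
        using True by (simp add: mult.assoc)
      also have "\<dots> \<le> (2 * ?X z) * ennreal (\<mu> / 2) + (2 * ?X z) * ennreal (\<mu> / 2)"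
        by (intro add_mono mult_mono mean(1)[OF z] X1) auto
      also have "\<dots> = (2 * ?X z) * ennreal \<mu>"
        using \<mu>0 by (simp add: distrib_left[symmetric] ennreal_plus[symmetric] del: ennreal_plus)
      also have "\<dots> \<le> (2 * ?X z) * g z"
        using True by (intro mult_left_mono) auto
      finally show ?thesis by (simp add: mult.assoc)
    next
      case False
      show ?thesis
      proof (cases "z \<in> ball 0 r")
        case True
        then show ?thesis using False mean(2)[OF True] by (simp add: mult_left_mono)
      next
        case False2: False
        then have "bump r z = 0" using r by (intro bump_eq_0) auto
        then show ?thesis using False by simp
      qed
    qed
  qed
  also have "\<dots> = 2 * (\<integral>\<^sup>+z. ?X z * g z \<partial>lborel)"
    by (rule nn_integral_cmult) measurable
  also have "\<dots> \<le> 2 * P + ennreal (4 * (t / r)\<^sup>2) * (\<integral>\<^sup>+z\<in>ball 0 (2 * r). g z \<partial>lborel)"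
    unfolding P_def by (rule bump_pairing_cmean) (use r t in auto)
  also have "\<dots> \<le> 2 * P + ennreal (4 * (t / r)\<^sup>2) * I"
    unfolding I_def using R
    by (intro add_left_mono mult_left_mono nn_integral_mono) (auto simp: indicator_def r_def)
  finally have "2 * P + ennreal (\<mu> / 2) * emeasure lborel ?S \<le> 2 * P + ennreal (4 * (t / r)\<^sup>2) * I" .
  moreover have "P \<le> I"
    unfolding P_def I_def
  proof (rule nn_integral_mono)
    fix z
    show "?X z * ?C z \<le> g z * indicator (ball 0 R) z"
    proof (cases "z \<in> ball 0 r")
      case True
      have "?X z * ?C z \<le> 1 * g z"
        by (intro mult_mono mean(2)[OF True]) (auto simp: bump_le_1 ennreal_le_1)
      then show ?thesis using True R by (simp add: r_def)
    next
      case False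
      then have "bump r z = 0" using r by (intro bump_eq_0) auto
      then show ?thesis by simp
    qed
  qed
  then have "P < top" using I by (metis ennreal_less_top le_less_trans)
  then have "2 * P \<noteq> top" by (simp add: ennreal_mult_eq_top_iff)
  ultimately have "ennreal (\<mu> / 2) * emeasure lborel ?S \<le> ennreal (4 * (t / r)\<^sup>2) * I"
    by (simp add: ennreal_add_left_cancel_le)
  also have "\<dots> \<le> ennreal (4 * (t / r)\<^sup>2) * ennreal (pi * R\<^sup>2 * m)"
    by (intro mult_left_mono I) simp
  finally have "ennreal (2 / \<mu>) * (ennreal (\<mu> / 2) * emeasure lborel ?S) \<le> ennreal (2 / \<mu>) * (ennreal (4 * (t / r)\<^sup>2) * ennreal (pi * R\<^sup>2 * m))"
    by (rule mult_left_mono) simp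
  moreover have "ennreal (2 / \<mu>) * ennreal (\<mu> / 2) = 1"
    using \<mu>0 by (subst ennreal_mult[symmetric]) simp_all
  moreover have "ennreal (2 / \<mu>) * (ennreal (4 * (t / r)\<^sup>2) * ennreal (pi * R\<^sup>2 * m)) = ennreal (32 * pi * R\<^sup>2 * (m / \<mu>) * (128 * m / \<mu>) ^ 4)"
  proof -
    have "t / r = 2 * (128 * m / \<mu>)\<^sup>2" using R by (simp add: t_def r_def)
    then have "(t / r)\<^sup>2 = 4 * (128 * m / \<mu>) ^ 4" by (simp only: power_mult_distrib power_mult[symmetric]) simp
    then have eq: "2 / \<mu> * (4 * (t / r)\<^sup>2 * (pi * R\<^sup>2 * m)) = 32 * pi * R\<^sup>2 * (m / \<mu>) * (128 * m / \<mu>) ^ 4"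
      by simp
    have "ennreal a * (ennreal b * ennreal c) = ennreal (a * (b * c))" if "0 \<le> a" "0 \<le> b" "0 \<le> c" for a b c
      using that by (simp add: ennreal_mult)
    then show ?thesis
      unfolding eq[symmetric] using \<mu>0 m by simp
  qed
  ultimately show ?thesis by (simp add: mult.assoc[symmetric])
qed

text \<open>For finite \<open>a\<close> above \<open>m\<close>, the last level
  \<open>2 ^ l * m\<close> below \<open>a\<close> satisfies \<open>a \<le> 2 ^ Suc l * m\<close>, so
  one layer suffices. For infinite \<open>a\<close> all layers are present and the series
  diverges.\<close>

lemma square_le_dyadic_layers:
  fixes a :: ennreal
  assumes "0 < m"
  shows "a\<^sup>2 \<le> ennreal (m\<^sup>2) + (\<Sum>i. ennreal (4 ^ Suc i * m\<^sup>2) * indicator {i. ennreal (2 ^ i * m) < a} i)"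
proof (cases "a \<le> ennreal m")
  case True
  then have "a\<^sup>2 \<le> (ennreal m)\<^sup>2" by (rule power_mono) simp
  then show ?thesis using assms by (simp add: ennreal_power add_increasing2)
next
  case False
  define J where "J = {i. ennreal (2 ^ i * m) < a}"
  have 0: "0 \<in> J" using False by (simp add: J_def)
  show ?thesis
  proof (cases a)
    case (real b)
    obtain n where n: "b < 2 ^ n * m"
    proof -
      obtain n where "b / m < 2 ^ n" using real_arch_pow[of 2 "b / m"] by auto
      then show ?thesis using that assms by (auto simp: field_simps)
    qed
    define i where "i = (LEAST n. n \<notin> J)"
    have "n \<notin> J" using n real by (auto simp: J_def ennreal_less_iff)
    then have i: "i \<notin> J"
      unfolding i_def by (rule LeastI)
    have i': "\<And>l. l < i \<Longrightarrow> l \<in> J"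
      unfolding i_def by (auto dest: not_less_Least)
    obtain l where l: "i = Suc l" using 0 i by (cases i) auto
    have "l \<in> J" using i'[of l] l by simp
    have "a \<le> ennreal (2 ^ i * m)" using i by (simp add: J_def)
    then have "a\<^sup>2 \<le> (ennreal (2 ^ i * m))\<^sup>2" by (rule power_mono) simp
    also have "\<dots> = ennreal ((2 ^ i * m)\<^sup>2)" using assms by (simp add: ennreal_power)
    also have "(2 ^ i * m)\<^sup>2 = 4 ^ Suc l * m\<^sup>2"
      unfolding l power_mult_distrib by (simp add: power_mult[symmetric] power2_eq_square flip: power_mult_distrib)
    also have "ennreal (4 ^ Suc l * m\<^sup>2) = (\<Sum>i\<in>{l}. ennreal (4 ^ Suc i * m\<^sup>2) * indicator J i)"
      using \<open>l \<in> J\<close> by simp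
    also have "\<dots> \<le> (\<Sum>i. ennreal (4 ^ Suc i * m\<^sup>2) * indicator J i)"
      by (rule sum_le_suminf) simp_all
    finally show ?thesis unfolding J_def by (simp add: add_increasing)
  next
    case top
    have "(\<Sum>i. ennreal (4 ^ Suc i * m\<^sup>2) * indicator {i. ennreal (2 ^ i * m) < a} i) = top"
    proof (rule ccontr)
      assume fin: "(\<Sum>i. ennreal (4 ^ Suc i * m\<^sup>2) * indicator {i. ennreal (2 ^ i * m) < a} i) \<noteq> top"
      then obtain b where b: "(\<Sum>i. ennreal (4 ^ Suc i * m\<^sup>2) * indicator {i. ennreal (2 ^ i * m) < a} i) = ennreal b" "0 \<le> b"
        by (cases "\<Sum>i. ennreal (4 ^ Suc i * m\<^sup>2) * indicator {i. ennreal (2 ^ i * m) < a} i") auto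
      obtain n where n: "b / m\<^sup>2 < 4 ^ n" using real_arch_pow[of 4 "b / m\<^sup>2"] by auto
      have "ennreal (4 ^ Suc n * m\<^sup>2) = (\<Sum>i\<in>{n}. ennreal (4 ^ Suc i * m\<^sup>2) * indicator {i. ennreal (2 ^ i * m) < a} i)"
        using top by simp
      also have "\<dots> \<le> ennreal b"
        unfolding b(1)[symmetric] by (rule sum_le_suminf) simp_all
      finally have "4 ^ Suc n * m\<^sup>2 \<le> b" using b assms by (simp add: ennreal_le_iff)
      moreover have "b < 4 ^ n * m\<^sup>2" using n assms by (simp add: field_simps)
      moreover have "0 < 4 ^ n * m\<^sup>2" using assms by simp
      ultimately show False by simp
    qed
    then show ?thesis by simp
  qed
qed

text \<open>The level sets at \<open>2 ^ i * M\<close> have measure of order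
  \<open>32 ^ (- i)\<close> by the fifth power decay, against the weight \<open>4 ^ i\<close>: a
  geometric series of ratio 1/8. The constant is \<open>6 * 256\<^sup>2\<close>.\<close>

lemma superharmonic1_L2:
  assumes g: "superharmonic1 U g" and R: "0 < R" "cball 0 R \<subseteq> U"
  shows "(\<integral>\<^sup>+z\<in>ball 0 (R / 8). (g z)\<^sup>2 \<partial>lborel) \<le> ennreal (393216 * pi * R\<^sup>2) * (g 0)\<^sup>2"
proof -
  have [measurable]: "g \<in> borel_measurable borel"
    using g by (auto simp: superharmonic1_def intro: lsc_borel_measurable)
  have B[measurable]: "ball (0::complex) (R / 8) \<in> sets borel" by simp
  have main: "(\<integral>\<^sup>+z\<in>ball 0 (R / 8). (g z)\<^sup>2 \<partial>lborel) \<le> ennreal (393216 * pi * R\<^sup>2 * m\<^sup>2)" if m: "0 < m" "g 0 \<le> ennreal m" for m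
  proof -
    define M where "M = 256 * m"
    have M: "0 < M" using m by (simp add: M_def)
    define S where "S i = {z \<in> ball 0 (R / 8). ennreal (2 ^ i * M) < g z}" for i :: nat
    have [measurable]: "S i \<in> sets borel" for i unfolding S_def by measurable
    have eS: "emeasure lborel (S i) \<le> ennreal (pi * R\<^sup>2 * (1 / 32) ^ i)" for i
    proof -
      have "256 * m * 1 \<le> 256 * m * 2 ^ i" using m by (intro mult_left_mono) auto
      then have "256 * m \<le> 2 ^ i * M" by (simp add: M_def mult_ac)
      from superharmonic1_superlevel[OF g R m this]
      have "emeasure lborel (S i) \<le> ennreal (32 * pi * R\<^sup>2 * (m / (2 ^ i * M)) * (128 * m / (2 ^ i * M)) ^ 4)"
        by (simp add: S_def)
      also have "32 * pi * R\<^sup>2 * (m / (2 ^ i * M)) * (128 * m / (2 ^ i * M)) ^ 4 = (1 / 128) * (pi * R\<^sup>2 * (1 / 32) ^ i)"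
      proof -
        have 1: "m / (2 ^ i * M) = (1 / 256) * (1 / 2) ^ i" "128 * m / (2 ^ i * M) = (1 / 2) * (1 / 2) ^ i"
          using m by (simp_all add: M_def power_one_over)
        have 2: "(1 / 2 :: real) ^ i * ((1 / 2) ^ i) ^ 4 = (1 / 32) ^ i"
        proof -
          have "((1 / 2 :: real) ^ i) ^ 4 = ((1 / 2) ^ 4) ^ i"
            by (metis power_mult mult.commute)
          then have "(1 / 2 :: real) ^ i * ((1 / 2) ^ i) ^ 4 = (1 / 2 * (1 / 2) ^ 4) ^ i"
            by (simp only: power_mult_distrib)
          moreover have "1 / 2 * (1 / 2) ^ 4 = (1 / 32 :: real)" by (simp add: eval_nat_numeral)
          ultimately show ?thesis by (simp only:)
        qed
        show ?thesis unfolding 1 power_mult_distrib 2[symmetric] by (simp add: power_divide)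
      qed
      also have "ennreal ((1 / 128) * (pi * R\<^sup>2 * (1 / 32) ^ i)) \<le> ennreal (pi * R\<^sup>2 * (1 / 32) ^ i)"
        by (rule ennreal_leI) simp
      finally show ?thesis .
    qed
    have "(\<integral>\<^sup>+z\<in>ball 0 (R / 8). (g z)\<^sup>2 \<partial>lborel) \<le> (\<integral>\<^sup>+z. ennreal (M\<^sup>2) * indicator (ball 0 (R / 8)) z + (\<Sum>i. ennreal (4 ^ Suc i * M\<^sup>2) * indicator (S i) z) \<partial>lborel)"
    proof (rule nn_integral_mono)
      fix z
      show "(g z)\<^sup>2 * indicator (ball 0 (R / 8)) z \<le> ennreal (M\<^sup>2) * indicator (ball 0 (R / 8)) z + (\<Sum>i. ennreal (4 ^ Suc i * M\<^sup>2) * indicator (S i) z)"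
      proof (cases "z \<in> ball 0 (R / 8)")
        case True
        then have "indicator (S i) z = (indicator {i. ennreal (2 ^ i * M) < g z} i :: ennreal)" for i
          by (simp add: S_def indicator_def)
        then show ?thesis using True square_le_dyadic_layers[OF M, of "g z"] by simp
      qed simp
    qed
    also have "\<dots> = ennreal (M\<^sup>2) * emeasure lborel (ball (0::complex) (R / 8)) + (\<integral>\<^sup>+z. (\<Sum>i. ennreal (4 ^ Suc i * M\<^sup>2) * indicator (S i) z) \<partial>lborel)"
      by (subst nn_integral_add) (measurable, simp add: nn_integral_cmult_indicator)
    also have "(\<integral>\<^sup>+z. (\<Sum>i. ennreal (4 ^ Suc i * M\<^sup>2) * indicator (S i) z) \<partial>lborel) = (\<Sum>i. ennreal (4 ^ Suc i * M\<^sup>2) * emeasure lborel (S i))"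
      by (subst nn_integral_suminf) (measurable, simp add: nn_integral_cmult_indicator)
    also have "\<dots> \<le> (\<Sum>i. ennreal (4 * M\<^sup>2 * (pi * R\<^sup>2) * (1 / 8) ^ i))"
    proof (rule suminf_le)
      fix i
      have "ennreal (4 ^ Suc i * M\<^sup>2) * emeasure lborel (S i) \<le> ennreal (4 ^ Suc i * M\<^sup>2) * ennreal (pi * R\<^sup>2 * (1 / 32) ^ i)"
        by (intro mult_left_mono eS) simp
      also have "\<dots> = ennreal (4 ^ Suc i * M\<^sup>2 * (pi * R\<^sup>2 * (1 / 32) ^ i))"
        by (rule ennreal_mult[symmetric]) simp_all
      also have "4 ^ Suc i * M\<^sup>2 * (pi * R\<^sup>2 * (1 / 32) ^ i) = 4 * M\<^sup>2 * (pi * R\<^sup>2) * (1 / 8) ^ i"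
      proof -
        have "(4::real) ^ i * (1 / 32) ^ i = (1 / 8) ^ i" unfolding power_mult_distrib[symmetric] by simp
        then show ?thesis by (simp add: mult_ac) 
      qed
      finally show "ennreal (4 ^ Suc i * M\<^sup>2) * emeasure lborel (S i) \<le> ennreal (4 * M\<^sup>2 * (pi * R\<^sup>2) * (1 / 8) ^ i)" .
    qed simp_all
    also have "\<dots> = ennreal (\<Sum>i. 4 * M\<^sup>2 * (pi * R\<^sup>2) * (1 / 8) ^ i)"
      by (rule suminf_ennreal2) (auto intro!: summable_mult summable_geometric)
    also have "(\<Sum>i. 4 * M\<^sup>2 * (pi * R\<^sup>2) * (1 / 8) ^ i) = 4 * M\<^sup>2 * (pi * R\<^sup>2) * (8 / 7)"
      by (subst suminf_mult) (auto simp: suminf_geometric summable_geometric)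
    also have "ennreal (M\<^sup>2) * emeasure lborel (ball (0::complex) (R / 8)) = ennreal (M\<^sup>2 * (pi * (R / 8)\<^sup>2))"
      using R by (simp add: emeasure_disc ennreal_mult)
    also have "\<dots> + ennreal (4 * M\<^sup>2 * (pi * R\<^sup>2) * (8 / 7)) = ennreal (M\<^sup>2 * (pi * (R / 8)\<^sup>2) + 4 * M\<^sup>2 * (pi * R\<^sup>2) * (8 / 7))"
      by (rule ennreal_plus[symmetric]) simp_all
    also have "\<dots> \<le> ennreal (393216 * pi * R\<^sup>2 * m\<^sup>2)"
    proof (rule ennreal_leI)
      have "M\<^sup>2 * (pi * (R / 8)\<^sup>2) + 4 * M\<^sup>2 * (pi * R\<^sup>2) * (8 / 7) = (1 / 64 + 32 / 7) * (65536 * (pi * R\<^sup>2 * m\<^sup>2))"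
        by (simp add: M_def power_mult_distrib power_divide algebra_simps)
      also have "\<dots> \<le> 6 * (65536 * (pi * R\<^sup>2 * m\<^sup>2))"
        by (rule mult_right_mono) simp_all
      finally show "M\<^sup>2 * (pi * (R / 8)\<^sup>2) + 4 * M\<^sup>2 * (pi * R\<^sup>2) * (8 / 7) \<le> 393216 * pi * R\<^sup>2 * m\<^sup>2"
        by simp
    qed
    finally show ?thesis by (simp add: add_left_mono)
  qed
  show ?thesis
  proof (cases "g 0")
    case (real a)
    \<comment> \<open>\<open>main\<close> needs a positive bound while \<open>g 0\<close> may be 0,
      so it is applied to \<open>a + e\<close> with \<open>e\<close> tending to 0.\<close>
    have lim: "((\<lambda>e. ennreal (393216 * pi * R\<^sup>2 * (a + e)\<^sup>2)) \<longlongrightarrow> ennreal (393216 * pi * R\<^sup>2 * (a + 0)\<^sup>2)) (at_right 0)"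
      by (intro tendsto_intros tendsto_ennrealI)
    have "(\<integral>\<^sup>+z\<in>ball 0 (R / 8). (g z)\<^sup>2 \<partial>lborel) \<le> ennreal (393216 * pi * R\<^sup>2 * (a + 0)\<^sup>2)"
    proof (rule tendsto_lowerbound[OF lim])
      show "\<forall>\<^sub>F e in at_right 0. (\<integral>\<^sup>+z\<in>ball 0 (R / 8). (g z)\<^sup>2 \<partial>lborel) \<le> ennreal (393216 * pi * R\<^sup>2 * (a + e)\<^sup>2)"
        by (rule eventually_mono[OF eventually_at_right_less[of 0]])
           (use real in \<open>intro main; simp add: ennreal_leI\<close>)
    qed simp
    then show ?thesis using real by (simp add: ennreal_mult ennreal_power)
  next
    case top
    then show ?thesis using R by (simp add: ennreal_mult_eq_top_iff power2_eq_square)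
  qed
qed

section \<open>Iterated integration over coordinate slices\<close>

definition slice_int :: "'n \<Rightarrow> (complex ^ 'n \<Rightarrow> ennreal) \<Rightarrow> complex ^ 'n \<Rightarrow> ennreal" where
  "slice_int j f x = (\<integral>\<^sup>+w. f (x + axis j (w - x $ j)) \<partial>lborel)"

lemma slice_int_shift:
  assumes [measurable]: "f \<in> borel_measurable borel"
  shows "slice_int j f x = (\<integral>\<^sup>+v. f (x + axis j v) \<partial>lborel)"
  using nn_integral_lborel_shift[where f = "\<lambda>w. f (x + axis j (w - x $ j))" and a = "x $ j"]
  by (simp add: slice_int_def)

lemma slice_int_measurable[measurable]:
  assumes [measurable]: "f \<in> borel_measurable borel"
  shows "slice_int j f \<in> borel_measurable borel"
  unfolding slice_int_def[abs_def] by measurable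

lemma foldr_slice_int_measurable[measurable]:
  assumes "f \<in> borel_measurable borel"
  shows "foldr slice_int js f \<in> borel_measurable borel"
  using assms by (induction js) (auto intro: slice_int_measurable)

lemma nth_add_axis: "(x + axis j v) $ l = (if l = j then x $ l + v else x $ l :: 'a::monoid_add)"
  by (simp add: axis_def)

text \<open>A slice integral is still a function of all coordinates, constant in the one integrated
  out. A weight \<open>q\<close> of integral 1 in each such coordinate makes the outer integral
  meaningful, so that \<open>lborel_disintegration\<close> serves as Fubini's theorem for
  \<open>complex ^ 'n\<close>.\<close>

lemma foldr_slice_int_fubini:
  fixes f :: "complex ^ 'n \<Rightarrow> ennreal" and q :: "complex \<Rightarrow> ennreal"
  assumes [measurable]: "f \<in> borel_measurable borel" "q \<in> borel_measurable borel"
    and q: "(\<integral>\<^sup>+v. q v \<partial>lborel) = 1" and js: "distinct js"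
  shows "(\<integral>\<^sup>+x. f x \<partial>lborel) = (\<integral>\<^sup>+y. (\<Prod>l\<in>set js. q (y $ l)) * foldr slice_int js f y \<partial>lborel)"
  using js
proof (induction js)
  case (Cons j js)
  define h where "h y = (\<Prod>l\<in>set js. q (y $ l)) * foldr slice_int js f y" for y
  have [measurable]: "h \<in> borel_measurable borel" unfolding h_def[abs_def] by measurable
  have "(\<integral>\<^sup>+x. f x \<partial>lborel) = (\<integral>\<^sup>+y. h y \<partial>lborel)"
    using Cons by (simp add: h_def)
  also have "\<dots> = (\<integral>\<^sup>+x. q (x $ j) * (\<integral>\<^sup>+v. h (x + axis j v) \<partial>lborel) \<partial>lborel)"
    by (subst lborel_disintegration[where f = h and q = q and e = "axis j"])
       (simp_all add: axis_uminus q)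
  also have "\<dots> = (\<integral>\<^sup>+y. (\<Prod>l\<in>set (j # js). q (y $ l)) * foldr slice_int (j # js) f y \<partial>lborel)"
  proof (rule nn_integral_cong)
    fix x :: "complex ^ 'n"
    have "(\<Prod>l\<in>set js. q ((x + axis j v) $ l)) = (\<Prod>l\<in>set js. q (x $ l))" for v
      using Cons.prems by (intro prod.cong) (auto simp: nth_add_axis simp del: vector_add_component)
    then have "(\<integral>\<^sup>+v. h (x + axis j v) \<partial>lborel) = (\<Prod>l\<in>set js. q (x $ l)) * slice_int j (foldr slice_int js f) x"
      unfolding h_def by (subst slice_int_shift) (simp_all add: nn_integral_cmult)
    then show "q (x $ j) * (\<integral>\<^sup>+v. h (x + axis j v) \<partial>lborel) = (\<Prod>l\<in>set (j # js). q (x $ l)) * foldr slice_int (j # js) f x"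
      using Cons.prems by (simp add: mult.assoc)
  qed
  finally show ?case .
qed simp

lemma foldr_slice_int_indep:
  "(\<And>l. l \<notin> set js \<Longrightarrow> x $ l = y $ l) \<Longrightarrow> foldr slice_int js f x = foldr slice_int js f y"
proof (induction js arbitrary: x y)
  case Nil
  then have "x = y" by (simp add: vec_eq_iff)
  then show ?case by simp
next
  case (Cons j js)
  have "foldr slice_int js f (x + axis j (w - x $ j)) = foldr slice_int js f (y + axis j (w - y $ j))" for w
    using Cons.prems by (intro Cons.IH) (auto simp: axis_def)
  then show ?case by (simp only: foldr_Cons o_apply slice_int_def[of j])
qed

lemma foldr_slice_int_factor:
  assumes [measurable]: "f \<in> borel_measurable borel" "h \<in> borel_measurable borel" and "j \<notin> set js"
  shows "foldr slice_int js (\<lambda>z. h (z $ j) * f z) y = h (y $ j) * foldr slice_int js f y"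
  using assms(3)
proof (induction js arbitrary: y)
  case (Cons l js)
  then have nth: "(y + axis l (w - y $ l)) $ j = y $ j" for w by (auto simp: axis_def)
  have IH: "foldr slice_int js (\<lambda>z. h (z $ j) * f z) x = h (x $ j) * foldr slice_int js f x" for x
    using Cons by simp
  have "foldr slice_int (l # js) (\<lambda>z. h (z $ j) * f z) y = (\<integral>\<^sup>+w. h (y $ j) * foldr slice_int js f (y + axis l (w - y $ l)) \<partial>lborel)"
    by (simp only: foldr_Cons o_apply slice_int_def[of l] IH nth)
  also have "\<dots> = h (y $ j) * foldr slice_int (l # js) f y"
    unfolding foldr_Cons o_apply slice_int_def[of l] by (rule nn_integral_cmult) measurable
  finally show ?case .
qed simp

text \<open>Each coordinate costs one application of the one-variable bound, centred at
  \<open>y\<close>. In the induction, coordinates outside \<open>js\<close> have already been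
  displaced; those in \<open>js\<close> still agree with \<open>\<xi>\<close>, so that the discs of
  integration are centred correctly.\<close>

lemma foldr_slice_int_L2:
  fixes G :: "complex ^ 'n \<Rightarrow> ennreal" and y \<xi> :: "complex ^ 'n"
  assumes G: "separately_superharmonic \<Omega> G" and R: "0 < R" and "distinct js"
    and "\<And>z :: complex ^ 'n. (\<And>l. l \<notin> set js \<Longrightarrow> z $ l = y $ l) \<Longrightarrow> (\<And>l. l \<in> set js \<Longrightarrow> norm (z $ l - y $ l) \<le> R) \<Longrightarrow> z \<in> \<Omega>"
    and "\<And>l. l \<in> set js \<Longrightarrow> y $ l = \<xi> $ l"
  shows "foldr slice_int js (\<lambda>z. (\<Prod>l\<in>set js. indicator (ball (\<xi> $ l) (R / 8)) (z $ l)) * (G z)\<^sup>2) y \<le>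
    ennreal (393216 * pi * R\<^sup>2) ^ length js * (G y)\<^sup>2"
  using assms(3-)
proof (induction js arbitrary: y)
  case (Cons j js)
  note Gm[measurable] = separately_superharmonic_measurable[OF G]
  let ?C = "ennreal (393216 * pi * R\<^sup>2)"
  have ball[measurable]: "ball (\<xi> $ l) (R / 8) \<in> sets borel" "ball (0::complex) (R / 8) \<in> sets borel" for l by simp_all
  define F where "F = (\<lambda>z::complex ^ 'n. (\<Prod>l\<in>set js. indicator (ball (\<xi> $ l) (R / 8)) (z $ l)) * (G z)\<^sup>2)"
  have F[measurable]: "F \<in> borel_measurable borel" unfolding F_def by measurable
  have split: "(\<lambda>z. (\<Prod>l\<in>set (j # js). indicator (ball (\<xi> $ l) (R / 8)) (z $ l)) * (G z)\<^sup>2) =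
      (\<lambda>z. indicator (ball (\<xi> $ j) (R / 8)) (z $ j) * F z)"
    using Cons.prems(1) by (simp add: F_def mult.assoc)
  have "foldr slice_int (j # js) (\<lambda>z. (\<Prod>l\<in>set (j # js). indicator (ball (\<xi> $ l) (R / 8)) (z $ l)) * (G z)\<^sup>2) y =
     slice_int j (\<lambda>x. indicator (ball (\<xi> $ j) (R / 8)) (x $ j) * foldr slice_int js F x) y"
  proof -
    have "foldr slice_int js (\<lambda>z. indicator (ball (\<xi> $ j) (R / 8)) (z $ j) * F z) =
      (\<lambda>x. indicator (ball (\<xi> $ j) (R / 8)) (x $ j) * foldr slice_int js F x)"
      using Cons.prems(1) by (intro ext foldr_slice_int_factor) simp_all
    then show ?thesis unfolding split by (simp only: foldr_Cons o_apply)
  qed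
  also have "\<dots> = (\<integral>\<^sup>+v. indicator (ball (\<xi> $ j) (R / 8)) ((y + axis j v) $ j) * foldr slice_int js F (y + axis j v) \<partial>lborel)"
    by (rule slice_int_shift) measurable
  also have "\<dots> \<le> (\<integral>\<^sup>+v. ?C ^ length js * ((G (y + axis j v))\<^sup>2 * indicator (ball 0 (R / 8)) v) \<partial>lborel)"
  proof (rule nn_integral_mono)
    fix v
    have yj: "y $ j = \<xi> $ j" using Cons.prems(3) by simp
    show "indicator (ball (\<xi> $ j) (R / 8)) ((y + axis j v) $ j) * foldr slice_int js F (y + axis j v) \<le>
        ?C ^ length js * ((G (y + axis j v))\<^sup>2 * indicator (ball 0 (R / 8)) v)"
    proof (cases "v \<in> ball 0 (R / 8)")
      case True
      have "foldr slice_int js F (y + axis j v) \<le> ?C ^ length js * (G (y + axis j v))\<^sup>2"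
        unfolding F_def
      proof (rule Cons.IH)
        show "distinct js" using Cons.prems(1) by simp
        show "(y + axis j v) $ l = \<xi> $ l" if "l \<in> set js" for l
          using that Cons.prems(1,3) by (auto simp: nth_add_axis simp del: vector_add_component)
        fix z :: "complex ^ 'n" assume z: "\<And>l. l \<notin> set js \<Longrightarrow> z $ l = (y + axis j v) $ l" "\<And>l. l \<in> set js \<Longrightarrow> norm (z $ l - (y + axis j v) $ l) \<le> R"
        show "z \<in> \<Omega>"
        proof (rule Cons.prems(2))
          fix l assume "l \<notin> set (j # js)"
          then show "z $ l = y $ l" using z(1)[of l] by (simp add: axis_def)
        next
          fix l assume "l \<in> set (j # js)"
          then consider "l = j" | "l \<in> set js" "l \<noteq> j" using Cons.prems(1) by auto
          then show "norm (z $ l - y $ l) \<le> R"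
          proof cases
            case 1
            then have "z $ l = y $ l + v" using z(1)[of l] Cons.prems(1) by (simp add: axis_def)
            then show ?thesis using True R by simp
          next
            case 2
            then show ?thesis using z(2)[of l] by (simp add: axis_def)
          qed
        qed
      qed
      then show ?thesis using True yj by (simp add: axis_def dist_norm)
    next
      case False
      then show ?thesis using yj by (simp add: axis_def dist_norm)
    qed
  qed
  also have "\<dots> = ?C ^ length js * (\<integral>\<^sup>+v\<in>ball 0 (R / 8). (G (y + axis j v))\<^sup>2 \<partial>lborel)"
    by (rule nn_integral_cmult) measurable
  also have "\<dots> \<le> ?C ^ length js * (?C * (G y)\<^sup>2)"
  proof (rule mult_left_mono)
    have "cball 0 R \<subseteq> {v. y + axis j v \<in> \<Omega>}"
      using Cons.prems(2)[of "y + axis j v" for v] R by (auto simp: axis_def)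
    from superharmonic1_L2[OF separately_superharmonic_slice[OF G] R this]
    show "(\<integral>\<^sup>+v\<in>ball 0 (R / 8). (G (y + axis j v))\<^sup>2 \<partial>lborel) \<le> ?C * (G y)\<^sup>2" by simp
  qed simp
  finally show ?case by (simp add: mult_ac)
qed simp

lemma separately_superharmonic_L2_local:
  assumes R: "0 < R"
  shows "\<exists>r>0. \<exists>C\<ge>0. r \<le> R \<and> (\<forall>\<Omega> (G :: complex ^ 'n \<Rightarrow> ennreal) \<xi>. separately_superharmonic \<Omega> G \<longrightarrow> cball \<xi> R \<subseteq> \<Omega> \<longrightarrow>
    (\<integral>\<^sup>+z\<in>ball \<xi> r. (G z)\<^sup>2 \<partial>lborel) \<le> ennreal C * (G \<xi>)\<^sup>2)"
proof -
  define M where "M = norm (\<chi> i::'n. (1::complex))"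
  have M: "1 \<le> M"
    using Finite_Cartesian_Product.norm_nth_le[of "\<chi> i::'n. (1::complex)"] by (simp add: M_def)
  \<comment> \<open>\<open>M\<close> is the norm of the all-ones vector, so the polydisc of radius
    \<open>S\<close> lies in the ball of radius \<open>R\<close>.\<close>
  define S where "S = R / M"
  have S: "0 < S" "S \<le> R" using R M by (simp_all add: S_def field_simps mult_left_le_one_le mult_le_cancel_left1)
  obtain js where js: "set js = (UNIV :: 'n set)" "distinct js"
    using finite_distinct_list[of "UNIV :: 'n set"] by auto
  define q :: "complex \<Rightarrow> ennreal" where "q = indicator (cbox 0 One)"
  have [measurable]: "q \<in> borel_measurable borel" unfolding q_def by simp
  have q1: "(\<integral>\<^sup>+v. q v \<partial>lborel) = 1" by (simp add: q_def)
  \<comment> \<open>Once all coordinates are integrated out, the slice integral is a constant, and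
    the outer integral contributes just this finite factor.\<close>
  define K where "K = (\<integral>\<^sup>+(y::complex ^ 'n). (\<Prod>l\<in>UNIV. q (y $ l)) \<partial>lborel)"
  have "K \<le> (\<integral>\<^sup>+(y::complex ^ 'n). indicator (cball 0 (2 * M)) y \<partial>lborel)"
    unfolding K_def
  proof (rule nn_integral_mono)
    fix y :: "complex ^ 'n"
    show "(\<Prod>l\<in>UNIV. q (y $ l)) \<le> indicator (cball 0 (2 * M)) y"
    proof (cases "\<forall>l. y $ l \<in> cbox 0 One")
      case True
      have "norm (y $ l) \<le> 2" for l
      proof -
        have "\<bar>Re (y $ l)\<bar> \<le> 1" "\<bar>Im (y $ l)\<bar> \<le> 1"
          using True by (auto simp: in_cbox_complex_iff Basis_complex_def)
        then show ?thesis using cmod_le[of "y $ l"] by linarith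
      qed
      then have "norm y \<le> 2 * norm (\<chi> i::'n. (1::complex))"
        by (intro norm_vec_le_scale) auto
      moreover have "(\<Prod>l\<in>UNIV. q (y $ l)) = 1" using True by (simp add: q_def)
      ultimately show ?thesis by (simp add: M_def)
    next
      case False
      then have "(\<Prod>l\<in>UNIV. q (y $ l)) = 0" by (intro prod_zero) (auto simp: q_def indicator_def)
      then show ?thesis by (simp only: zero_le)
    qed
  qed
  also have "\<dots> < top" using emeasure_lborel_cball_finite[of "0 :: complex ^ 'n" "2 * M"] by simp
  finally obtain k where k: "K = ennreal k" "0 \<le> k" by (cases K) auto
  define C where "C = k * (393216 * pi * S\<^sup>2) ^ length js"
  have "(\<integral>\<^sup>+z\<in>ball \<xi> (S / 8). (G z)\<^sup>2 \<partial>lborel) \<le> ennreal C * (G \<xi>)\<^sup>2"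
    if G: "separately_superharmonic \<Omega> G" and sub: "cball \<xi> R \<subseteq> \<Omega>" for \<Omega> and G :: "complex ^ 'n \<Rightarrow> ennreal" and \<xi>
  proof -
    note [measurable] = separately_superharmonic_measurable[OF G]
    have [measurable]: "ball (\<xi> $ l) (S / 8) \<in> sets borel" for l by simp
    define F where "F = (\<lambda>z::complex ^ 'n. (\<Prod>l\<in>set js. indicator (ball (\<xi> $ l) (S / 8)) (z $ l)) * (G z)\<^sup>2)"
    have F[measurable]: "F \<in> borel_measurable borel" unfolding F_def by measurable
    have "(\<integral>\<^sup>+z\<in>ball \<xi> (S / 8). (G z)\<^sup>2 \<partial>lborel) \<le> (\<integral>\<^sup>+z. F z \<partial>lborel)"
    proof (rule nn_integral_mono)
      fix z
      show "(G z)\<^sup>2 * indicator (ball \<xi> (S / 8)) z \<le> F z"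
      proof (cases "z \<in> ball \<xi> (S / 8)")
        case True
        then have "z $ l \<in> ball (\<xi> $ l) (S / 8)" for l
          using dist_vec_nth_le[of \<xi> l z] by simp
        then show ?thesis using True by (simp add: F_def)
      qed simp
    qed
    also have "\<dots> = (\<integral>\<^sup>+y. (\<Prod>l\<in>UNIV. q (y $ l)) * foldr slice_int js F y \<partial>lborel)"
      using foldr_slice_int_fubini[OF F _ q1 js(2)] js(1) by simp
    also have "\<dots> = (\<integral>\<^sup>+(y :: complex ^ 'n). (\<Prod>l\<in>UNIV. q (y $ l)) * foldr slice_int js F \<xi> \<partial>lborel)"
    proof -
      have eq: "foldr slice_int js F y = foldr slice_int js F \<xi>" for y
        by (rule foldr_slice_int_indep) (simp add: js)
      show ?thesis by (rule nn_integral_cong) (rule arg_cong[OF eq])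
    qed
    also have "\<dots> = K * foldr slice_int js F \<xi>"
      unfolding K_def by (rule nn_integral_multc) measurable
    also have "\<dots> \<le> K * (ennreal (393216 * pi * S\<^sup>2) ^ length js * (G \<xi>)\<^sup>2)"
      unfolding F_def
    proof (intro mult_left_mono foldr_slice_int_L2[OF G S(1) js(2)])
      fix z :: "complex ^ 'n" assume "\<And>l. l \<in> set js \<Longrightarrow> norm (z $ l - \<xi> $ l) \<le> S"
      then have "norm (z - \<xi>) \<le> S * norm (\<chi> i::'n. (1::complex))"
        using S(1) js by (intro norm_vec_le_scale) auto
      also have "\<dots> = R" using M by (simp add: S_def M_def[symmetric])
      finally show "z \<in> \<Omega>" using sub by (auto simp: dist_norm norm_minus_commute)
    qed simp_all
    also have "\<dots> = ennreal C * (G \<xi>)\<^sup>2"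
    proof -
      have "ennreal (k * b ^ n) = ennreal k * ennreal b ^ n" if "0 \<le> b" for b n
        using that k(2) by (simp add: ennreal_mult ennreal_power)
      from this[of "393216 * pi * S\<^sup>2" "length js"] show ?thesis
        by (simp add: C_def k(1) mult.assoc)
    qed
    finally show ?thesis .
  qed
  moreover have "0 \<le> C" using k by (simp add: C_def)
  ultimately show ?thesis using S
    by (intro exI[of _ "S / 8"] conjI exI[of _ C]) auto
qed

section \<open>Propagation along chains of overlapping balls\<close>

text \<open>Neighbourhoods on both sides, with a constant uniform in \<open>G\<close>, make the
  relation transitive and stable under moving either point slightly.\<close>

definition L2_controls :: "(complex ^ 'n) set \<Rightarrow> complex ^ 'n \<Rightarrow> complex ^ 'n \<Rightarrow> bool" where
  "L2_controls \<Omega> p q \<longleftrightarrow> (\<exists>U V C. open U \<and> open V \<and> p \<in> U \<and> q \<in> V \<and> (0::real) \<le> C \<and>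
     (\<forall>G. separately_superharmonic \<Omega> G \<longrightarrow> (\<forall>\<xi>\<in>U. (\<integral>\<^sup>+z\<in>V. (G z)\<^sup>2 \<partial>lborel) \<le> ennreal C * (G \<xi>)\<^sup>2)))"

lemma L2_controls_refl:
  assumes "open \<Omega>" "p \<in> \<Omega>"
  shows "L2_controls \<Omega> p p"
proof -
  obtain R where R: "0 < R" "cball p R \<subseteq> \<Omega>"
    using assms open_contains_cball by blast
  obtain r C where r: "0 < r" "0 \<le> C" "r \<le> R / 2" and
    L: "\<And>\<Omega> (G :: complex ^ 'a \<Rightarrow> ennreal) \<xi>. separately_superharmonic \<Omega> G \<Longrightarrow> cball \<xi> (R / 2) \<subseteq> \<Omega> \<Longrightarrow>
    (\<integral>\<^sup>+z\<in>ball \<xi> r. (G z)\<^sup>2 \<partial>lborel) \<le> ennreal C * (G \<xi>)\<^sup>2"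
    using separately_superharmonic_L2_local[of "R / 2", where 'n = 'a] R by auto
  have "(\<integral>\<^sup>+z\<in>ball p (r / 2). (G z)\<^sup>2 \<partial>lborel) \<le> ennreal C * (G \<xi>)\<^sup>2"
    if G: "separately_superharmonic \<Omega> G" and \<xi>: "\<xi> \<in> ball p (r / 2)" for G \<xi>
  proof -
    have "(\<integral>\<^sup>+z\<in>ball p (r / 2). (G z)\<^sup>2 \<partial>lborel) \<le> (\<integral>\<^sup>+z\<in>ball \<xi> r. (G z)\<^sup>2 \<partial>lborel)"
    proof (rule nn_integral_mono)
      fix z
      have "z \<in> ball \<xi> r" if "z \<in> ball p (r / 2)"
        using that \<xi> dist_triangle[of \<xi> z p] by (simp add: dist_commute)
      then show "(G z)\<^sup>2 * indicator (ball p (r / 2)) z \<le> (G z)\<^sup>2 * indicator (ball \<xi> r) z"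
        by (auto simp: indicator_def)
    qed
    also have "\<dots> \<le> ennreal C * (G \<xi>)\<^sup>2"
    proof (rule L[OF G])
      have "cball \<xi> (R / 2) \<subseteq> cball p R"
        using \<xi> r by (auto simp: cball_subset_cball_iff dist_commute)
      then show "cball \<xi> (R / 2) \<subseteq> \<Omega>" using R by blast
    qed
    finally show ?thesis .
  qed
  then show ?thesis
    unfolding L2_controls_def using r
    by (intro exI[of _ "ball p (r / 2)"] exI[of _ C]) auto
qed

text \<open>The second estimate holds at each point of a small ball \<open>W\<close> about
  \<open>q\<close> inside \<open>V \<inter> U'\<close>. Averaging it over \<open>W\<close> replaces
  the point value of \<open>G\<^sup>2\<close> by an integral over part of \<open>V\<close>, to which
  the first estimate applies.\<close>

lemma L2_controls_trans:
  assumes "L2_controls \<Omega> p q" "L2_controls \<Omega> q s"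
  shows "L2_controls \<Omega> p s"
proof -
  obtain U V C where 1: "open U" "open V" "p \<in> U" "q \<in> V" "0 \<le> C"
    and C: "\<And>G \<xi>. separately_superharmonic \<Omega> G \<Longrightarrow> \<xi> \<in> U \<Longrightarrow> (\<integral>\<^sup>+z\<in>V. (G z)\<^sup>2 \<partial>lborel) \<le> ennreal C * (G \<xi>)\<^sup>2"
    using assms(1) unfolding L2_controls_def by blast
  obtain U' V' C' where 2: "open U'" "open V'" "q \<in> U'" "s \<in> V'" "0 \<le> C'"
    and C': "\<And>G \<xi>. separately_superharmonic \<Omega> G \<Longrightarrow> \<xi> \<in> U' \<Longrightarrow> (\<integral>\<^sup>+z\<in>V'. (G z)\<^sup>2 \<partial>lborel) \<le> ennreal C' * (G \<xi>)\<^sup>2"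
    using assms(2) unfolding L2_controls_def by blast
  obtain e where e: "0 < e" "cball q e \<subseteq> V \<inter> U'"
    using 1 2 open_contains_cball[of "V \<inter> U'"] by (metis IntI open_Int)
  define W where "W = ball q e"
  have W: "W \<subseteq> V" "W \<subseteq> U'" using e ball_subset_cball[of q e] unfolding W_def by blast+
  have [measurable]: "W \<in> sets borel" by (simp add: W_def)
  define w where "w = measure lborel W"
  have w: "emeasure lborel W = ennreal w" "0 < w"
    using e emeasure_lborel_ball_finite[of q e]
    by (simp_all add: w_def W_def emeasure_eq_ennreal_measure content_ball_pos)
  have "(\<integral>\<^sup>+z\<in>V'. (G z)\<^sup>2 \<partial>lborel) \<le> ennreal (C' * C / w) * (G \<xi>)\<^sup>2"
    if G: "separately_superharmonic \<Omega> G" and \<xi>: "\<xi> \<in> U" for G \<xi>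
  proof -
    note [measurable] = separately_superharmonic_measurable[OF G]
    let ?I = "\<integral>\<^sup>+z\<in>V'. (G z)\<^sup>2 \<partial>lborel"
    have "?I * ennreal w = (\<integral>\<^sup>+\<eta>\<in>W. ?I \<partial>lborel)"
      by (simp add: nn_integral_cmult_indicator w)
    also have "\<dots> \<le> (\<integral>\<^sup>+\<eta>. ennreal C' * ((G \<eta>)\<^sup>2 * indicator W \<eta>) \<partial>lborel)"
      using C'[OF G] W by (intro nn_integral_mono) (auto simp: indicator_def)
    also have "\<dots> = ennreal C' * (\<integral>\<^sup>+\<eta>\<in>W. (G \<eta>)\<^sup>2 \<partial>lborel)"
      by (rule nn_integral_cmult) measurable
    also have "\<dots> \<le> ennreal C' * (\<integral>\<^sup>+\<eta>\<in>V. (G \<eta>)\<^sup>2 \<partial>lborel)"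
      using W by (intro mult_left_mono nn_integral_mono) (auto simp: indicator_def)
    also have "\<dots> \<le> ennreal C' * (ennreal C * (G \<xi>)\<^sup>2)"
      by (intro mult_left_mono C[OF G \<xi>]) simp
    finally have "ennreal (1 / w) * (?I * ennreal w) \<le> ennreal (1 / w) * (ennreal C' * (ennreal C * (G \<xi>)\<^sup>2))"
      by (rule mult_left_mono) simp
    moreover have "ennreal (1 / w) * (?I * ennreal w) = ?I"
    proof -
      have "ennreal (1 / w) * ennreal w = 1" using w by (subst ennreal_mult[symmetric]) simp_all
      then show ?thesis by (simp add: mult.commute[of ?I] mult.assoc[symmetric])
    qed
    moreover have "ennreal (1 / w) * (ennreal C' * (ennreal C * (G \<xi>)\<^sup>2)) = ennreal (C' * C / w) * (G \<xi>)\<^sup>2"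
    proof -
      have "ennreal (C' * C / w) = ennreal (1 / w) * (ennreal C' * ennreal C)"
        using 1 2 w by (simp add: ennreal_mult[symmetric])
      then show ?thesis by (simp only: mult.assoc)
    qed
    ultimately show ?thesis by simp
  qed
  moreover have "0 \<le> C' * C / w" using 1 2 w by simp
  ultimately show ?thesis
    unfolding L2_controls_def using 1 2 by blast
qed

text \<open>By transitivity and local control in both directions, the points controlled by
  \<open>p\<close> and those not controlled by it both form open sets.\<close>

lemma L2_controls_connected:
  assumes "open \<Omega>" "connected \<Omega>" "p \<in> \<Omega>" "q \<in> \<Omega>"
  shows "L2_controls \<Omega> p q"
proof (rule ccontr)
  assume not: "\<not> L2_controls \<Omega> p q"
  let ?A = "{x \<in> \<Omega>. L2_controls \<Omega> p x}" and ?B = "{x \<in> \<Omega>. \<not> L2_controls \<Omega> p x}"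
  have near: "\<exists>U V. open U \<and> open V \<and> x \<in> U \<and> x \<in> V \<and> (\<forall>y\<in>U. L2_controls \<Omega> y x) \<and> (\<forall>y\<in>V. L2_controls \<Omega> x y)" if "x \<in> \<Omega>" for x
    using L2_controls_refl[OF assms(1) that] unfolding L2_controls_def by blast
  have "open ?A"
    unfolding open_subopen[of ?A]
  proof
    fix x assume x: "x \<in> ?A"
    then obtain V where "open V" "x \<in> V" "\<forall>y\<in>V. L2_controls \<Omega> x y" using near[of x] by auto
    then show "\<exists>T. open T \<and> x \<in> T \<and> T \<subseteq> ?A"
      using x assms(1) by (intro exI[of _ "V \<inter> \<Omega>"]) (auto intro: L2_controls_trans)
  qed
  moreover have "open ?B"
    unfolding open_subopen[of ?B]
  proof
    fix x assume x: "x \<in> ?B"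
    then obtain U where "open U" "x \<in> U" "\<forall>y\<in>U. L2_controls \<Omega> y x" using near[of x] by auto
    then show "\<exists>T. open T \<and> x \<in> T \<and> T \<subseteq> ?B"
      using x assms(1) by (intro exI[of _ "U \<inter> \<Omega>"]) (auto intro: L2_controls_trans)
  qed
  moreover have "?A \<inter> ?B \<inter> \<Omega> = {}" "\<Omega> \<subseteq> ?A \<union> ?B" by auto
  moreover have "p \<in> ?A \<inter> \<Omega>" using assms L2_controls_refl by auto
  moreover have "q \<in> ?B \<inter> \<Omega>" using assms not by auto
  ultimately show False using assms(2) unfolding connected_def by blast
qed

text \<open>For fixed \<open>p\<close>, finitely many sets \<open>V q\<close> cover
  \<open>K'\<close>, and the intersection of the matching \<open>U q\<close> is a neighbourhood of
  \<open>p\<close>. Finitely many such neighbourhoods cover \<open>K\<close>; in both steps the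
  constants are added.\<close>

lemma separately_superharmonic_L2_compact:
  fixes K K' :: "(complex ^ 'n) set"
  assumes \<Omega>: "open \<Omega>" "connected \<Omega>" and K: "compact K" "K \<subseteq> \<Omega>" and K': "compact K'" "K' \<subseteq> \<Omega>"
  shows "\<exists>C\<ge>0. \<forall>G. separately_superharmonic \<Omega> G \<longrightarrow> (\<forall>\<xi>\<in>K. (\<integral>\<^sup>+z\<in>K'. (G z)\<^sup>2 \<partial>lborel) \<le> ennreal C * (G \<xi>)\<^sup>2)"
proof -
  have step: "\<exists>U C. open U \<and> p \<in> U \<and> 0 \<le> C \<and>
    (\<forall>G. separately_superharmonic \<Omega> G \<longrightarrow> (\<forall>\<xi>\<in>U. (\<integral>\<^sup>+z\<in>K'. (G z)\<^sup>2 \<partial>lborel) \<le> ennreal C * (G \<xi>)\<^sup>2))" if p: "p \<in> K" for p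
  proof -
    have "\<forall>q\<in>K'. \<exists>U V C. open U \<and> open V \<and> p \<in> U \<and> q \<in> V \<and> 0 \<le> C \<and>
     (\<forall>G. separately_superharmonic \<Omega> G \<longrightarrow> (\<forall>\<xi>\<in>U. (\<integral>\<^sup>+z\<in>V. (G z)\<^sup>2 \<partial>lborel) \<le> ennreal C * (G \<xi>)\<^sup>2))"
    proof
      fix q assume "q \<in> K'"
      then have "L2_controls \<Omega> p q" using L2_controls_connected[OF \<Omega>] p K(2) K'(2) by blast
      then show "\<exists>U V C. open U \<and> open V \<and> p \<in> U \<and> q \<in> V \<and> 0 \<le> C \<and>
     (\<forall>G. separately_superharmonic \<Omega> G \<longrightarrow> (\<forall>\<xi>\<in>U. (\<integral>\<^sup>+z\<in>V. (G z)\<^sup>2 \<partial>lborel) \<le> ennreal C * (G \<xi>)\<^sup>2))"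
        unfolding L2_controls_def .
    qed
    from bchoice[OF this] obtain U where "\<forall>q\<in>K'. \<exists>V C. open (U q) \<and> open V \<and> p \<in> U q \<and> q \<in> V \<and> 0 \<le> C \<and>
     (\<forall>G. separately_superharmonic \<Omega> G \<longrightarrow> (\<forall>\<xi>\<in>U q. (\<integral>\<^sup>+z\<in>V. (G z)\<^sup>2 \<partial>lborel) \<le> ennreal C * (G \<xi>)\<^sup>2))" by blast
    from bchoice[OF this] obtain V where "\<forall>q\<in>K'. \<exists>C. open (U q) \<and> open (V q) \<and> p \<in> U q \<and> q \<in> V q \<and> 0 \<le> C \<and>
     (\<forall>G. separately_superharmonic \<Omega> G \<longrightarrow> (\<forall>\<xi>\<in>U q. (\<integral>\<^sup>+z\<in>V q. (G z)\<^sup>2 \<partial>lborel) \<le> ennreal C * (G \<xi>)\<^sup>2))" by blast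
    from bchoice[OF this] obtain C where UV: "\<And>q. q \<in> K' \<Longrightarrow> open (U q) \<and> open (V q) \<and> p \<in> U q \<and> q \<in> V q \<and> (0::real) \<le> C q"
      and C: "\<And>q G \<xi>. q \<in> K' \<Longrightarrow> separately_superharmonic \<Omega> G \<Longrightarrow> \<xi> \<in> U q \<Longrightarrow> (\<integral>\<^sup>+z\<in>V q. (G z)\<^sup>2 \<partial>lborel) \<le> ennreal (C q) * (G \<xi>)\<^sup>2"
      by blast
    have cov: "K' \<subseteq> \<Union> (V ` K')" using UV by blast
    obtain D where D: "D \<subseteq> K'" "finite D" "K' \<subseteq> \<Union> (V ` D)"
      by (rule compactE_image[OF K'(1) _ cov]) (use UV in auto)
    have "(\<integral>\<^sup>+z\<in>K'. (G z)\<^sup>2 \<partial>lborel) \<le> ennreal (\<Sum>q\<in>D. C q) * (G \<xi>)\<^sup>2"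
      if G: "separately_superharmonic \<Omega> G" and \<xi>: "\<xi> \<in> (\<Inter>q\<in>D. U q)" for G \<xi>
    proof -
      note [measurable] = separately_superharmonic_measurable[OF G]
      have Vm: "V q \<in> sets borel" if "q \<in> D" for q using UV[of q] D(1) that by (auto intro: borel_open)
      have "(\<integral>\<^sup>+z\<in>K'. (G z)\<^sup>2 \<partial>lborel) \<le> (\<integral>\<^sup>+z. (\<Sum>q\<in>D. (G z)\<^sup>2 * indicator (V q) z) \<partial>lborel)"
      proof (rule nn_integral_mono)
        fix z
        show "(G z)\<^sup>2 * indicator K' z \<le> (\<Sum>q\<in>D. (G z)\<^sup>2 * indicator (V q) z)"
        proof (cases "z \<in> K'")
          case True
          then obtain q where q: "q \<in> D" "z \<in> V q" using D by auto
          then have "(G z)\<^sup>2 * indicator K' z = (G z)\<^sup>2 * indicator (V q) z" using True by simp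
          also have "\<dots> \<le> (\<Sum>q\<in>D. (G z)\<^sup>2 * indicator (V q) z)"
            using D q(1) by (intro member_le_sum) auto
          finally show ?thesis .
        qed simp
      qed
      also have "\<dots> = (\<Sum>q\<in>D. \<integral>\<^sup>+z\<in>V q. (G z)\<^sup>2 \<partial>lborel)"
      proof (rule nn_integral_sum)
        fix q assume "q \<in> D"
        then have [measurable]: "V q \<in> sets borel" by (rule Vm)
        show "(\<lambda>z. (G z)\<^sup>2 * indicator (V q) z) \<in> borel_measurable lborel" by measurable
      qed
      also have "\<dots> \<le> (\<Sum>q\<in>D. ennreal (C q) * (G \<xi>)\<^sup>2)"
        using D \<xi> by (intro sum_mono C[OF _ G]) auto
      also have "\<dots> = ennreal (\<Sum>q\<in>D. C q) * (G \<xi>)\<^sup>2"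
        using UV D by (subst sum_ennreal[symmetric]) (auto simp: sum_distrib_right)
      finally show ?thesis .
    qed
    moreover have "open (\<Inter>q\<in>D. U q)" using D UV by (intro open_INT) auto
    moreover have "p \<in> (\<Inter>q\<in>D. U q)" using D UV by auto
    moreover have "0 \<le> (\<Sum>q\<in>D. C q)" using D UV by (intro sum_nonneg) auto
    ultimately show ?thesis by blast
  qed
  then have "\<forall>p\<in>K. \<exists>U C. open U \<and> p \<in> U \<and> 0 \<le> C \<and>
    (\<forall>G. separately_superharmonic \<Omega> G \<longrightarrow> (\<forall>\<xi>\<in>U. (\<integral>\<^sup>+z\<in>K'. (G z)\<^sup>2 \<partial>lborel) \<le> ennreal C * (G \<xi>)\<^sup>2))" by blast
  from bchoice[OF this] obtain U where "\<forall>p\<in>K. \<exists>C. open (U p) \<and> p \<in> U p \<and> 0 \<le> C \<and>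
    (\<forall>G. separately_superharmonic \<Omega> G \<longrightarrow> (\<forall>\<xi>\<in>U p. (\<integral>\<^sup>+z\<in>K'. (G z)\<^sup>2 \<partial>lborel) \<le> ennreal C * (G \<xi>)\<^sup>2))" by blast
  from bchoice[OF this] obtain C where UV: "\<And>p. p \<in> K \<Longrightarrow> open (U p) \<and> p \<in> U p \<and> (0::real) \<le> C p"
    and C: "\<And>p G \<xi>. p \<in> K \<Longrightarrow> separately_superharmonic \<Omega> G \<Longrightarrow> \<xi> \<in> U p \<Longrightarrow> (\<integral>\<^sup>+z\<in>K'. (G z)\<^sup>2 \<partial>lborel) \<le> ennreal (C p) * (G \<xi>)\<^sup>2"
    by blast
  have cov: "K \<subseteq> \<Union> (U ` K)" using UV by blast
  obtain D where D: "D \<subseteq> K" "finite D" "K \<subseteq> \<Union> (U ` D)"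
    by (rule compactE_image[OF K(1) _ cov]) (use UV in auto)
  have "(\<integral>\<^sup>+z\<in>K'. (G z)\<^sup>2 \<partial>lborel) \<le> ennreal (\<Sum>p\<in>D. C p) * (G \<xi>)\<^sup>2"
    if G: "separately_superharmonic \<Omega> G" and \<xi>: "\<xi> \<in> K" for G \<xi>
  proof -
    obtain p where p: "p \<in> D" "\<xi> \<in> U p" using D \<xi> by auto
    then have "(\<integral>\<^sup>+z\<in>K'. (G z)\<^sup>2 \<partial>lborel) \<le> ennreal (C p) * (G \<xi>)\<^sup>2" using D by (intro C[OF _ G]) auto
    also have "\<dots> \<le> ennreal (\<Sum>p\<in>D. C p) * (G \<xi>)\<^sup>2"
      using D p UV by (intro mult_right_mono ennreal_leI member_le_sum) auto
    finally show ?thesis .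
  qed
  moreover have "0 \<le> (\<Sum>p\<in>D. C p)" using D UV by (intro sum_nonneg) auto
  ultimately show ?thesis by blast
qed

section \<open>Joint semicontinuity\<close>

text \<open>On \<open>\<Omega>\<close> nothing is lost by \<open>e2ennreal\<close> because
  \<open>F\<close> is negative there; the value 0 outside cannot violate lower semicontinuity of a
  non-negative function on an open set.\<close>

definition neg_ext :: "(complex ^ 'n) set \<Rightarrow> (complex ^ 'n \<Rightarrow> ereal) \<Rightarrow> complex ^ 'n \<Rightarrow> ennreal" where
  "neg_ext \<Omega> F x = (if x \<in> \<Omega> then e2ennreal (- F x) else 0)"

lemma replace_coord_eq: "replace_coord x j z = x + axis j (z - x $ j)"
  by (simp add: replace_coord_def axis_def vec_eq_iff)

lemma enn2ereal_neg_ext: "x \<in> \<Omega> \<Longrightarrow> F x < 0 \<Longrightarrow> enn2ereal (neg_ext \<Omega> F x) = - F x"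
  by (simp add: neg_ext_def enn2ereal_e2ennreal ereal_uminus_le_reorder less_imp_le)

text \<open>Since \<open>F\<close> is negative, the positive part in \<open>circle_mean\<close>
  vanishes and the negative part is an integral of \<open>neg_ext\<close>. Superharmonicity is first
  shown in the variable \<open>z\<close> of \<open>replace_coord\<close> and then translated by
  \<open>x $ j\<close>.\<close>

lemma neg_ext_slice_superharmonic1:
  fixes F :: "complex ^ 'n \<Rightarrow> ereal"
  assumes neg: "\<And>x. x \<in> \<Omega> \<Longrightarrow> F x < 0" and F: "separately_subharmonic_on \<Omega> F"
  shows "superharmonic1 {v. x + axis j v \<in> \<Omega>} (\<lambda>v. neg_ext \<Omega> F (x + axis j v))"
proof -
  let ?G = "neg_ext \<Omega> F"
  define U where "U = {z. replace_coord x j z \<in> \<Omega>}"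
  define u where "u z = F (replace_coord x j z)" for z
  have sub: "subharmonic_on U u"
    using F unfolding separately_subharmonic_on_def U_def u_def by blast
  then have U: "open U" and usc: "upper_semicontinuous_on U u"
    and mean: "\<And>z r. r > 0 \<Longrightarrow> cball z r \<subseteq> U \<Longrightarrow> u z \<le> circle_mean u z r"
    unfolding subharmonic_on_def by blast+
  define g where "g z = ?G (replace_coord x j z)" for z
  have gu: "enn2ereal (g z) = - u z" "u z < 0" if "z \<in> U" for z
    using that neg by (auto simp: g_def u_def U_def intro: enn2ereal_neg_ext)
  have g0: "g z = 0" if "z \<notin> U" for z
    using that by (simp add: g_def U_def neg_ext_def)
  have lsc_g: "lsc g"
    unfolding lsc_def
  proof
    fix c
    have "c < g z \<longleftrightarrow> z \<in> U \<and> u z < - enn2ereal c" for z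
    proof (cases "z \<in> U")
      case True
      have "c < g z \<longleftrightarrow> enn2ereal c < - u z" using gu[OF True] by (simp add: less_ennreal.rep_eq)
      also have "\<dots> \<longleftrightarrow> u z < - enn2ereal c" by (rule ereal_less_uminus_reorder)
      finally show ?thesis using True by simp
    qed (simp add: g0)
    then have "{z. c < g z} = {z \<in> U. u z < - enn2ereal c}" by auto
    moreover have "open {z \<in> U. u z < - enn2ereal c}"
      using usc U unfolding upper_semicontinuous_on_def by (metis openin_open_trans)
    ultimately show "open {z. c < g z}" by simp
  qed
  note [measurable] = lsc_borel_measurable[OF lsc_g]
  have mean_g: "cmean (\<lambda>w. g (z + w)) (of_real r) \<le> g z" if r: "0 < r" "cball z r \<subseteq> U" for z r
  proof -
    define m where "m = cmean (\<lambda>w. g (z + w)) (of_real r)"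
    have inU: "z + rcis r t \<in> U" for t
      using r by (intro subsetD[OF r(2)]) (simp add: dist_norm)
    have P: "(\<integral>\<^sup>+t\<in>{0..2*pi}. e2ennreal (u (z + rcis r t)) \<partial>lborel) = 0"
    proof -
      have "e2ennreal (u (z + rcis r t)) = 0" for t
        using gu(2)[OF inU[of t]] by (simp add: e2ennreal_neg less_imp_le)
      then show ?thesis by simp
    qed
    have [measurable]: "(\<lambda>t. rcis r t) \<in> borel_measurable borel"
      unfolding rcis_def by measurable
    have [simp]: "\<not> pi \<le> 0" using pi_gt_zero by linarith
    \<comment> \<open>The substitution of \<open>2 * pi * x\<close> for the angle turns the integral
      over \<open>{0..2*pi}\<close> into \<open>2 * pi\<close> times the mean for
      \<open>circle\<close>.\<close>
    have N: "(\<integral>\<^sup>+t\<in>{0..2*pi}. e2ennreal (- u (z + rcis r t)) \<partial>lborel) = ennreal (2 * pi) * m"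
    proof -
      have "e2ennreal (- u (z + rcis r t)) = g (z + rcis r t)" for t
        using gu(1)[OF inU[of t]] by (metis e2ennreal_enn2ereal)
      then have "(\<integral>\<^sup>+t\<in>{0..2*pi}. e2ennreal (- u (z + rcis r t)) \<partial>lborel) =
        (\<integral>\<^sup>+t. g (z + rcis r t) * indicator {0..2*pi} t \<partial>lborel)" by simp
      also have "\<dots> = ennreal (2 * pi) * (\<integral>\<^sup>+x. g (z + rcis r (0 + 2 * pi * x)) * indicator {0..2*pi} (0 + 2 * pi * x) \<partial>lborel)"
        by (subst nn_integral_real_affine[where c = "2 * pi" and t = 0]) simp_all
      also have "(\<integral>\<^sup>+x. g (z + rcis r (0 + 2 * pi * x)) * indicator {0..2*pi} (0 + 2 * pi * x) \<partial>lborel) =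
        (\<integral>\<^sup>+x. g (z + of_real r * cis (2 * pi * x)) * indicator {0..1} x \<partial>lborel)"
        by (intro nn_integral_cong) (auto simp: indicator_def rcis_def mult_le_cancel_left2 zero_le_mult_iff)
      also have "\<dots> = m"
        unfolding m_def cmean_def by (subst nn_integral_circle) simp_all
      finally show ?thesis .
    qed
    have "u z \<le> circle_mean u z r" by (rule mean[OF r])
    also have "\<dots> = (0 - enn2ereal (ennreal (2 * pi) * m)) / ereal (2 * pi)"
      unfolding circle_mean_def P N by (simp add: zero_ennreal.rep_eq)
    also have "enn2ereal (ennreal (2 * pi) * m) = ereal (2 * pi) * enn2ereal m"
      by (simp add: times_ennreal.rep_eq)
    also have "(0 - ereal (2 * pi) * enn2ereal m) / ereal (2 * pi) = - enn2ereal m"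
    proof (cases m)
      case (real a)
      then show ?thesis by (simp add: zero_ereal_def)
    next
      case top
      then show ?thesis by simp
    qed
    finally have "enn2ereal m \<le> - u z" using ereal_uminus_le_reorder[of "u z" "enn2ereal m"]
      by (metis ereal_minus_le_minus ereal_uminus_uminus)
    also have "- u z = enn2ereal (g z)"
      using gu(1)[of z] r by (simp add: subset_iff)
    finally show ?thesis unfolding m_def by (simp add: less_eq_ennreal.rep_eq)
  qed
  have "superharmonic1 U g"
    unfolding superharmonic1_def using U lsc_g mean_g by blast
  from superharmonic1_translate[OF this, of "x $ j"]
  show ?thesis by (simp add: U_def g_def replace_coord_eq add.commute)
qed

text \<open>Joint lower semicontinuity (Avanissian), by induction on the set of varying coordinates: the
  value at a point dominates the disc mean in the next coordinate, to which Fatou's lemma and the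
  induction hypothesis apply.\<close>

lemma neg_ext_le_liminf:
  fixes F :: "complex ^ 'n \<Rightarrow> ereal"
  assumes \<Omega>: "open \<Omega>" and neg: "\<And>x. x \<in> \<Omega> \<Longrightarrow> F x < 0" and F: "separately_subharmonic_on \<Omega> F"
    and S: "finite S"
  shows "\<And>X x. X \<longlonglongrightarrow> x \<Longrightarrow> (\<And>n i. i \<notin> S \<Longrightarrow> X n $ i = x $ i) \<Longrightarrow> neg_ext \<Omega> F x \<le> liminf (\<lambda>n. neg_ext \<Omega> F (X n))"
  using S
proof (induction S)
  case empty
  then have "X n = x" for n by (simp add: vec_eq_iff)
  then show ?case by (simp add: Liminf_const)
next
  case (insert j S)
  let ?G = "neg_ext \<Omega> F"
  note sh = neg_ext_slice_superharmonic1[OF neg F]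
  have sm: "(\<lambda>v. ?G (y + axis j v)) \<in> borel_measurable borel" for y
    using sh[of y j] by (auto simp: superharmonic1_def intro: lsc_borel_measurable)
  have sm': "(\<lambda>z. ?G (y + axis j (z - y $ j))) \<in> borel_measurable borel" for y
    by (rule measurable_compose[OF _ sm]) measurable
  show ?case
    unfolding le_Liminf_iff
  proof (intro allI impI)
    fix c0 assume "c0 < ?G x"
    then obtain c where c: "c0 < c" "c < ?G x" using dense by blast
    have "0 < ?G x" using c by (auto intro: le_less_trans)
    then have x: "x \<in> \<Omega>" by (auto simp: neg_ext_def split: if_splits)
    have "lsc (\<lambda>v. ?G (x + axis j v))" using sh[of x j] by (simp add: superharmonic1_def)
    then have "open {v. c < ?G (x + axis j v)}" by (simp add: lsc_def)
    moreover have "0 \<in> {v. c < ?G (x + axis j v)}" using c by simp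
    ultimately obtain r1 where r1: "0 < r1" "ball 0 r1 \<subseteq> {v. c < ?G (x + axis j v)}"
      using open_contains_ball by blast
    obtain r2 where r2: "0 < r2" "cball x r2 \<subseteq> \<Omega>" using \<Omega> x open_contains_cball by blast
    define r where "r = min r1 (r2 / 2)"
    have r: "0 < r" "r \<le> r1" "2 * r \<le> r2" using r1 r2 by (auto simp: r_def)
    obtain l where l: "c = ennreal l" "0 \<le> l" using c by (cases c) auto
    \<comment> \<open>When \<open>X n\<close> is within \<open>e\<close> of \<open>x\<close>, the
      disc of radius \<open>r\<close> about \<open>X n $ j\<close> contains the fixed disc of radius
      \<open>r - e\<close> about \<open>x $ j\<close>. Fatou's lemma is used on the fixed disc; the
      price is the ratio of the areas, which tends to 1 with \<open>e\<close>.\<close>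
    have step: "ennreal ((r - e)\<^sup>2 / r\<^sup>2 * l) \<le> liminf (\<lambda>n. ?G (X n))" if e: "0 < e" "e < r" for e
    proof -
      have ev: "\<forall>\<^sub>F n in sequentially. dist (X n) x < e"
        using insert.prems(1) e(1) by (simp add: tendstoD)
      let ?I = "\<lambda>n. \<integral>\<^sup>+z\<in>ball (x $ j) (r - e). ?G (X n + axis j (z - X n $ j)) \<partial>lborel"
      have B[measurable]: "ball (x $ j) (r - e) \<in> sets borel" by simp
      have 1: "\<forall>\<^sub>F n in sequentially. ?I n \<le> ennreal (pi * r\<^sup>2) * ?G (X n)"
        using ev
      proof eventually_elim
        case (elim n)
        have sub: "cball 0 r \<subseteq> {v. X n + axis j v \<in> \<Omega>}"
        proof
          fix v :: complex assume v: "v \<in> cball 0 r"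
          have "dist x (X n + axis j v) \<le> dist x (X n) + norm v"
            using dist_triangle[of x "X n + axis j v" "X n"] by (simp add: dist_norm norm_axis)
          also have "\<dots> \<le> r2" using v elim e r by (simp add: dist_commute)
          finally show "v \<in> {v. X n + axis j v \<in> \<Omega>}" using r2 by auto
        qed
        have "?I n \<le> (\<integral>\<^sup>+z. ?G (X n + axis j (z + (- X n $ j))) * indicator (ball 0 r) (z + (- X n $ j)) \<partial>lborel)"
        proof (rule nn_integral_mono)
          fix z
          have "z + (- X n $ j) \<in> ball 0 r" if "z \<in> ball (x $ j) (r - e)"
          proof -
            have "dist (X n $ j) (x $ j) < e" using dist_vec_nth_le[of "X n" j x] elim by simp
            then show ?thesis using that dist_triangle[of "X n $ j" z "x $ j"] by (simp add: dist_norm norm_minus_commute)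
          qed
          then show "?G (X n + axis j (z - X n $ j)) * indicator (ball (x $ j) (r - e)) z \<le>
            ?G (X n + axis j (z + (- X n $ j))) * indicator (ball 0 r) (z + (- X n $ j))"
            by (auto simp: indicator_def)
        qed
        also have "\<dots> = (\<integral>\<^sup>+v\<in>ball 0 r. ?G (X n + axis j v) \<partial>lborel)"
          by (rule nn_integral_lborel_shift[where f = "\<lambda>v. ?G (X n + axis j v) * indicator (ball 0 r) v"])
             (intro borel_measurable_times_ennreal sm borel_measurable_indicator, simp)
        also have "\<dots> \<le> ennreal (pi * r\<^sup>2) * ?G (X n + axis j 0)"
          by (rule disc_le_superharmonic1[OF sh sub r(1)])
        finally show ?case by simp
      qed
      have "c * ennreal (pi * (r - e)\<^sup>2) = (\<integral>\<^sup>+z\<in>ball (x $ j) (r - e). c \<partial>lborel)"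
        using e by (simp add: nn_integral_cmult_indicator emeasure_disc)
      also have "\<dots> \<le> (\<integral>\<^sup>+z. liminf (\<lambda>n. ?G (X n + axis j (z - X n $ j)) * indicator (ball (x $ j) (r - e)) z) \<partial>lborel)"
      proof (rule nn_integral_mono)
        fix z
        show "c * indicator (ball (x $ j) (r - e)) z \<le> liminf (\<lambda>n. ?G (X n + axis j (z - X n $ j)) * indicator (ball (x $ j) (r - e)) z)"
        proof (cases "z \<in> ball (x $ j) (r - e)")
          case True
          have "z - x $ j \<in> ball 0 r1" using True r e by (simp add: dist_norm norm_minus_commute)
          then have "c < ?G (x + axis j (z - x $ j))" using r1(2) by blast
          \<comment> \<open>The modified points and their limit all have \<open>j\<close>-th
            coordinate \<open>z\<close>, so they differ only in the coordinates of
            \<open>S\<close>.\<close>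
          also have "\<dots> \<le> liminf (\<lambda>n. ?G (X n + axis j (z - X n $ j)))"
          proof (rule insert.IH)
            show "(\<lambda>n. X n + axis j (z - X n $ j)) \<longlonglongrightarrow> x + axis j (z - x $ j)"
              by (intro tendsto_intros insert.prems(1) bounded_linear.tendsto[OF bounded_linear_axis])
            show "(X n + axis j (z - X n $ j)) $ i = (x + axis j (z - x $ j)) $ i" if "i \<notin> S" for n i
              using that insert.prems(2)[of i n] by (cases "i = j") (auto simp: axis_def)
          qed
          finally show ?thesis using True by simp
        qed simp
      qed
      also have "\<dots> \<le> liminf ?I"
        by (intro nn_integral_liminf borel_measurable_times_ennreal borel_measurable_indicator) (simp_all add: sm')
      finally have 2: "c * ennreal (pi * (r - e)\<^sup>2) \<le> liminf ?I" .
      show ?thesis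
        unfolding le_Liminf_iff
      proof (intro allI impI)
        fix d assume d: "d < ennreal ((r - e)\<^sup>2 / r\<^sup>2 * l)"
        then obtain d0 where d0: "d = ennreal d0" "0 \<le> d0" "d0 < (r - e)\<^sup>2 / r\<^sup>2 * l"
          by (cases d) (auto simp: ennreal_less_iff)
        have "pi * r\<^sup>2 * d0 < pi * r\<^sup>2 * ((r - e)\<^sup>2 / r\<^sup>2 * l)"
          using d0 r by (intro mult_strict_left_mono) auto
        also have "\<dots> = l * (pi * (r - e)\<^sup>2)" using r by simp
        finally have less: "pi * r\<^sup>2 * d0 < l * (pi * (r - e)\<^sup>2)" .
        have "0 \<le> pi * r\<^sup>2 * d0" using d0 by simp
        with less have "0 < l * (pi * (r - e)\<^sup>2)" by (rule le_less_trans[rotated])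
        with less have "ennreal (pi * r\<^sup>2 * d0) < ennreal (l * (pi * (r - e)\<^sup>2))"
          by (intro ennreal_lessI)
        then have "ennreal (pi * r\<^sup>2) * d < c * ennreal (pi * (r - e)\<^sup>2)"
          using d0 l by (simp add: ennreal_mult)
        also note 2
        finally have "\<forall>\<^sub>F n in sequentially. ennreal (pi * r\<^sup>2) * d < ?I n"
          by (rule less_LiminfD)
        then show "\<forall>\<^sub>F n in sequentially. d < ?G (X n)"
          using 1
        proof eventually_elim
          case (elim n)
          then have "ennreal (pi * r\<^sup>2) * d < ennreal (pi * r\<^sup>2) * ?G (X n)" by simp
          then show ?case by (meson linorder_not_le mult_left_mono zero_le)
        qed
      qed
    qed
    have "c \<le> liminf (\<lambda>n. ?G (X n))"
    proof (rule tendsto_upperbound)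
      have "((\<lambda>e. ennreal ((r - e)\<^sup>2 / r\<^sup>2 * l)) \<longlongrightarrow> ennreal ((r - 0)\<^sup>2 / r\<^sup>2 * l)) (at_right 0)"
        using r by (intro tendsto_intros tendsto_ennrealI) auto
      then show "((\<lambda>e. ennreal ((r - e)\<^sup>2 / r\<^sup>2 * l)) \<longlongrightarrow> c) (at_right 0)"
        using r l by simp
      have "\<forall>\<^sub>F e in at_right 0. e \<in> {0<..<r}"
        using r(1) by (rule eventually_at_right_real)
      then show "\<forall>\<^sub>F e in at_right 0. ennreal ((r - e)\<^sup>2 / r\<^sup>2 * l) \<le> liminf (\<lambda>n. ?G (X n))"
        by eventually_elim (use step in auto)
    qed simp
    then have "c0 < liminf (\<lambda>n. ?G (X n))" using c by simp
    then show "\<forall>\<^sub>F n in sequentially. c0 < ?G (X n)"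
      by (rule less_LiminfD)
  qed
qed

lemma separately_superharmonic_neg_ext:
  fixes F :: "complex ^ 'n \<Rightarrow> ereal"
  assumes \<Omega>: "open \<Omega>" and neg: "\<And>x. x \<in> \<Omega> \<Longrightarrow> F x < 0" and F: "separately_subharmonic_on \<Omega> F"
  shows "separately_superharmonic \<Omega> (neg_ext \<Omega> F)"
  unfolding separately_superharmonic_def
proof (intro conjI allI impI)
  show "lsc (neg_ext \<Omega> F)"
    by (rule lscI_sequentially) (rule neg_ext_le_liminf[OF \<Omega> neg F, of UNIV], simp_all)
  fix x :: "complex ^ 'n" and j and r :: real
  assume r: "0 < r" "\<forall>v. norm v \<le> r \<longrightarrow> x + axis j v \<in> \<Omega>"
  have "cball 0 r \<subseteq> {v. x + axis j v \<in> \<Omega>}" using r by auto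
  then have "cmean (\<lambda>w. neg_ext \<Omega> F (x + axis j (0 + w))) (of_real r) \<le> neg_ext \<Omega> F (x + axis j 0)"
    using neg_ext_slice_superharmonic1[OF neg F, of x j] r(1) unfolding superharmonic1_def by blast
  then show "cmean (\<lambda>v. neg_ext \<Omega> F (x + axis j v)) (complex_of_real r) \<le> neg_ext \<Omega> F x" by simp
qed (rule \<Omega>)

section \<open>The main theorem\<close>

lemma neg_ext_lipschitz_transfer:
  fixes F :: "complex ^ 'n \<Rightarrow> ereal"
  assumes F: "F x < 0" "F y < 0" and \<Omega>: "x \<in> \<Omega>" "y \<in> \<Omega>"
    and fin: "neg_ext \<Omega> F x < top" "neg_ext \<Omega> F y < top" and a: "0 \<le> a"
    and le: "neg_ext \<Omega> F x \<le> neg_ext \<Omega> F y + ennreal a" "neg_ext \<Omega> F y \<le> neg_ext \<Omega> F x + ennreal a"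
  shows "\<bar>F x\<bar> \<noteq> \<infinity>" "\<bar>real_of_ereal (F x) - real_of_ereal (F y)\<bar> \<le> a"
proof -
  obtain p q where pq: "neg_ext \<Omega> F x = ennreal p" "0 \<le> p" "neg_ext \<Omega> F y = ennreal q" "0 \<le> q"
    using fin by (metis ennreal_cases less_irrefl)
  have "- F x = ereal p" "- F y = ereal q"
    using enn2ereal_neg_ext[of x \<Omega> F] enn2ereal_neg_ext[of y \<Omega> F] F \<Omega> pq by simp_all
  then have F': "F x = ereal (- p)" "F y = ereal (- q)"
    by (metis ereal_uminus_uminus uminus_ereal.simps(1))+
  show "\<bar>F x\<bar> \<noteq> \<infinity>" by (simp add: F')
  have "p \<le> q + a" "q \<le> p + a"
    using le pq a by (simp_all flip: ennreal_plus)
  then show "\<bar>real_of_ereal (F x) - real_of_ereal (F y)\<bar> \<le> a"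
    by (simp add: F' abs_le_iff)
qed

lemma superlevel_L2_bound:
  fixes f :: "complex ^ 'n \<Rightarrow> ennreal"
  assumes [measurable]: "f \<in> borel_measurable borel" "A \<in> sets borel" and b: "0 < b"
  shows "emeasure lborel {x \<in> A. ennreal b < f x} \<le> ennreal (1 / b\<^sup>2) * (\<integral>\<^sup>+x\<in>A. (f x)\<^sup>2 \<partial>lborel)"
proof -
  let ?S = "{x \<in> A. ennreal b < f x}"
  have S: "?S \<in> sets borel" by measurable
  have "ennreal (b\<^sup>2) * emeasure lborel ?S = (\<integral>\<^sup>+x. ennreal (b\<^sup>2) * indicator ?S x \<partial>lborel)"
    using S by (simp add: nn_integral_cmult_indicator)
  also have "\<dots> \<le> (\<integral>\<^sup>+x\<in>A. (f x)\<^sup>2 \<partial>lborel)"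
  proof (rule nn_integral_mono)
    fix x
    have "ennreal (b\<^sup>2) \<le> (f x)\<^sup>2" if "ennreal b < f x"
      using power_mono[of "ennreal b" "f x" 2] that b by (simp add: ennreal_power)
    then show "ennreal (b\<^sup>2) * indicator ?S x \<le> (f x)\<^sup>2 * indicator A x"
      by (auto simp: indicator_def)
  qed
  finally have "ennreal (1 / b\<^sup>2) * (ennreal (b\<^sup>2) * emeasure lborel ?S) \<le> ennreal (1 / b\<^sup>2) * (\<integral>\<^sup>+x\<in>A. (f x)\<^sup>2 \<partial>lborel)"
    by (rule mult_left_mono) simp
  moreover have "ennreal (1 / b\<^sup>2) * ennreal (b\<^sup>2) = 1"
    using b by (subst ennreal_mult[symmetric]) simp_all
  ultimately show ?thesis by (simp add: mult.assoc[symmetric])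
qed

lemma kdiff_sum_bad_set:
  fixes G :: "complex ^ 'n \<Rightarrow> ennreal"
  assumes G: "separately_superharmonic \<Omega> G" and \<rho>: "0 < \<rho>" and c: "cball c (10 * \<rho>) \<subseteq> \<Omega>" "cball c (5 * \<rho>) \<subseteq> K"
    and k: "0 < k"
  shows "emeasure lborel {x \<in> ball c (\<rho> / 2). ennreal k < kdiff_sum \<rho> (stage idx j) j G x} \<le>
    ennreal (995328 / \<rho>\<^sup>2 / k\<^sup>2) * (\<integral>\<^sup>+x\<in>K. (G x)\<^sup>2 \<partial>lborel)"
proof -
  let ?S = "{x \<in> ball c (\<rho> / 2). ennreal k < kdiff_sum \<rho> (stage idx j) j G x}"
  have "emeasure lborel ?S * ennreal (k\<^sup>2) \<le> ennreal (995328 / \<rho>\<^sup>2) * (\<integral>\<^sup>+x\<in>cball c (5 * \<rho>). (G x)\<^sup>2 \<partial>lborel)"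
    by (rule kdiff_sum_weak_bound[OF G \<rho> c(1) _ _ _ k]) (auto simp: stage_def)
  also have "\<dots> \<le> ennreal (995328 / \<rho>\<^sup>2) * (\<integral>\<^sup>+x\<in>K. (G x)\<^sup>2 \<partial>lborel)"
    using c(2) by (intro mult_left_mono nn_integral_mono) (auto simp: indicator_def)
  finally have "ennreal (1 / k\<^sup>2) * (emeasure lborel ?S * ennreal (k\<^sup>2)) \<le> ennreal (1 / k\<^sup>2) * (ennreal (995328 / \<rho>\<^sup>2) * (\<integral>\<^sup>+x\<in>K. (G x)\<^sup>2 \<partial>lborel))"
    by (rule mult_left_mono) simp
  also have "\<dots> = ennreal (995328 / \<rho>\<^sup>2 / k\<^sup>2) * (\<integral>\<^sup>+x\<in>K. (G x)\<^sup>2 \<partial>lborel)"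
    unfolding mult.assoc[symmetric] by (subst ennreal_mult[symmetric]) (simp_all add: mult.commute)
  also have "ennreal (1 / k\<^sup>2) * (emeasure lborel ?S * ennreal (k\<^sup>2)) = emeasure lborel ?S"
  proof -
    have "ennreal (1 / k\<^sup>2) * ennreal (k\<^sup>2) = 1"
      using k by (subst ennreal_mult[symmetric]) simp_all
    then have "emeasure lborel ?S * (ennreal (1 / k\<^sup>2) * ennreal (k\<^sup>2)) = emeasure lborel ?S" by (simp only: mult_1_right)
    then show ?thesis by (simp only: mult_ac)
  qed
  finally show ?thesis .
qed

text \<open>On the good set \<open>E\<close> each \<open>kdiff_sum\<close> is at most
  \<open>k / A\<close> and \<open>G\<close> is at most \<open>k * \<rho>\<close>. The first bound
  handles points at distance at most \<open>\<rho>\<close>; the second handles the others, for which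
  \<open>G x \<le> k * \<rho> \<le> k * dist x y\<close>. The exceptional set is covered by one bad
  set for each coordinate and each ball of a finite cover of \<open>K\<close>, together with a
  superlevel set of \<open>G\<close>.\<close>

lemma superharmonic_lipschitz_off_small_set:
  fixes \<omega> K :: "(complex ^ 'n) set"
  assumes \<omega>: "open \<omega>" and K: "compact K" "\<omega> \<subseteq> K" and \<rho>: "0 < \<rho>" and sub: "\<And>x. x \<in> K \<Longrightarrow> cball x (10 * \<rho>) \<subseteq> \<Omega>"
    and K': "compact K'" "\<And>x. x \<in> K \<Longrightarrow> cball x (5 * \<rho>) \<subseteq> K'"
  shows "\<exists>C\<ge>0. \<forall>(G :: complex ^ 'n \<Rightarrow> ennreal) k. separately_superharmonic \<Omega> G \<longrightarrow> 0 < k \<longrightarrow>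
    (\<exists>E. E \<in> sets borel \<and> E \<subseteq> \<omega> \<and>
      emeasure lborel (\<omega> - E) \<le> ennreal (C / k\<^sup>2) * (\<integral>\<^sup>+x\<in>K'. (G x)\<^sup>2 \<partial>lborel) \<and>
      (\<forall>x\<in>E. G x < top) \<and>
      (\<forall>x\<in>E. \<forall>y\<in>E. G x \<le> G y + ennreal (k * dist x y)))"
proof -
  obtain idx :: "'n \<Rightarrow> nat" where idx: "bij_betw idx UNIV {..<CARD('n)}"
    using ex_bij_betw_finite_nat[of "UNIV :: 'n set"] by (auto simp: atLeast0LessThan)
  obtain KL where KL: "0 \<le> KL" and lip: "\<And>\<Omega> (G :: complex ^ 'n \<Rightarrow> ennreal) x y. separately_superharmonic \<Omega> G \<Longrightarrow> cball x (3 * \<rho>) \<subseteq> \<Omega> \<Longrightarrow> dist x y \<le> \<rho> \<Longrightarrow>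
    G x \<le> G y + ennreal (KL * dist x y) *
      ((\<Sum>j\<in>UNIV. kdiff_sum \<rho> (stage idx j) j G x) + (\<integral>\<^sup>+z\<in>cball x \<rho>. G z \<partial>lborel))"
    using lipschitz_by_kdiff_sum[OF \<rho> idx] by blast
  have cov: "K \<subseteq> \<Union> ((\<lambda>c. ball c (\<rho> / 2)) ` K)" using \<rho> by force
  obtain D where D: "D \<subseteq> K" "finite D" "K \<subseteq> \<Union> ((\<lambda>c. ball c (\<rho> / 2)) ` D)"
    by (rule compactE_image[OF K(1) _ cov]) auto
  define N where "N = real CARD('n)"
  have N: "0 < N" by (simp add: N_def)
  define m where "m = measure lborel K'"
  have m: "emeasure lborel K' = ennreal m" "0 \<le> m"
    using emeasure_compact_finite[OF K'(1)] by (simp_all add: m_def emeasure_eq_ennreal_measure)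
  \<comment> \<open>With these choices the sum over the coordinates and the ball integral are each
    at most \<open>k / B\<close>, so the Lipschitz factor is at most
    \<open>KL * (2 * k / B) = KL * k / (KL + 1)\<close>, which is at most \<open>k\<close>.\<close>
  define A where "A = 2 * N * (KL + 1)"
  define B where "B = 2 * (KL + 1)"
  have AB: "0 < A" "0 < B" using N KL by (simp_all add: A_def B_def)
  \<comment> \<open>The summands pay for the bad sets of the dyadic sums, for the superlevel set of
    \<open>G\<close>, and for the case in which \<open>E\<close> is empty.\<close>
  define C where "C = real (card D) * N * (995328 / \<rho>\<^sup>2 * A\<^sup>2) + 1 / \<rho>\<^sup>2 + m\<^sup>2 * B\<^sup>2"
  have C: "0 \<le> C" using N by (simp add: C_def)
  have K'm[measurable]: "K' \<in> sets borel" using K'(1) by (simp add: compact_imp_closed)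
  have KK': "K \<subseteq> K'" using K'(2) \<rho> by force
  have \<omega>m[measurable]: "\<omega> \<in> sets borel" using \<omega> by simp
  have "\<exists>E. E \<in> sets borel \<and> E \<subseteq> \<omega> \<and>
      emeasure lborel (\<omega> - E) \<le> ennreal (C / k\<^sup>2) * (\<integral>\<^sup>+x\<in>K'. (G x)\<^sup>2 \<partial>lborel) \<and>
      (\<forall>x\<in>E. G x < top) \<and> (\<forall>x\<in>E. \<forall>y\<in>E. G x \<le> G y + ennreal (k * dist x y))"
    if G: "separately_superharmonic \<Omega> G" and k: "0 < k" for G :: "complex ^ 'n \<Rightarrow> ennreal" and k
  proof -
    note [measurable] = separately_superharmonic_measurable[OF G]
    define I2 where "I2 = (\<integral>\<^sup>+x\<in>K'. (G x)\<^sup>2 \<partial>lborel)"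
    define I1 where "I1 = (\<integral>\<^sup>+x\<in>K'. G x \<partial>lborel)"
    show ?thesis
    proof (cases "I1 \<le> ennreal (k / B)")
      case False
      \<comment> \<open>If the integral of \<open>G\<close> over \<open>K'\<close> exceeds
        \<open>k / B\<close>, Cauchy-Schwarz makes the allowed measure at least that of
        \<open>K'\<close>, and the empty set serves as \<open>E\<close>.\<close>
      have CS: "I1\<^sup>2 \<le> ennreal m * I2"
      proof -
        have "(\<integral>\<^sup>+x. indicator K' x * (G x * indicator K' x) \<partial>lborel)\<^sup>2 \<le>
          (\<integral>\<^sup>+x. (indicator K' x)\<^sup>2 \<partial>lborel) * (\<integral>\<^sup>+x. (G x * indicator K' x)\<^sup>2 \<partial>lborel)"
          by (rule Cauchy_Schwarz_nn_integral) measurable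
        moreover have "indicator K' x * (G x * indicator K' x) = G x * indicator K' x" for x
          by (simp add: indicator_def)
        moreover have "(indicator K' x)\<^sup>2 = (indicator K' x :: ennreal)" "(G x * indicator K' x)\<^sup>2 = (G x)\<^sup>2 * indicator K' x" for x
          by (simp_all add: indicator_def)
        ultimately show ?thesis by (simp add: I1_def I2_def m)
      qed
      have "(ennreal (k / B))\<^sup>2 \<le> I1\<^sup>2" using False by (intro power_mono) auto
      also note CS
      finally have "ennreal (m * (B / k)\<^sup>2) * (ennreal (k / B))\<^sup>2 \<le> ennreal (m * (B / k)\<^sup>2) * (ennreal m * I2)"
        by (rule mult_left_mono) simp
      moreover have "ennreal (m * (B / k)\<^sup>2) * (ennreal (k / B))\<^sup>2 = ennreal m"
        using m AB k by (simp add: ennreal_power ennreal_mult[symmetric] power_divide)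
      moreover have "ennreal (m * (B / k)\<^sup>2) * (ennreal m * I2) \<le> ennreal (C / k\<^sup>2) * I2"
      proof -
        have "m * (B / k)\<^sup>2 * m = (m\<^sup>2 * B\<^sup>2) / k\<^sup>2" by (simp add: power_divide power2_eq_square)
        also have "\<dots> \<le> C / k\<^sup>2" using N by (intro divide_right_mono) (simp_all add: C_def)
        finally have "ennreal (m * (B / k)\<^sup>2 * m) \<le> ennreal (C / k\<^sup>2)" by (rule ennreal_leI)
        then have "ennreal (m * (B / k)\<^sup>2 * m) * I2 \<le> ennreal (C / k\<^sup>2) * I2" by (rule mult_right_mono) simp
        then show ?thesis using m(2) by (simp only: mult.assoc[symmetric] ennreal_mult[symmetric] zero_le_power2 zero_le_mult_iff) (simp add: ennreal_mult[symmetric] mult.assoc[symmetric])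
      qed
      ultimately have "ennreal m \<le> ennreal (C / k\<^sup>2) * I2" by simp
      moreover have "emeasure lborel (\<omega> - {}) \<le> ennreal m"
        unfolding m(1)[symmetric] using K(2) KK' by (intro emeasure_mono) auto
      ultimately show ?thesis unfolding I2_def by (intro exI[of _ "{}"]) auto
    next
      case I1: True
      let ?T = "\<lambda>j. kdiff_sum \<rho> (stage idx j) j G"
      have Tm[measurable]: "?T j \<in> borel_measurable borel" for j by measurable
      define E where "E = {x \<in> \<omega>. (\<forall>j. ?T j x \<le> ennreal (k / A)) \<and> G x \<le> ennreal (k * \<rho>)}"
      have E: "E \<in> sets borel" unfolding E_def by measurable
      define Z where "Z c j = {x \<in> ball c (\<rho> / 2). ennreal (k / A) < ?T j x}" for c j
      have Zm: "Z c j \<in> sets borel" for c j unfolding Z_def by measurable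
      define Y where "Y = {x \<in> K'. ennreal (k * \<rho>) < G x}"
      have Ym: "Y \<in> sets borel" unfolding Y_def by measurable
      have "emeasure lborel (\<omega> - E) \<le> emeasure lborel ((\<Union>(c, j)\<in>D \<times> UNIV. Z c j) \<union> Y)"
      proof (rule emeasure_mono)
        show "\<omega> - E \<subseteq> (\<Union>(c, j)\<in>D \<times> UNIV. Z c j) \<union> Y"
        proof
          fix x assume x: "x \<in> \<omega> - E"
          then have xK: "x \<in> K" using K(2) by auto
          then obtain c where c: "c \<in> D" "x \<in> ball c (\<rho> / 2)" using D by auto
          show "x \<in> (\<Union>(c, j)\<in>D \<times> UNIV. Z c j) \<union> Y"
          proof (cases "G x \<le> ennreal (k * \<rho>)")
            case True
            then obtain j where "\<not> ?T j x \<le> ennreal (k / A)" using x by (auto simp: E_def)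
            then have "x \<in> Z c j" using c by (simp add: Z_def)
            then show ?thesis using c by auto
          next
            case False
            then show ?thesis using xK KK' by (auto simp: Y_def)
          qed
        qed
        show "(\<Union>(c, j)\<in>D \<times> UNIV. Z c j) \<union> Y \<in> sets lborel"
          using Zm Ym D(2) by (auto intro!: sets.Un sets.finite_UN)
      qed
      also have "\<dots> \<le> emeasure lborel (\<Union>(c, j)\<in>D \<times> UNIV. Z c j) + emeasure lborel Y"
        using Zm Ym D(2) by (intro emeasure_subadditive) (auto intro!: sets.finite_UN)
      also have "\<dots> \<le> (\<Sum>(c, j)\<in>D \<times> UNIV. emeasure lborel (Z c j)) + emeasure lborel Y"
      proof (intro add_right_mono)
        have "emeasure lborel (\<Union>p\<in>D \<times> UNIV. Z (fst p) (snd p)) \<le> (\<Sum>p\<in>D \<times> UNIV. emeasure lborel (Z (fst p) (snd p)))"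
          using Zm D(2) by (intro emeasure_subadditive_finite) auto
        then show "emeasure lborel (\<Union>(c, j)\<in>D \<times> UNIV. Z c j) \<le> (\<Sum>(c, j)\<in>D \<times> UNIV. emeasure lborel (Z c j))"
          by (simp add: case_prod_beta')
      qed
      also have "\<dots> \<le> (\<Sum>(c, j)\<in>D \<times> (UNIV :: 'n set). ennreal (995328 / \<rho>\<^sup>2 / (k / A)\<^sup>2) * I2) + ennreal (1 / (k * \<rho>)\<^sup>2) * I2"
      proof (intro add_mono sum_mono)
        fix p assume "p \<in> D \<times> (UNIV :: 'n set)"
        then obtain c j where p: "p = (c, j)" "c \<in> D" by auto
        have cK: "c \<in> K" using p D(1) by auto
        have "emeasure lborel (Z c j) \<le> ennreal (995328 / \<rho>\<^sup>2 / (k / A)\<^sup>2) * I2"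
          unfolding Z_def I2_def using k AB by (intro kdiff_sum_bad_set[OF G \<rho> sub[OF cK] K'(2)[OF cK]]) simp
        then show "(case p of (c, j) \<Rightarrow> emeasure lborel (Z c j)) \<le> (case p of (c, j) \<Rightarrow> ennreal (995328 / \<rho>\<^sup>2 / (k / A)\<^sup>2) * I2)"
          by (simp add: p)
      qed (unfold Y_def I2_def, use k \<rho> in \<open>intro superlevel_L2_bound; auto\<close>)
      also have "(\<Sum>(c, j)\<in>D \<times> (UNIV :: 'n set). ennreal (995328 / \<rho>\<^sup>2 / (k / A)\<^sup>2) * I2) =
         ennreal (real (card D) * N * (995328 / \<rho>\<^sup>2 / (k / A)\<^sup>2)) * I2"
      proof -
        have "(\<Sum>(c, j)\<in>D \<times> (UNIV :: 'n set). ennreal (995328 / \<rho>\<^sup>2 / (k / A)\<^sup>2) * I2) =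
          ennreal (real (card D) * N) * (ennreal (995328 / \<rho>\<^sup>2 / (k / A)\<^sup>2) * I2)"
          by (simp add: N_def card_cartesian_product case_prod_beta' ennreal_of_nat_eq_real_of_nat)
        also have "\<dots> = ennreal (real (card D) * N * (995328 / \<rho>\<^sup>2 / (k / A)\<^sup>2)) * I2"
          using N by (subst ennreal_mult[of "real (card D) * N"]) (simp_all add: mult.assoc)
        finally show ?thesis .
      qed
      also have "\<dots> + ennreal (1 / (k * \<rho>)\<^sup>2) * I2 \<le> ennreal (C / k\<^sup>2) * I2"
      proof -
        have "real (card D) * N * (995328 / \<rho>\<^sup>2 / (k / A)\<^sup>2) + 1 / (k * \<rho>)\<^sup>2 = (real (card D) * N * (995328 / \<rho>\<^sup>2 * A\<^sup>2) + 1 / \<rho>\<^sup>2) / k\<^sup>2"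
          using k \<rho> AB by (simp add: field_simps power_divide power_mult_distrib)
        also have "\<dots> \<le> C / k\<^sup>2" by (intro divide_right_mono) (simp_all add: C_def)
        finally have "ennreal (real (card D) * N * (995328 / \<rho>\<^sup>2 / (k / A)\<^sup>2) + 1 / (k * \<rho>)\<^sup>2) \<le> ennreal (C / k\<^sup>2)"
          by (rule ennreal_leI)
        then have "(ennreal (real (card D) * N * (995328 / \<rho>\<^sup>2 / (k / A)\<^sup>2)) + ennreal (1 / (k * \<rho>)\<^sup>2)) * I2 \<le> ennreal (C / k\<^sup>2) * I2"
          using N by (intro mult_right_mono) (simp_all add: ennreal_plus[symmetric] del: ennreal_plus)
        then show ?thesis by (simp only: distrib_right)
      qed
      finally have meas: "emeasure lborel (\<omega> - E) \<le> ennreal (C / k\<^sup>2) * I2" .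
      have lipE: "G x \<le> G y + ennreal (k * dist x y)" if x: "x \<in> E" and y: "y \<in> E" for x y
      proof (cases "dist x y \<le> \<rho>")
        case True
        have xK: "x \<in> K" using x K(2) by (auto simp: E_def)
        have s: "(\<Sum>j\<in>UNIV. ?T j x) \<le> ennreal (k / B)"
        proof -
          have "(\<Sum>j\<in>UNIV. ?T j x) \<le> (\<Sum>j\<in>(UNIV :: 'n set). ennreal (k / A))"
            using x by (intro sum_mono) (auto simp: E_def)
          also have "\<dots> = ennreal (N * (k / A))"
            using k AB N by (subst ennreal_mult) (simp_all add: N_def ennreal_of_nat_eq_real_of_nat)
          also have "N * (k / A) = k / B" using N KL by (simp add: A_def B_def)
          finally show ?thesis .
        qed
        have i: "(\<integral>\<^sup>+z\<in>cball x \<rho>. G z \<partial>lborel) \<le> ennreal (k / B)"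
        proof -
          have "cball x \<rho> \<subseteq> K'" using K'(2)[OF xK] \<rho> by (auto simp: subset_iff)
          then have "(\<integral>\<^sup>+z\<in>cball x \<rho>. G z \<partial>lborel) \<le> I1"
            unfolding I1_def by (intro nn_integral_mono) (auto simp: indicator_def)
          then show ?thesis using I1 by simp
        qed
        have "cball x (3 * \<rho>) \<subseteq> \<Omega>" using sub[OF xK] \<rho> by (auto simp: subset_iff)
        from lip[OF G this True]
        have "G x \<le> G y + ennreal (KL * dist x y) * ((\<Sum>j\<in>UNIV. ?T j x) + (\<integral>\<^sup>+z\<in>cball x \<rho>. G z \<partial>lborel))" .
        also have "\<dots> \<le> G y + ennreal (KL * dist x y) * (ennreal (k / B) + ennreal (k / B))"
          by (intro add_left_mono mult_left_mono add_mono s i) simp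
        also have "ennreal (KL * dist x y) * (ennreal (k / B) + ennreal (k / B)) = ennreal (KL * dist x y * (2 * (k / B)))"
          using k AB KL by (simp add: ennreal_plus[symmetric] ennreal_mult[symmetric] del: ennreal_plus)
        also have "\<dots> \<le> ennreal (k * dist x y)"
        proof (rule ennreal_leI)
          have "KL * (2 * (k / B)) \<le> k" using k KL by (simp add: B_def field_simps)
          then have "KL * (2 * (k / B)) * dist x y \<le> k * dist x y" by (rule mult_right_mono) simp
          then show "KL * dist x y * (2 * (k / B)) \<le> k * dist x y" by (simp add: mult_ac)
        qed
        finally show ?thesis by (simp add: add_left_mono)
      next
        case False
        have "G x \<le> ennreal (k * \<rho>)" using x by (simp add: E_def)
        also have "\<dots> \<le> ennreal (k * dist x y)" using False k by (intro ennreal_leI mult_left_mono) auto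
        also have "\<dots> \<le> G y + ennreal (k * dist x y)" by (simp add: add_increasing)
        finally show ?thesis .
      qed
      have "\<forall>x\<in>E. G x < top"
        by (auto simp: E_def intro: le_less_trans)
      moreover have "E \<subseteq> \<omega>" by (auto simp: E_def)
      ultimately show ?thesis
        using E meas lipE unfolding I2_def by blast
    qed
  qed
  then show ?thesis using C by blast
qed

theorem theorem1p2:
  fixes \<Omega> \<omega> \<omega>' :: "(complex ^ 'n) set"
  assumes "open \<Omega>" and "connected \<Omega>"
    and "open \<omega>" and "\<omega> \<noteq> {}" and "relatively_compact_in \<omega> \<Omega>"
    and "open \<omega>'" and "\<omega>' \<noteq> {}" and "relatively_compact_in \<omega>' \<Omega>"
  shows "\<exists>C::real. C > 0 \<and>
    (\<forall>F :: complex ^ 'n \<Rightarrow> ereal.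
      (\<forall>x\<in>\<Omega>. F x < 0) \<and> separately_subharmonic_on \<Omega> F \<longrightarrow>
      (\<forall>k::real. k > 0 \<longrightarrow>
        (\<exists>L. compact L \<and> L \<subseteq> \<omega> \<and>
          (\<forall>x\<in>L. \<bar>F x\<bar> \<noteq> \<infinity>) \<and>
          k-lipschitz_on L (\<lambda>x. real_of_ereal (F x)) \<and>
          (\<forall>\<xi>\<in>\<omega>'. enn2ereal (emeasure lebesgue (\<omega> - L))
                     \<le> ereal (C / k\<^sup>2) * \<bar>F \<xi>\<bar>\<^sup>2))))"
proof -
  define K where "K = closure \<omega>"
  have K: "compact K" "K \<subseteq> \<Omega>" "\<omega> \<subseteq> K"
    using assms(5) closure_subset by (auto simp: relatively_compact_in_def K_def)
  obtain e where e: "0 < e" "(\<Union>x\<in>K. cball x e) \<subseteq> \<Omega>"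
    using compact_subset_open_imp_cball_epsilon_subset[OF K(1) assms(1) K(2)] by blast
  \<comment> \<open>Balls of radius \<open>10 * \<rho> = e\<close> about \<open>K\<close> stay in
    \<open>\<Omega>\<close>; half of this room goes to \<open>K'\<close>, which therefore is a
    compact subset of \<open>\<Omega>\<close>.\<close>
  define \<rho> where "\<rho> = e / 10"
  have \<rho>: "0 < \<rho>" using e by (simp add: \<rho>_def)
  have sub: "cball x (10 * \<rho>) \<subseteq> \<Omega>" if "x \<in> K" for x using e that by (auto simp: \<rho>_def)
  define K' where "K' = {x. infdist x K \<le> 5 * \<rho>}"
  have K0: "K \<noteq> {}" using assms(4) K by auto
  have K'c: "compact K'" unfolding K'_def by (rule compact_infdist_le) (use K0 K \<rho> in auto)
  have K'sub: "cball x (5 * \<rho>) \<subseteq> K'" if "x \<in> K" for x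
  proof
    fix y assume "y \<in> cball x (5 * \<rho>)"
    then show "y \<in> K'" using infdist_le[OF that, of y] by (simp add: K'_def dist_commute)
  qed
  have K'\<Omega>: "K' \<subseteq> \<Omega>"
  proof
    fix y assume y: "y \<in> K'"
    obtain x where x: "x \<in> K" "infdist y K = dist y x"
      using infdist_attains_inf[OF compact_imp_closed[OF K(1)] K0] by blast
    then have "y \<in> cball x (10 * \<rho>)" using y \<rho> by (simp add: K'_def dist_commute)
    then show "y \<in> \<Omega>" using sub[OF x(1)] by blast
  qed
  obtain C1 where C1: "0 \<le> C1" and main: "\<And>(G :: complex ^ 'n \<Rightarrow> ennreal) k. separately_superharmonic \<Omega> G \<Longrightarrow> 0 < k \<Longrightarrow>
    (\<exists>E. E \<in> sets borel \<and> E \<subseteq> \<omega> \<and>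
      emeasure lborel (\<omega> - E) \<le> ennreal (C1 / k\<^sup>2) * (\<integral>\<^sup>+x\<in>K'. (G x)\<^sup>2 \<partial>lborel) \<and>
      (\<forall>x\<in>E. G x < top) \<and>
      (\<forall>x\<in>E. \<forall>y\<in>E. G x \<le> G y + ennreal (k * dist x y)))"
    using superharmonic_lipschitz_off_small_set[OF assms(3) K(1,3) \<rho> sub K'c K'sub] by blast
  have "compact (closure \<omega>')" "closure \<omega>' \<subseteq> \<Omega>"
    using assms(8) by (auto simp: relatively_compact_in_def)
  from separately_superharmonic_L2_compact[OF assms(1,2) this K'c K'\<Omega>]
  obtain C2 where C2: "0 \<le> C2" and L2: "\<And>G \<xi>. separately_superharmonic \<Omega> G \<Longrightarrow> \<xi> \<in> closure \<omega>' \<Longrightarrow> (\<integral>\<^sup>+z\<in>K'. (G z)\<^sup>2 \<partial>lborel) \<le> ennreal C2 * (G \<xi>)\<^sup>2"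
    by blast
  \<comment> \<open>The 1 added to \<open>C1\<close> pays for passing from the Borel set
    \<open>E\<close> to a compact subset; the last 1 keeps \<open>C\<close> positive when
    \<open>C2\<close> is 0.\<close>
  define C where "C = (C1 + 1) * C2 + 1"
  have C: "0 < C" using C1 C2 by (simp add: C_def add_nonneg_pos)
  have "\<exists>L. compact L \<and> L \<subseteq> \<omega> \<and> (\<forall>x\<in>L. \<bar>F x\<bar> \<noteq> \<infinity>) \<and>
          k-lipschitz_on L (\<lambda>x. real_of_ereal (F x)) \<and>
          (\<forall>\<xi>\<in>\<omega>'. enn2ereal (emeasure lebesgue (\<omega> - L)) \<le> ereal (C / k\<^sup>2) * \<bar>F \<xi>\<bar>\<^sup>2)"
    if F: "\<forall>x\<in>\<Omega>. F x < 0" "separately_subharmonic_on \<Omega> F" and k: "0 < k" for F :: "complex ^ 'n \<Rightarrow> ereal" and k :: real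
  proof -
    define G where "G = neg_ext \<Omega> F"
    have G: "separately_superharmonic \<Omega> G"
      unfolding G_def using F by (intro separately_superharmonic_neg_ext assms(1)) auto
    note [measurable] = separately_superharmonic_measurable[OF G]
    have K'm: "K' \<in> sets borel" using K'c by (simp add: compact_imp_closed)
    define I2 where "I2 = (\<integral>\<^sup>+x\<in>K'. (G x)\<^sup>2 \<partial>lborel)"
    have Gpos: "0 < G x" if "x \<in> \<Omega>" for x
    proof -
      have "enn2ereal (G x) = - F x" using F that unfolding G_def by (intro enn2ereal_neg_ext) auto
      then have "enn2ereal 0 < enn2ereal (G x)" using F that by (simp add: zero_ennreal.rep_eq)
      then show ?thesis by (simp add: less_ennreal.rep_eq)
    qed
    \<comment> \<open>\<open>F\<close> is strictly negative, so \<open>G\<close> is positive on the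
      non-empty open set \<open>\<omega>\<close>. Positivity of \<open>I2\<close> leaves room for a
      set of positive measure to be lost in the inner approximation.\<close>
    have I2pos: "0 < I2"
    proof -
      have "I2 \<noteq> 0"
      proof
        assume "I2 = 0"
        then have "AE x in lborel. (G x)\<^sup>2 * indicator K' x = 0"
          unfolding I2_def using K'm by (subst (asm) nn_integral_0_iff_AE) auto
        then have "AE x in lborel. x \<notin> \<omega>"
        proof eventually_elim
          case (elim x)
          show ?case
          proof
            assume x: "x \<in> \<omega>"
            then have "x \<in> K'" using K'sub[of x] K(3) \<rho> by (auto simp: subset_iff)
            then have "G x = 0" using elim by simp
            then show False using Gpos[of x] x K by auto
          qed
        qed
        then have "\<omega> \<in> null_sets lborel"
          using assms(3) by (subst (asm) AE_iff_null) auto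
        then show False
          using open_not_negligible[OF assms(3,4)] by (simp add: negligible_iff_null_sets null_sets_completionI)
      qed
      then show ?thesis by (simp add: zero_less_iff_neq_zero)
    qed
    have bound: "enn2ereal (ennreal ((C1 + 1) / k\<^sup>2) * I2) \<le> ereal (C / k\<^sup>2) * \<bar>F \<xi>\<bar>\<^sup>2" if \<xi>: "\<xi> \<in> \<omega>'" for \<xi>
    proof -
      have \<xi>c: "\<xi> \<in> closure \<omega>'" using \<xi> closure_subset by blast
      then have \<xi>\<Omega>: "\<xi> \<in> \<Omega>" using assms(8) by (auto simp: relatively_compact_in_def)
      have "ennreal ((C1 + 1) / k\<^sup>2) * I2 \<le> ennreal ((C1 + 1) / k\<^sup>2) * (ennreal C2 * (G \<xi>)\<^sup>2)"
        unfolding I2_def by (intro mult_left_mono L2[OF G \<xi>c]) simp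
      also have "\<dots> = ennreal ((C1 + 1) / k\<^sup>2 * C2) * (G \<xi>)\<^sup>2"
        using C1 C2 by (subst ennreal_mult) (simp_all add: mult.assoc)
      also have "\<dots> \<le> ennreal (C / k\<^sup>2) * (G \<xi>)\<^sup>2"
        by (intro mult_right_mono ennreal_leI) (simp_all add: C_def divide_right_mono)
      finally have "enn2ereal (ennreal ((C1 + 1) / k\<^sup>2) * I2) \<le> enn2ereal (ennreal (C / k\<^sup>2) * (G \<xi>)\<^sup>2)"
        by (simp add: less_eq_ennreal.rep_eq)
      also have "\<dots> = ereal (C / k\<^sup>2) * (enn2ereal (G \<xi>))\<^sup>2"
        using C by (simp add: times_ennreal.rep_eq power2_eq_square)
      also have "enn2ereal (G \<xi>) = \<bar>F \<xi>\<bar>"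
      proof -
        have "enn2ereal (G \<xi>) = - F \<xi>" using F \<xi>\<Omega> unfolding G_def by (intro enn2ereal_neg_ext) auto
        then show ?thesis using F(1) \<xi>\<Omega> by (simp add: abs_ereal_less0)
      qed
      finally show ?thesis .
    qed
    obtain E where E: "E \<in> sets borel" "E \<subseteq> \<omega>" "emeasure lborel (\<omega> - E) \<le> ennreal (C1 / k\<^sup>2) * I2"
      and Efin: "\<And>x. x \<in> E \<Longrightarrow> G x < top" and Elip: "\<And>x y. x \<in> E \<Longrightarrow> y \<in> E \<Longrightarrow> G x \<le> G y + ennreal (k * dist x y)"
      using main[OF G k] unfolding I2_def by blast
    \<comment> \<open>\<open>I2\<close> may be infinite, hence the choice of a positive real number
      below the admissible loss.\<close>
    obtain d :: real where d: "0 < d" "ennreal d \<le> ennreal (1 / k\<^sup>2) * I2"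
    proof -
      have "0 < ennreal (1 / k\<^sup>2) * I2" using I2pos k by (simp add: ennreal_zero_less_mult_iff)
      then obtain q where q: "0 < q" "q < ennreal (1 / k\<^sup>2) * I2" using dense by blast
      then obtain r where "q = ennreal r" "0 \<le> r" by (cases q) auto
      then show ?thesis using that[of r] q by auto
    qed
    have "E \<in> sets lebesgue" using E(1) by simp
    from sets_lebesgue_inner_closed[OF this d(1)]
    obtain L where L: "closed L" "L \<subseteq> E" "emeasure lebesgue (E - L) < ennreal d" by metis
    have "bounded \<omega>" using K compact_imp_bounded bounded_subset by blast
    then have "compact L" using L E(2) by (meson bounded_subset compact_eq_bounded_closed order_trans)
    have meas: "emeasure lebesgue (\<omega> - L) \<le> ennreal ((C1 + 1) / k\<^sup>2) * I2"
    proof -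
      have "emeasure lebesgue (\<omega> - L) \<le> emeasure lebesgue (\<omega> - E) + emeasure lebesgue (E - L)"
      proof -
        have "\<omega> - L \<subseteq> (\<omega> - E) \<union> (E - L)" by auto
        then have "emeasure lebesgue (\<omega> - L) \<le> emeasure lebesgue ((\<omega> - E) \<union> (E - L))"
          using E(1) L(1) assms(3) by (intro emeasure_mono) auto
        also have "\<dots> \<le> emeasure lebesgue (\<omega> - E) + emeasure lebesgue (E - L)"
          using E(1) L(1) assms(3) by (intro emeasure_subadditive) auto
        finally show ?thesis .
      qed
      also have "emeasure lebesgue (\<omega> - E) = emeasure lborel (\<omega> - E)"
      proof -
        have "\<omega> - E \<in> sets lborel" using E(1) assms(3) by auto
        then show ?thesis by simp
      qed
      also have "emeasure lborel (\<omega> - E) + emeasure lebesgue (E - L) \<le> ennreal (C1 / k\<^sup>2) * I2 + ennreal (1 / k\<^sup>2) * I2"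
        using E(3) L(3) d(2) by (intro add_mono) auto
      also have "\<dots> = ennreal ((C1 + 1) / k\<^sup>2) * I2"
        using C1 by (simp add: add_divide_distrib distrib_right)
      finally show ?thesis .
    qed
    have in\<Omega>: "x \<in> \<Omega>" if "x \<in> L" for x using that L(2) E(2) K by auto
    have tr: "\<bar>F x\<bar> \<noteq> \<infinity>" "\<bar>real_of_ereal (F x) - real_of_ereal (F y)\<bar> \<le> k * dist x y" if "x \<in> L" "y \<in> L" for x y
    proof -
      have xy: "x \<in> E" "y \<in> E" using that L(2) by auto
      have F0: "F x < 0" "F y < 0" using F(1) in\<Omega> that by auto
      have le: "neg_ext \<Omega> F x \<le> neg_ext \<Omega> F y + ennreal (k * dist x y)" "neg_ext \<Omega> F y \<le> neg_ext \<Omega> F x + ennreal (k * dist x y)"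
        using Elip[OF xy] Elip[OF xy(2,1)] by (simp_all add: G_def dist_commute)
      have fin: "neg_ext \<Omega> F x < top" "neg_ext \<Omega> F y < top"
        using Efin xy by (auto simp: G_def)
      have nn: "0 \<le> k * dist x y" using k by simp
      show "\<bar>F x\<bar> \<noteq> \<infinity>" "\<bar>real_of_ereal (F x) - real_of_ereal (F y)\<bar> \<le> k * dist x y"
        using neg_ext_lipschitz_transfer[OF F0 in\<Omega>[OF that(1)] in\<Omega>[OF that(2)] fin nn le] by auto
    qed
    have "k-lipschitz_on L (\<lambda>x. real_of_ereal (F x))"
      using tr(2) k by (intro lipschitz_onI) (auto simp: dist_real_def)
    moreover have "enn2ereal (emeasure lebesgue (\<omega> - L)) \<le> ereal (C / k\<^sup>2) * \<bar>F \<xi>\<bar>\<^sup>2" if "\<xi> \<in> \<omega>'" for \<xi>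
      using meas bound[OF that] by (simp add: less_eq_ennreal.rep_eq)
    ultimately show ?thesis
      using \<open>compact L\<close> L(2) E(2) tr(1) by (intro exI[of _ L]) auto
  qed
  then show ?thesis using C by blast
qed

end
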